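(* Suppose Assumptions A1, A2, A3 (stated in the context) hold. Let $b_1>b_2>\cdots>b_n>0$ be $n$ numbers with $b_1>1$ and $$P(x)=x^{n+1}-b_1x^n+\sum_{i=1}^{n-1}(b_i-b_{i+1})x^{n-i}+b_n>0\quad\text{for all }x\in(1,b_1),$$ and suppose $f_j(x)=O(|x|^{b_j})+O(1)$ for $1\le j\le n$, i.e. there are constants $L_1,L_2>0$ such that $|f_j(x)|\le L_1+L_2|x|^{b_j}$ for all $x\in\mathbb{R}$ and $1\le j\le n$. Then the system $$y_{t+1}=\sum_{j=1}^n\theta_jf_j(y_t)+u_t+w_{t+1},\quad t\ge 0,$$ is almost surely globally stabilizable.
   Context: Setting: $n\ge2$; $\theta=(\theta_1,\ldots,\theta_n)^\tau\in\mathbb{R}^n$ is an unknown (random) parameter vector; $y_t,u_t,w_t\in\mathbb{R}$ are the output, input and noise signals; $\phi=(f_1,\ldots,f_n)^\tau:\mathbb{R}\to\mathbb{R}^n$ is a known measurable vector function, and $E\subset\mathbb{R}$ is an open set such that $f_j\in C^n(E)$ for $1\le j\le n$. Assumptions. A1: $\{w_t\}$ is an i.i.d. random sequence with $w_1\sim N(0,\sigma^2)$, $\sigma>0$. A2: $\theta\sim N(\theta_0,I_n)$ is independent of $\{w_t\}$. A3: $f_1,\ldots,f_n$ are linearly independent on $E$. Definition: the system is almost surely globally stabilizable if there exists a feedback control law $u_t\in\mathcal{F}_t^y:=\sigma\{y_i,0\le i\le t\}$, $t=0,1,\ldots$ (i.e. $u_t$ is $\mathcal{F}_t^y$-measurable),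 such that for any initial condition $y_0\in\mathbb{R}$, $\sup_{t\ge1}\frac1t\sum_{i=1}^ty_i^2<+\infty$ almost surely. *)

theory Defs
  imports "HOL-Probability.Probability"
begin

text \<open>Vectors of \<open>\<real>\<^sup>n\<close> are functions on the index set \<open>{1..n}\<close>, because \<open>n\<close> also occurs as an exponent
  and as an order of differentiability.  The noise signal is \<open>w\<^sub>1, w\<^sub>2, \<dots>\<close>; the value \<open>w 0\<close> is
  never used.\<close>

definition C_k_on :: "nat \<Rightarrow> (real \<Rightarrow> real) \<Rightarrow> real set \<Rightarrow> bool" where
  "C_k_on k f E \<longleftrightarrow>
     (\<forall>i<k. \<forall>x\<in>E. ((deriv ^^ i) f) field_differentiable (at x)) \<and>
     continuous_on E ((deriv ^^ k) f)"

definition lin_indep_on :: "nat \<Rightarrow> (nat \<Rightarrow> real \<Rightarrow> real) \<Rightarrow> real set \<Rightarrow> bool" where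
  "lin_indep_on n f E \<longleftrightarrow>
     (\<forall>c. (\<forall>x\<in>E. (\<Sum>j=1..n. c j * f j x) = 0) \<longrightarrow> (\<forall>j\<in>{1..n}. c j = 0))"

definition random_vector :: "nat \<Rightarrow> (nat \<Rightarrow> 'a \<Rightarrow> real) \<Rightarrow> 'a \<Rightarrow> nat \<Rightarrow> real" where
  "random_vector n \<theta> \<omega> = (\<lambda>j\<in>{1..n}. \<theta> j \<omega>)"

definition noise_sequence :: "(nat \<Rightarrow> 'a \<Rightarrow> real) \<Rightarrow> 'a \<Rightarrow> nat \<Rightarrow> real" where
  "noise_sequence w \<omega> = (\<lambda>t\<in>{1..}. w t \<omega>)"

text \<open>The density of \<open>N(m, I\<^sub>n)\<close> with respect to Lebesgue measure on \<open>\<real>\<^sup>n\<close>.\<close>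

definition std_cov_normal_density :: "nat \<Rightarrow> (nat \<Rightarrow> real) \<Rightarrow> (nat \<Rightarrow> real) \<Rightarrow> real" where
  "std_cov_normal_density n m x =
     1 / sqrt (2 * pi) ^ n * exp (- (\<Sum>j=1..n. (x j - m j)\<^sup>2) / 2)"

definition iid_normal_noise :: "'a measure \<Rightarrow> real \<Rightarrow> (nat \<Rightarrow> 'a \<Rightarrow> real) \<Rightarrow> bool" where
  "iid_normal_noise M \<sigma> w \<longleftrightarrow>
     prob_space.indep_vars M (\<lambda>_. borel) w {1..} \<and>
     (\<forall>t\<ge>1. distr M borel (w t) = distr M borel (w 1)) \<and>
     distributed M lborel (w 1) (\<lambda>x. ennreal (normal_density 0 \<sigma> x))"

definition normal_parameter ::
    "'a measure \<Rightarrow> nat \<Rightarrow> (nat \<Rightarrow> real) \<Rightarrow> (nat \<Rightarrow> 'a \<Rightarrow> real) \<Rightarrow> (nat \<Rightarrow> 'a \<Rightarrow> real) \<Rightarrow> bool" where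
  "normal_parameter M n \<theta>\<^sub>0 \<theta> w \<longleftrightarrow>
     distributed M (PiM {1..n} (\<lambda>_. lborel)) (random_vector n \<theta>)
       (\<lambda>x. ennreal (std_cov_normal_density n \<theta>\<^sub>0 x)) \<and>
     prob_space.indep_var M (PiM {1..n} (\<lambda>_. borel)) (random_vector n \<theta>)
                            (PiM {1..} (\<lambda>_. borel)) (noise_sequence w)"

definition output_sigma :: "'a measure \<Rightarrow> (nat \<Rightarrow> 'a \<Rightarrow> real) \<Rightarrow> nat \<Rightarrow> 'a measure" where
  "output_sigma M y t =
     sigma (space M) {y i -` B \<inter> space M | i B. i \<le> t \<and> B \<in> sets borel}"

definition system_trajectory ::
    "'a measure \<Rightarrow> nat \<Rightarrow> (nat \<Rightarrow> real \<Rightarrow> real) \<Rightarrow> (nat \<Rightarrow> 'a \<Rightarrow> real) \<Rightarrow> (nat \<Rightarrow> 'a \<Rightarrow> real) \<Rightarrow>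
     real \<Rightarrow> (nat \<Rightarrow> 'a \<Rightarrow> real) \<Rightarrow> (nat \<Rightarrow> 'a \<Rightarrow> real) \<Rightarrow> bool" where
  "system_trajectory M n f \<theta> w y\<^sub>0 u y \<longleftrightarrow>
     (\<forall>\<omega>\<in>space M. y 0 \<omega> = y\<^sub>0 \<and>
        (\<forall>t. y (Suc t) \<omega> = (\<Sum>j=1..n. \<theta> j \<omega> * f j (y t \<omega>)) + u t \<omega> + w (Suc t) \<omega>))"

text \<open>A feedback law is a family of Borel functions \<open>h\<^sub>t\<close> on output histories, chosen once for all
  initial conditions; since its arguments are only \<open>y\<^sub>0, \<dots>, y\<^sub>t\<close>, it has no access to \<open>\<theta>\<close> or \<open>w\<close>.
  Adaptedness of the resulting signal \<open>u\<close> to the output \<open>\<sigma>\<close>-algebras follows from this, and is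
  stated because it is the usual requirement on \<open>u\<close>.  Given \<open>h\<close> and \<open>y\<^sub>0\<close>, the signals \<open>u\<close> and
  \<open>y\<close> are uniquely determined on the probability space.\<close>

definition as_globally_stabilizable ::
    "'a measure \<Rightarrow> nat \<Rightarrow> (nat \<Rightarrow> real \<Rightarrow> real) \<Rightarrow> (nat \<Rightarrow> 'a \<Rightarrow> real) \<Rightarrow> (nat \<Rightarrow> 'a \<Rightarrow> real) \<Rightarrow> bool"
  where
  "as_globally_stabilizable M n f \<theta> w \<longleftrightarrow>
     (\<exists>h :: nat \<Rightarrow> (nat \<Rightarrow> real) \<Rightarrow> real.
        (\<forall>t. h t \<in> borel_measurable (PiM {..t} (\<lambda>_. borel))) \<and>
        (\<forall>y\<^sub>0 :: real. \<exists>u y.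
           system_trajectory M n f \<theta> w y\<^sub>0 u y \<and>
           (\<forall>t. \<forall>\<omega>\<in>space M. u t \<omega> = h t (\<lambda>i\<in>{..t}. y i \<omega>)) \<and>
           (\<forall>t. u t \<in> borel_measurable (output_sigma M y t)) \<and>
           (AE \<omega> in M. (SUP t\<in>{1..}. ereal (1 / real t * (\<Sum>i=1..t. (y i \<omega>)\<^sup>2))) < \<infinity>)))"

end

theory Submission
  imports Defs "Jordan_Normal_Form.Determinant" "HOL-Real_Asymp.Real_Asymp"
begin

text \<open>
  The controller predicts \<open>\<theta> \<cdot> \<phi>(y\<^sub>t)\<close> by writing \<open>\<phi>(y\<^sub>t)\<close> as a linear combination of \<open>n\<close> known rows,
  with Cramer coefficients.  The rows are taken from the last \<open>K\<close> regressors and the unit vectors, so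
  as to minimise the sum of the absolute coefficients.  Comparing with a tuple of maximal determinant,
  \<open>log |y\<^sub>t\<^sub>+\<^sub>1|\<close> is at most a noise term plus the logarithm of a ratio of maximal minors; these ratios
  telescope, and a minor built from the times in \<open>U\<close> is bounded through the growth exponents \<open>b\<^sub>j\<close> by a
  weighted matching of \<open>log |y|\<close> on \<open>U\<close>.  Applied to the successive record values of \<open>log |y|\<close>, this
  gives a linear recursion with characteristic polynomial \<open>P\<close>; as \<open>P\<close> has no zero in \<open>[1, \<infinity>)\<close>, the
  number of records in a window is bounded, and \<open>log |y|\<close> contracts over long windows.  Hence the
  averages of \<open>log |y|\<close> stay bounded and \<open>log |y\<^sub>t| = o(log t)\<close>.

  Consequently the conditional mean of \<open>y\<^sub>t\<^sub>+\<^sub>1\<close> is bounded half of the time, and by Gaussianity the outputs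
  visit fixed neighbourhoods \<open>B\<^sub>r\<close> of \<open>n\<close> points with linearly independent regressors linearly often.
  The sums of the regressors over these visits then have coefficients of size \<open>t powr (-3/4)\<close>, while the
  sums of the noises are \<open>O(t powr (5/8))\<close>.  Predicting with these pooled rows as soon as their
  coefficients are small makes the prediction error bounded.

  The probabilistic facts are proved for fixed \<open>\<theta>\<close> with exponential supermartingales, and Fubini's
  theorem passes to the random \<open>\<theta>\<close>.
\<close>

section \<open>Cramer coefficients and maximal minors\<close>

text \<open>Past regressors may be almost collinear, so no estimate of \<theta> need be accurate;
  only \<theta> \<cdot> \<phi>(y_t) has to be predicted, and a predictor is judged by the size of
  its coefficients. A Cramer coefficient is a quotient of minors with one row exchanged, hence at
  most the growth of the maximal minor when the new row is added. The cheapest tuple competes with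
  the maximal tuple of every subset U of the window at once; so U may be chosen afterwards, as the
  times just before records, although the controller cannot know them. The unit rows keep all these
  maximal minors at least 1.

  For increasing records r_0, r_1, ... with partial sums S_m, summation by parts of the exponents
  turns the matching bound into S_(m+1) \<le> 2 r_0 + b_1 S_m - sum_i \<beta>_i S_(m-i). The
  geometric ansatz S_m = x^m yields P; partial sums never decrease, which is why only x \<ge> 1
  matters.

  All this controls only ln |y|. Square averages need the second predictor, whose rates leave room
  on both sides: its coefficients are eventually O(t powr (1/16 - 1)), and -3/4 + 5/8 < 0.\<close>

definition rdet :: "nat \<Rightarrow> (nat \<Rightarrow> nat \<Rightarrow> real) \<Rightarrow> real" where
  "rdet n V = det (Matrix.mat n n (\<lambda>(i, j). V j i))"

text \<open>The vectors \<open>V r\<close> are the columns of the matrix in \<open>rdet\<close>, so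
  this is Cramer's rule in column form: the coefficient of \<open>V r\<close> in the expansion of
  \<open>p\<close>.\<close>

definition cramer :: "nat \<Rightarrow> (nat \<Rightarrow> nat \<Rightarrow> real) \<Rightarrow> (nat \<Rightarrow> real) \<Rightarrow> nat \<Rightarrow> real" where
  "cramer n V p r = rdet n (V(r := p)) / rdet n V"

lemma rdet_leibniz:
  "rdet n V = (\<Sum>p | p permutes {0..<n}. signof p * (\<Prod>i=0..<n. V (p i) i))"
proof -
  have "rdet n V = (\<Sum>p | p permutes {0..<n}. signof p * (\<Prod>i=0..<n. Matrix.mat n n (\<lambda>(i, j). V j i) $$ (i, p i)))"
    unfolding rdet_def by (rule det_def') auto
  also have "\<dots> = (\<Sum>p | p permutes {0..<n}. signof p * (\<Prod>i=0..<n. V (p i) i))"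
  proof (rule sum.cong[OF refl])
    fix p assume "p \<in> {p. p permutes {0..<n}}"
    hence p: "p permutes {0..<n}" by simp
    have "p i < n" if "i < n" for i
      using permutes_in_image[OF p, of i] that by simp
    thus "signof p * (\<Prod>i=0..<n. Matrix.mat n n (\<lambda>(i, j). V j i) $$ (i, p i))
        = signof p * (\<Prod>i=0..<n. V (p i) i)"
      by (auto intro!: prod.cong arg_cong2[of _ _ _ _ "(*)"])
  qed
  finally show ?thesis .
qed

lemma rdet_cong: "(\<And>r j. r < n \<Longrightarrow> j < n \<Longrightarrow> V r j = W r j) \<Longrightarrow> rdet n V = rdet n W"
  unfolding rdet_def by (rule arg_cong[of _ _ det]) (auto intro!: eq_matI)

lemma cramer_cong:
  "(\<And>r j. r < n \<Longrightarrow> j < n \<Longrightarrow> V r j = W r j) \<Longrightarrow> (\<And>j. j < n \<Longrightarrow> p j = q j) \<Longrightarrow>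
    cramer n V p r = cramer n W q r"
  unfolding cramer_def by (intro arg_cong2[of _ _ _ _ "(/)"] rdet_cong) auto

lemma rdet_unit: "rdet n (\<lambda>r j. if j = r then 1 else 0) = 1"
proof -
  have "Matrix.mat n n (\<lambda>(i, j). (if i = j then 1 else 0 :: real)) = 1\<^sub>m n"
    by (auto intro!: eq_matI)
  thus ?thesis unfolding rdet_def by simp
qed

lemma rdet_repeated:
  assumes "r < n" "s < n" "r \<noteq> s" "\<And>j. j < n \<Longrightarrow> V r j = V s j"
  shows "rdet n V = 0"
  unfolding rdet_def
  by (rule det_identical_columns[of _ n r s]) (use assms in \<open>auto intro!: eq_vecI\<close>)

text \<open>The adjugate solves the linear system, and Cramer's rule identifies the coordinates of
  the solution with quotients of determinants.\<close>

lemma cramer_expansion: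
  assumes nz: "rdet n V \<noteq> 0" and j: "j < n"
  shows "(\<Sum>r<n. cramer n V p r * V r j) = p j"
proof -
  define A where "A = Matrix.mat n n (\<lambda>(i, j). V j i)"
  have A: "A \<in> carrier_mat n n" by (simp add: A_def)
  define P where "P = Matrix.vec n p"
  have P: "P \<in> carrier_vec n" by (simp add: P_def)
  have dA: "det A = rdet n V" by (simp add: A_def rdet_def)
  have aA: "adj_mat A \<in> carrier_mat n n" using adj_mat(1)[OF A] .
  define x where "x = (1 / det A) \<cdot>\<^sub>v (adj_mat A *\<^sub>v P)"
  have x: "x \<in> carrier_vec n" using aA P by (simp add: x_def)
  have "A *\<^sub>v x = (1 / det A) \<cdot>\<^sub>v (A *\<^sub>v (adj_mat A *\<^sub>v P))"
    unfolding x_def using A aA P by (simp add: mult_mat_vec)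
  also have "A *\<^sub>v (adj_mat A *\<^sub>v P) = (A * adj_mat A) *\<^sub>v P"
    using A aA P by (simp add: assoc_mult_mat_vec)
  also have "\<dots> = det A \<cdot>\<^sub>v P"
    unfolding adj_mat(2)[OF A] using P by auto
  finally have Ax: "A *\<^sub>v x = P" using nz dA by (auto simp: smult_smult_assoc)
  have xk: "x $ k = cramer n V p k" if k: "k < n" for k
  proof -
    have "det (replace_col A P k) = x $ k * det A"
      using cramer_lemma_mat[OF A x k] Ax by simp
    moreover have "replace_col A P k = Matrix.mat n n (\<lambda>(i, j). (V(k := p)) j i)"
      using k by (auto simp: replace_col_def A_def P_def intro!: eq_matI)
    ultimately show ?thesis using nz dA by (simp add: cramer_def rdet_def field_simps)
  qed
  have "p j = (A *\<^sub>v x) $ j" using Ax j by (simp add: P_def)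
  also have "\<dots> = (\<Sum>r=0..<n. A $$ (j, r) * x $ r)"
    using j A x by (auto simp: scalar_prod_def intro!: sum.cong)
  also have "\<dots> = (\<Sum>r<n. cramer n V p r * V r j)"
    using j xk by (auto simp: A_def lessThan_atLeast0 intro!: sum.cong)
  finally show ?thesis ..
qed

lemma abs_rdet_le:
  assumes "\<And>p. p permutes {0..<n} \<Longrightarrow> (\<Prod>i=0..<n. \<bar>V (p i) i\<bar>) \<le> C"
  shows "\<bar>rdet n V\<bar> \<le> fact n * C"
proof -
  have "\<bar>rdet n V\<bar> \<le> (\<Sum>p | p permutes {0..<n}. \<bar>signof p * (\<Prod>i=0..<n. V (p i) i)\<bar>)"
    unfolding rdet_leibniz by (rule sum_abs)
  also have "\<dots> \<le> (\<Sum>p | p permutes {0..<n}. C)"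
  proof (rule sum_mono)
    fix p assume "p \<in> {p. p permutes {0..<n}}"
    moreover have "\<bar>signof p :: real\<bar> = 1" by (simp add: sign_def)
    ultimately show "\<bar>signof p * (\<Prod>i=0..<n. V (p i) i)\<bar> \<le> C"
      using assms[of p] by (simp add: abs_mult abs_prod)
  qed
  also have "\<dots> = fact n * C" by (simp add: card_permutations)
  finally show ?thesis .
qed

section \<open>Maximal minors over a set of rows\<close>

definition tuples :: "nat \<Rightarrow> nat set \<Rightarrow> nat list set" where
  "tuples n I = {\<tau>. set \<tau> \<subseteq> I \<and> length \<tau> = n}"

text \<open>Tuples may repeat an index, so exchanging one entry never leaves the set of tuples; a
  repetition merely gives determinant 0, and reordering only changes a sign.\<close>

definition max_minor :: "nat \<Rightarrow> (nat \<Rightarrow> nat \<Rightarrow> real) \<Rightarrow> nat set \<Rightarrow> real" where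
  "max_minor n R I = Max ((\<lambda>\<tau>. \<bar>rdet n (\<lambda>r. R (\<tau> ! r))\<bar>) ` tuples n I)"

text \<open>The unit rows provide the minor 1. Maximal minors over index sets containing them are
  therefore at least 1: maximal tuples are nonsingular and the logarithms are nonnegative.\<close>

locale unit_rows =
  fixes n :: nat and R :: "nat \<Rightarrow> nat \<Rightarrow> real"
  assumes unit: "k < n \<Longrightarrow> j < n \<Longrightarrow> R k j = (if j = k then 1 else 0)"
begin

lemma max_minor_ge:
  assumes "finite I" "\<tau> \<in> tuples n I"
  shows "\<bar>rdet n (\<lambda>r. R (\<tau> ! r))\<bar> \<le> max_minor n R I"
  unfolding max_minor_def using assms
  by (intro Max_ge) (auto simp: tuples_def intro!: finite_imageI finite_lists_length_eq)

lemma max_minor_attained: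
  assumes "finite I" "{..<n} \<subseteq> I"
  obtains \<tau> where "\<tau> \<in> tuples n I" "\<bar>rdet n (\<lambda>r. R (\<tau> ! r))\<bar> = max_minor n R I"
proof -
  have "[0..<n] \<in> tuples n I" using assms(2) by (auto simp: tuples_def)
  hence ne: "(\<lambda>\<tau>. \<bar>rdet n (\<lambda>r. R (\<tau> ! r))\<bar>) ` tuples n I \<noteq> {}" by blast
  have fin: "finite ((\<lambda>\<tau>. \<bar>rdet n (\<lambda>r. R (\<tau> ! r))\<bar>) ` tuples n I)"
    using assms(1) by (auto simp: tuples_def intro!: finite_imageI finite_lists_length_eq)
  from Max_in[OF fin ne] show ?thesis using that unfolding max_minor_def by auto
qed

lemma max_minor_ge_1:
  assumes "finite I" "{..<n} \<subseteq> I"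
  shows "1 \<le> max_minor n R I"
proof -
  have t: "[0..<n] \<in> tuples n I" using assms(2) by (auto simp: tuples_def)
  have "rdet n (\<lambda>r. R ([0..<n] ! r)) = rdet n (\<lambda>r j. if j = r then 1 else 0)"
    by (rule rdet_cong) (auto simp: unit)
  thus ?thesis using max_minor_ge[OF assms(1) t] by (simp add: rdet_unit)
qed

text \<open>Take \<open>\<tau>\<close> with maximal minor over \<open>I\<close>. The numerator of
  its Cramer coefficient is the minor of \<open>\<tau>[r := k]\<close>, a tuple over
  \<open>insert k I\<close>.\<close>

lemma cramer_le_max_minor_ratio:
  assumes "finite I" "{..<n} \<subseteq> I"
  obtains \<tau> where "\<tau> \<in> tuples n I" "rdet n (\<lambda>r. R (\<tau> ! r)) \<noteq> 0"
    "\<And>r. r < n \<Longrightarrow> \<bar>cramer n (\<lambda>r. R (\<tau> ! r)) (R k) r\<bar> \<le> max_minor n R (insert k I) / max_minor n R I"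
proof -
  obtain \<tau> where \<tau>: "\<tau> \<in> tuples n I" "\<bar>rdet n (\<lambda>r. R (\<tau> ! r))\<bar> = max_minor n R I"
    using max_minor_attained[OF assms] .
  have ge1: "1 \<le> max_minor n R I" using max_minor_ge_1[OF assms] .
  show ?thesis
  proof
    show "\<tau> \<in> tuples n I" by fact
    show "rdet n (\<lambda>r. R (\<tau> ! r)) \<noteq> 0" using \<tau>(2) ge1 by auto
    fix r assume r: "r < n"
    have len: "length \<tau> = n" using \<tau>(1) by (simp add: tuples_def)
    have t: "\<tau>[r := k] \<in> tuples n (insert k I)"
      using \<tau>(1) set_update_subset_insert[of \<tau> r k] by (auto simp: tuples_def)
    have "rdet n ((\<lambda>r. R (\<tau> ! r))(r := R k)) = rdet n (\<lambda>i. R (\<tau>[r := k] ! i))"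
      using r len by (intro rdet_cong) (auto simp: nth_list_update)
    hence "\<bar>rdet n ((\<lambda>r. R (\<tau> ! r))(r := R k))\<bar> \<le> max_minor n R (insert k I)"
      using max_minor_ge[OF _ t] assms(1) by simp
    thus "\<bar>cramer n (\<lambda>r. R (\<tau> ! r)) (R k) r\<bar> \<le> max_minor n R (insert k I) / max_minor n R I"
      unfolding cramer_def abs_divide \<tau>(2) using ge1 by (intro divide_right_mono) auto
  qed
qed

text \<open>Each permutation in the Leibniz expansion pairs columns with rows. Columns paired with
  unit rows contribute at most 1; the others, collected in \<open>J\<close>, are matched injectively
  with times by \<open>g\<close>, and their product has the exponent that \<open>H\<close>
  bounds.\<close>

lemma max_minor_le:
  fixes b :: "nat \<Rightarrow> real"
  assumes I: "finite I" "{..<n} \<subseteq> I" and L: "L \<ge> 1"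
    and bnd: "\<And>k j. k \<in> I \<Longrightarrow> n \<le> k \<Longrightarrow> j < n \<Longrightarrow> \<bar>R k j\<bar> \<le> L * exp (b j * x (k - n))"
    and H: "\<And>J g. J \<subseteq> {..<n} \<Longrightarrow> inj_on g J \<Longrightarrow> g ` J \<subseteq> {i. n + i \<in> I} \<Longrightarrow> (\<Sum>j\<in>J. b j * x (g j)) \<le> H"
  shows "max_minor n R I \<le> fact n * (L ^ n * exp H)"
proof -
  obtain \<tau> where \<tau>: "\<tau> \<in> tuples n I" "\<bar>rdet n (\<lambda>r. R (\<tau> ! r))\<bar> = max_minor n R I"
    using max_minor_attained[OF I] .
  have len: "length \<tau> = n" and sub: "set \<tau> \<subseteq> I" using \<tau>(1) by (auto simp: tuples_def)
  \<comment> \<open>A repetition would make the maximal minor 0. Distinctness is what makes the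
    matching \<open>g\<close> injective.\<close>
  have dist: "distinct \<tau>"
  proof (rule ccontr)
    assume "\<not> distinct \<tau>"
    then obtain r s where "r < n" "s < n" "r \<noteq> s" "\<tau> ! r = \<tau> ! s"
      using len by (auto simp: distinct_conv_nth)
    hence "rdet n (\<lambda>r. R (\<tau> ! r)) = 0" by (intro rdet_repeated[of r n s]) auto
    thus False using \<tau>(2) max_minor_ge_1[OF I] by simp
  qed
  have "\<bar>rdet n (\<lambda>r. R (\<tau> ! r))\<bar> \<le> fact n * (L ^ n * exp H)"
  proof (rule abs_rdet_le)
    fix p assume p: "p permutes {0..<n}"
    have pn: "p i < n" if "i < n" for i using permutes_in_image[OF p, of i] that by simp
    define J where "J = {i. i < n \<and> n \<le> \<tau> ! p i}"
    define g where "g = (\<lambda>i. \<tau> ! p i - n)"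
    have mem: "\<tau> ! p i \<in> I" if "i < n" for i using pn[OF that] sub len by auto
    have inj: "inj_on g J"
    proof (rule inj_onI)
      fix i i' assume ii: "i \<in> J" "i' \<in> J" "g i = g i'"
      hence "\<tau> ! p i = \<tau> ! p i'" unfolding J_def g_def
        using eq_diff_iff by auto
      hence "p i = p i'" using dist len pn ii by (auto simp: J_def nth_eq_iff_index_eq)
      thus "i = i'" using permutes_inj[OF p] by (simp add: inj_eq)
    qed
    have HJ: "(\<Sum>j\<in>J. b j * x (g j)) \<le> H"
      by (rule H) (use inj mem in \<open>auto simp: J_def g_def\<close>)
    have finJ: "finite J" and Jsub: "J \<subseteq> {0..<n}" by (auto simp: J_def)
    have "(\<Prod>i=0..<n. \<bar>R (\<tau> ! p i) i\<bar>)
        \<le> (\<Prod>i=0..<n. L * (if i \<in> J then exp (b i * x (g i)) else 1))"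
    proof (rule prod_mono, safe)
      fix i assume i: "i \<in> {0..<n}"
      show "0 \<le> \<bar>R (\<tau> ! p i) i\<bar>" by simp
      show "\<bar>R (\<tau> ! p i) i\<bar> \<le> L * (if i \<in> J then exp (b i * x (g i)) else 1)"
      proof (cases "i \<in> J")
        case True
        thus ?thesis using bnd[OF mem, of i i] by (auto simp: J_def g_def)
      next
        case False
        thus ?thesis using i L by (auto simp: J_def unit)
      qed
    qed
    also have "\<dots> = L ^ n * (\<Prod>i=0..<n. (if i \<in> J then exp (b i * x (g i)) else 1))"
      by (simp add: prod.distrib)
    also have "(\<Prod>i=0..<n. (if i \<in> J then exp (b i * x (g i)) else 1)) = exp (\<Sum>j\<in>J. b j * x (g j))"
      unfolding exp_sum[OF finJ] using Jsub
      by (subst prod.inter_restrict[symmetric]) (auto simp: Int_absorb1)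
    also have "L ^ n * \<dots> \<le> L ^ n * exp H" using HJ L by (intro mult_left_mono) auto
    finally show "(\<Prod>i=0..<n. \<bar>R (\<tau> ! p i) i\<bar>) \<le> L ^ n * exp H" .
  qed
  thus ?thesis using \<tau>(2) by simp
qed

end

section \<open>Record values and contracting windows\<close>

text \<open>Induction on \<open>k\<close>: the largest index of \<open>A\<close> contributes at most
  the top term, and the rest of \<open>A\<close> lies below it. For \<open>m \<ge> k\<close>
  truncated subtraction makes the right side the full sum.\<close>

lemma sum_le_top_sum:
  fixes r :: "nat \<Rightarrow> real"
  assumes nonneg: "\<And>i. i < k \<Longrightarrow> 0 \<le> r i"
    and mono: "\<And>i j. i \<le> j \<Longrightarrow> j < k \<Longrightarrow> r i \<le> r j"
    and "A \<subseteq> {..<k}" "card A \<le> m"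
  shows "sum r A \<le> sum r {..<k} - sum r {..<k - m}"
  using assms
proof (induction k arbitrary: A m)
  case 0
  then show ?case by simp
next
  case (Suc k)
  have finA: "finite A" using Suc.prems(3) finite_subset by blast
  show ?case
  proof (cases m)
    case 0
    thus ?thesis using Suc.prems(4) finA by simp
  next
    case [simp]: (Suc m')
    show ?thesis
    proof (cases "A = {}")
      case True
      have "sum r {..<Suc k - m} \<le> sum r {..<Suc k}"
        by (rule sum_mono2) (use Suc.prems(1) in auto)
      thus ?thesis using True by simp
    next
      case False
      define a where "a = Max A"
      have a: "a \<in> A" using finA False by (simp add: a_def)
      have ak: "a \<le> k" using a Suc.prems(3) by auto
      have sub: "A - {a} \<subseteq> {..<k}"
      proof
        fix i assume i: "i \<in> A - {a}"
        hence "i \<le> a" using finA by (simp add: a_def)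
        thus "i \<in> {..<k}" using i ak by auto
      qed
      have "card (A - {a}) \<le> m'" using a finA Suc.prems(4) by simp
      hence "sum r (A - {a}) \<le> sum r {..<k} - sum r {..<k - m'}"
        using Suc.IH[OF _ _ sub] Suc.prems(1,2) by simp
      moreover have "sum r A = r a + sum r (A - {a})"
        using a finA by (simp add: sum.remove)
      moreover have "r a \<le> r k" using Suc.prems(2)[OF ak] by simp
      ultimately show ?thesis by simp
    qed
  qed
qed

section \<open>Growth exponents and the characteristic polynomial\<close>

locale exponents =
  fixes n :: nat and b :: "nat \<Rightarrow> real"
  assumes n_pos: "n \<ge> 1"
    and b_dec: "\<And>i. Suc i < n \<Longrightarrow> b (Suc i) < b i"
    and b_last: "b (n - 1) > 0" and b_0: "b 0 > 1"
    and P_pos: "\<And>x. 1 < x \<Longrightarrow> x < b 0 \<Longrightarrow>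
      0 < x ^ (n + 1) - b 0 * x ^ n + (\<Sum>i=1..n-1. (b (i - 1) - b i) * x ^ (n - i)) + b (n - 1)"
begin

text \<open>Consecutive differences of the exponents, closed off by 0 after the last one. As
  \<open>b\<close> is indexed from 0 here, \<open>\<beta> i\<close> is the coefficient of
  \<open>x ^ (n - i)\<close> that \<open>P\<close> has besides its two leading terms.\<close>

definition \<beta> :: "nat \<Rightarrow> real" where
  "\<beta> i = (if i = n then b (n - 1) else b (i - 1) - b i)"

lemma beta_pos: "1 \<le> i \<Longrightarrow> i \<le> n \<Longrightarrow> 0 < \<beta> i"
  using b_dec[of "i - 1"] b_last by (auto simp: \<beta>_def)

lemma b_eq_sum_beta: "j < n \<Longrightarrow> b j = (\<Sum>i\<in>{Suc j..n}. \<beta> i)"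
proof (induction "n - j" arbitrary: j)
  case 0
  then show ?case by simp
next
  case (Suc d)
  show ?case
  proof (cases "Suc j = n")
    case True
    thus ?thesis by (auto simp: \<beta>_def)
  next
    case False
    hence "Suc j < n" using Suc.prems by simp
    moreover have "{Suc j..n} = insert (Suc j) {Suc (Suc j)..n}" using Suc.prems by auto
    ultimately show ?thesis using Suc.hyps(1)[of "Suc j"] Suc.hyps(2) False by (simp add: \<beta>_def)
  qed
qed

lemma b_pos: "j < n \<Longrightarrow> 0 < b j"
  unfolding b_eq_sum_beta by (intro sum_pos) (auto intro!: beta_pos)

text \<open>Positivity is assumed only strictly between 1 and \<open>b 0\<close>. At 1 the
  differences add up to \<open>b 0\<close> and the value is 1; from \<open>b 0\<close> on, the two
  leading terms together are nonnegative.\<close>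

lemma char_poly_pos:
  assumes "x \<ge> 1"
  shows "0 < x ^ (n + 1) - b 0 * x ^ n + (\<Sum>i\<in>{1..n}. \<beta> i * x ^ (n - i))"
proof -
  have split: "{1..n} = insert n {1..n-1}" using n_pos by auto
  have eq: "(\<Sum>i\<in>{1..n}. \<beta> i * x ^ (n - i))
      = (\<Sum>i=1..n-1. (b (i - 1) - b i) * x ^ (n - i)) + b (n - 1)"
    unfolding split using n_pos by (subst sum.insert) (auto simp: \<beta>_def intro!: sum.cong)
  consider "x = 1" | "1 < x" "x < b 0" | "x \<ge> b 0" using assms by linarith
  thus ?thesis
  proof cases
    case 1
    have "b 0 = (\<Sum>i\<in>{1..n}. \<beta> i)" using b_eq_sum_beta[of 0] n_pos by simp
    thus ?thesis using 1 by simp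
  next
    case 2
    show ?thesis using P_pos[OF 2] eq by simp
  next
    case 3
    have "0 < (\<Sum>i\<in>{1..n}. \<beta> i * x ^ (n - i))"
      using n_pos assms by (intro sum_pos) (auto intro!: mult_pos_pos beta_pos)
    moreover have "x ^ (n + 1) - b 0 * x ^ n = (x - b 0) * x ^ n" by (simp add: algebra_simps)
    moreover have "(x - b 0) * x ^ n \<ge> 0" using 3 assms by simp
    ultimately show ?thesis by linarith
  qed
qed

text \<open>Summation by parts: \<open>b j\<close> is the sum of \<open>\<beta> i\<close> over
  \<open>i > j\<close>, so \<open>\<beta> i\<close> multiplies a sum of \<open>r\<close> over at
  most \<open>i\<close> distinct indices, and the top \<open>i\<close> values bound it.\<close>

lemma matching_le:
  fixes r :: "nat \<Rightarrow> real"
  assumes nonneg: "\<And>i. i < k \<Longrightarrow> 0 \<le> r i"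
    and mono: "\<And>i j. i \<le> j \<Longrightarrow> j < k \<Longrightarrow> r i \<le> r j"
    and J: "J \<subseteq> {..<n}" and g: "inj_on g J" "g ` J \<subseteq> {..<k}"
  shows "(\<Sum>j\<in>J. b j * r (g j)) \<le> (\<Sum>i\<in>{1..n}. \<beta> i * (sum r {..<k} - sum r {..<k - i}))"
proof -
  have finJ: "finite J" using J finite_subset by blast
  have "(\<Sum>j\<in>J. b j * r (g j)) = (\<Sum>j\<in>J. \<Sum>i\<in>{1..n}. if j < i then \<beta> i * r (g j) else 0)"
  proof (rule sum.cong[OF refl])
    fix j assume "j \<in> J"
    hence "j < n" using J by auto
    have "{i \<in> {1..n}. j < i} = {Suc j..n}" by auto
    thus "b j * r (g j) = (\<Sum>i\<in>{1..n}. if j < i then \<beta> i * r (g j) else 0)"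
      using b_eq_sum_beta[OF \<open>j < n\<close>]
      by (simp add: sum.inter_filter[symmetric] sum_distrib_right)
  qed
  also have "\<dots> = (\<Sum>i\<in>{1..n}. \<Sum>j\<in>J. if j < i then \<beta> i * r (g j) else 0)"
    by (rule sum.swap)
  also have "\<dots> = (\<Sum>i\<in>{1..n}. \<beta> i * (\<Sum>j\<in>{j\<in>J. j < i}. r (g j)))"
    using finJ by (simp add: sum.inter_filter[symmetric] sum_distrib_left)
  also have "\<dots> \<le> (\<Sum>i\<in>{1..n}. \<beta> i * (sum r {..<k} - sum r {..<k - i}))"
  proof (intro sum_mono mult_left_mono)
    fix i assume i: "i \<in> {1..n}"
    have inj: "inj_on g {j\<in>J. j < i}" using g(1) by (auto intro: inj_on_subset)
    have "(\<Sum>j\<in>{j\<in>J. j < i}. r (g j)) = sum r (g ` {j\<in>J. j < i})"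
      using sum.reindex[OF inj, of r] by simp
    also have "\<dots> \<le> sum r {..<k} - sum r {..<k - i}"
    proof (rule sum_le_top_sum[OF nonneg mono])
      show "g ` {j\<in>J. j < i} \<subseteq> {..<k}" using g(2) by auto
      have "card (g ` {j\<in>J. j < i}) \<le> card {j\<in>J. j < i}" using finJ by (intro card_image_le) auto
      also have "\<dots> \<le> card {..<i}" by (intro card_mono) auto
      finally show "card (g ` {j\<in>J. j < i}) \<le> i" by simp
    qed auto
    finally show "(\<Sum>j\<in>{j\<in>J. j < i}. r (g j)) \<le> sum r {..<k} - sum r {..<k - i}" .
    show "0 \<le> \<beta> i" using beta_pos[of i] i by auto
  qed
  finally show ?thesis .
qed

end

section \<open>Number and size of records, contraction\<close>

context exponents
begin

text \<open>Suppose the quotients of successive partial sums \<open>S\<close> are at most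
  \<open>M\<close> over the last \<open>n\<close> steps. Then
  \<open>S (m - i) \<ge> S m / M ^ i\<close>, and the recursion bounds the next quotient by
  \<open>M - Q M + q / 2 \<le> M - q / 2\<close>. The bound thus drops by a fixed amount every
  \<open>n\<close> steps, yet it cannot fall below 1, so the sequence ends; the number of steps
  depends on the exponents only.\<close>

lemma record_length_bound:
  obtains k1 :: nat where
    "\<And>r k. 0 < r 0 \<Longrightarrow> (\<And>i j. i \<le> j \<Longrightarrow> j \<le> k \<Longrightarrow> r i \<le> r j) \<Longrightarrow>
      (\<And>m. 1 \<le> m \<Longrightarrow> m \<le> k \<Longrightarrow>
        (\<Sum>l\<in>{1..m}. r l) \<le> r 0 + (\<Sum>i\<in>{1..n}. \<beta> i * (sum r {..<m} - sum r {..<m - i}))) \<Longrightarrow> k < k1"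
proof -
  \<comment> \<open>Crude first bound on the quotients: \<open>b 0 * S m\<close> plus
    \<open>2 * r 0 \<le> 2 * S m\<close>.\<close>
  define M0 where "M0 = b 0 + 2"
  \<comment> \<open>\<open>Q x\<close> is \<open>P x / x ^ n\<close>. On the compact interval
    \<open>{1..M0}\<close> it has a positive minimum \<open>q\<close>, the margin that drives the
    induction.\<close>
  define Q where "Q = (\<lambda>x::real. x - b 0 + (\<Sum>i\<in>{1..n}. \<beta> i / x ^ i))"
  have Q_pos: "0 < Q x" if "x \<ge> 1" for x
  proof -
    have "x ^ n * Q x = x ^ (n + 1) - b 0 * x ^ n + (\<Sum>i\<in>{1..n}. \<beta> i * x ^ (n - i))"
      unfolding Q_def distrib_left right_diff_distrib sum_distrib_left
      using that by (auto intro!: sum.cong arg_cong2[of _ _ _ _ "(+)"] simp: power_diff)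
    hence "0 < x ^ n * Q x" using char_poly_pos[OF that] by simp
    thus ?thesis using that by (simp add: zero_less_mult_iff)
  qed
  have "continuous_on {1..M0} Q"
    unfolding Q_def by (intro continuous_intros) auto
  moreover have "{1..M0} \<noteq> {}" using b_0 by (simp add: M0_def)
  ultimately obtain x0 where x0: "x0 \<in> {1..M0}" "\<And>x. x \<in> {1..M0} \<Longrightarrow> Q x0 \<le> Q x"
    using continuous_attains_inf[of "{1..M0}" Q] by auto
  define q where "q = Q x0"
  have q: "0 < q" using Q_pos x0(1) by (simp add: q_def)
  \<comment> \<open>From \<open>N0\<close> terms on, the constant \<open>2 * r 0\<close> costs at
    most \<open>q / 2\<close> of the margin, because \<open>S m \<ge> m * r 0\<close>.\<close>
  obtain N0 :: nat where N0: "N0 \<ge> 1" "2 / real N0 \<le> q / 2"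
  proof -
    obtain N :: nat where "4 / q < real N" using reals_Archimedean2 by blast
    moreover have "0 < 4 / q" using q by simp
    ultimately have "0 < real N" by linarith
    hence "N \<ge> 1" by simp
    thus ?thesis using that[of N] \<open>4 / q < real N\<close> q by (auto simp: field_simps)
  qed
  \<comment> \<open>After \<open>m1\<close> rounds of \<open>n\<close> steps the bound on the
    quotient would be negative.\<close>
  obtain m1 :: nat where m1: "2 * M0 / q < real m1" using reals_Archimedean2 by blast
  show ?thesis
  proof (rule that[of "N0 + m1 * n + 1"])
    fix r :: "nat \<Rightarrow> real" and k
    assume r0: "0 < r 0" and mono: "\<And>i j. i \<le> j \<Longrightarrow> j \<le> k \<Longrightarrow> r i \<le> r j"
      and rec: "\<And>m. 1 \<le> m \<Longrightarrow> m \<le> k \<Longrightarrow>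
        (\<Sum>l\<in>{1..m}. r l) \<le> r 0 + (\<Sum>i\<in>{1..n}. \<beta> i * (sum r {..<m} - sum r {..<m - i}))"
    define S where "S = (\<lambda>m. sum r {..<m})"
    have r_ge: "r 0 \<le> r l" if "l \<le> k" for l using mono[of 0 l] that by simp
    have S_ge: "real m * r 0 \<le> S m" if "m \<le> Suc k" for m
    proof -
      have "(\<Sum>l<m. r 0) \<le> S m" unfolding S_def by (rule sum_mono) (use r_ge that in auto)
      thus ?thesis by simp
    qed
    have S_Suc: "S (Suc m) = S m + r m" for m by (simp add: S_def)
    have step: "S (Suc m) \<le> 2 * r 0 + b 0 * S m - (\<Sum>i\<in>{1..n}. \<beta> i * S (m - i))"
      if "1 \<le> m" "m \<le> k" for m
    proof -
      have "S (Suc m) = r 0 + (\<Sum>l\<in>{1..m}. r l)"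
        using sum.atLeast_Suc_atMost[of 0 m r] by (simp add: S_def lessThan_Suc_atMost atMost_atLeast0)
      moreover have "(\<Sum>i\<in>{1..n}. \<beta> i * (S m - S (m - i))) = b 0 * S m - (\<Sum>i\<in>{1..n}. \<beta> i * S (m - i))"
        using b_eq_sum_beta[of 0] n_pos
        by (simp add: right_diff_distrib sum_subtractf sum_distrib_right[symmetric])
      ultimately show ?thesis using rec[OF that] by (simp add: S_def)
    qed
    have S_pos: "0 < S m" if "1 \<le> m" "m \<le> Suc k" for m
    proof -
      have "0 < real m * r 0" using that r0 by simp
      thus ?thesis using S_ge[of m] that by linarith
    qed
    have S_nonneg: "0 \<le> S m" if "m \<le> Suc k" for m
      using S_ge[OF that] r0 by (meson mult_nonneg_nonneg less_imp_le of_nat_0_le_iff order_trans)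
    have two_r0: "2 * r 0 \<le> q / 2 * S m" if "N0 \<le> m" "m \<le> Suc k" for m
    proof -
      have "2 * r 0 = 2 / real N0 * (real N0 * r 0)" using N0(1) by simp
      also have "\<dots> \<le> q / 2 * (real m * r 0)"
        using N0 that r0 q by (intro mult_mono) auto
      also have "\<dots> \<le> q / 2 * S m" using S_ge[OF that(2)] q by (intro mult_left_mono) auto
      finally show ?thesis .
    qed
    have ratio: "S (Suc m') \<le> (M0 - real m * (q / 2)) * S m'" if "N0 + m * n \<le> m'" "m' \<le> k" for m m'
      using that
    proof (induction m arbitrary: m')
      case 0
      have m': "1 \<le> m'" "m' \<le> k" "N0 \<le> m'" using 0 N0(1) by auto
      have "2 * r 0 \<le> 2 * S m'"
      proof -
        have "1 * r 0 \<le> real m' * r 0" using m'(1) r0 by (intro mult_right_mono) auto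
        thus ?thesis using S_ge[of m'] m' by simp
      qed
      moreover have "0 \<le> (\<Sum>i\<in>{1..n}. \<beta> i * S (m' - i))"
        using m' by (intro sum_nonneg mult_nonneg_nonneg S_nonneg) (auto intro!: less_imp_le[OF beta_pos])
      ultimately show ?case using step[OF m'(1,2)] by (simp add: M0_def algebra_simps)
    next
      case (Suc m)
      define M where "M = M0 - real m * (q / 2)"
      have m': "1 \<le> m'" "m' \<le> k" "N0 + m * n + n \<le> m'" using Suc.prems N0(1) by auto
      have IH: "S (Suc l) \<le> M * S l" if "N0 + m * n \<le> l" "l \<le> k" for l
        using Suc.IH[OF that] by (simp add: M_def)
      \<comment> \<open>The partial sums do not decrease, so the bound remains in the interval on
        which \<open>q\<close> is the minimum of \<open>Q\<close>.\<close>
      have M1: "1 \<le> M"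
      proof (rule ccontr)
        assume "\<not> 1 \<le> M"
        hence "M * S m' < 1 * S m'" using S_pos[of m'] m' by (intro mult_strict_right_mono) auto
        moreover have "S m' \<le> S (Suc m')" using r_ge[of m'] r0 m' by (simp add: S_Suc)
        ultimately show False using IH[of m'] m' by simp
      qed
      have MM: "M \<in> {1..M0}" using M1 q by (simp add: M_def)
      have Sback: "S m' \<le> M ^ i * S (m' - i)" if "i \<le> n" for i
        using that
      proof (induction i)
        case 0 show ?case by simp
      next
        case (Suc i)
        have "Suc (m' - Suc i) = m' - i" using Suc.prems m' N0(1) by auto
        hence "S (m' - i) \<le> M * S (m' - Suc i)"
          using IH[of "m' - Suc i"] Suc.prems m' by auto
        hence "M ^ i * S (m' - i) \<le> M ^ i * (M * S (m' - Suc i))"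
          using M1 by (intro mult_left_mono) auto
        thus ?case using Suc by (simp add: algebra_simps)
      qed
      have "(\<Sum>i\<in>{1..n}. \<beta> i / M ^ i) * S m' \<le> (\<Sum>i\<in>{1..n}. \<beta> i * S (m' - i))"
        unfolding sum_distrib_right
      proof (rule sum_mono)
        fix i assume i: "i \<in> {1..n}"
        have "S m' / M ^ i \<le> S (m' - i)" using Sback[of i] i M1 by (simp add: divide_le_eq mult.commute)
        hence "\<beta> i * (S m' / M ^ i) \<le> \<beta> i * S (m' - i)"
          using beta_pos[of i] i by (intro mult_left_mono) auto
        thus "\<beta> i / M ^ i * S m' \<le> \<beta> i * S (m' - i)" by simp
      qed
      hence "S (Suc m') \<le> q / 2 * S m' + b 0 * S m' - (\<Sum>i\<in>{1..n}. \<beta> i / M ^ i) * S m'"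
        using step[OF m'(1,2)] two_r0[of m'] m' by simp
      also have "\<dots> = (M - Q M + q / 2) * S m'" by (simp add: Q_def algebra_simps)
      also have "\<dots> \<le> (M - q / 2) * S m'"
        using x0(2)[OF MM] S_nonneg[of m'] m' by (intro mult_right_mono) (auto simp: q_def field_simps)
      also have "M - q / 2 = M0 - real (Suc m) * (q / 2)" by (simp add: M_def algebra_simps)
      finally show ?case .
    qed
    show "k < N0 + m1 * n + 1"
    proof (rule ccontr)
      assume "\<not> ?thesis"
      hence k: "N0 + m1 * n \<le> k" "1 \<le> k" by auto
      have "2 * M0 < real m1 * q" using m1 q by (simp add: field_simps)
      hence neg: "M0 - real m1 * (q / 2) < 0" by simp
      have "(M0 - real m1 * (q / 2)) * S k < 0"
        using neg S_pos[of k] k by (simp add: mult_less_0_iff)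
      thus False using ratio[OF k(1)] S_pos[of "Suc k"] by simp
    qed
  qed
qed

text \<open>The hypothesis says that the sum of the successors of the times in \<open>U\<close> is at most the
  largest \<open>b\<close>-weighted sum over partial matchings into \<open>U\<close>; it is what a telescoping product of
  ratios of maximal minors gives.\<close>

definition matching_dominated :: "real \<Rightarrow> (nat \<Rightarrow> real) \<Rightarrow> nat set \<Rightarrow> bool" where
  "matching_dominated \<gamma> x W \<longleftrightarrow> (\<forall>U H. U \<subseteq> W \<longrightarrow>
     (\<forall>J g. J \<subseteq> {..<n} \<longrightarrow> inj_on g J \<longrightarrow> g ` J \<subseteq> U \<longrightarrow> (\<Sum>j\<in>J. b j * x (g j)) \<le> H) \<longrightarrow>
     (\<Sum>i\<in>U. x (Suc i)) \<le> \<gamma> + H)"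

text \<open>The point is that \<open>C\<close> does not depend on the window length
  \<open>K\<close>. Apply domination to the times just before the successive records: the values at
  their successors are the records shifted by one, and the values at these times are at most the
  preceding records. This is the recursion of \<open>record_length_bound\<close>, so there are fewer
  than \<open>k1\<close> records, however long the window is.\<close>

lemma window_bound:
  obtains C :: real where "1 \<le> C"
    "\<And>K s x \<gamma> t. (\<And>i. 0 \<le> x i) \<Longrightarrow> 0 < \<gamma> \<Longrightarrow> matching_dominated \<gamma> x {s..<s + K} \<Longrightarrow>
       s \<le> t \<Longrightarrow> t \<le> s + K \<Longrightarrow> x t \<le> C * max (x s) \<gamma>"
proof -
  obtain k1 :: nat where k1:
    "\<And>r k. 0 < r 0 \<Longrightarrow> (\<And>i j. i \<le> j \<Longrightarrow> j \<le> k \<Longrightarrow> r i \<le> r j) \<Longrightarrow>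
      (\<And>m. 1 \<le> m \<Longrightarrow> m \<le> k \<Longrightarrow>
        (\<Sum>l\<in>{1..m}. r l) \<le> r 0 + (\<Sum>i\<in>{1..n}. \<beta> i * (sum r {..<m} - sum r {..<m - i}))) \<Longrightarrow> k < k1"
    by (rule record_length_bound) blast
  \<comment> \<open>Growth factor from one record to the next: the matching sum is at most
    \<open>b 0\<close> times the sum of the earlier records, of which there are at most
    \<open>k1\<close>.\<close>
  define D where "D = 1 + b 0 * real k1"
  have D1: "1 \<le> D" using b_0 by (simp add: D_def)
  show ?thesis
  proof (rule that[of "D ^ k1"])
    show "1 \<le> D ^ k1" using D1 by simp
    fix K s t :: nat and x :: "nat \<Rightarrow> real" and \<gamma> :: real
    assume x: "\<And>i. 0 \<le> x i" and \<gamma>: "0 < \<gamma>"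
      and dom: "matching_dominated \<gamma> x {s..<s + K}" and t: "s \<le> t" "t \<le> s + K"
    \<comment> \<open>Starting at the larger of the two makes \<open>r 0\<close> positive and lets
      it absorb the additive \<open>\<gamma>\<close>.\<close>
    define r0 where "r0 = max (x s) \<gamma>"
    have r0: "0 < r0" "\<gamma> \<le> r0" "x s \<le> r0" using \<gamma> by (auto simp: r0_def)
    \<comment> \<open>\<open>\<tau> l\<close> is the time just before the record
      \<open>r (Suc l)\<close> is set; \<open>d\<close> is the length of the stretch scanned so
      far.\<close>
    have "\<exists>k \<tau> r. r 0 = r0 \<and> (\<forall>l<k. r l < r (Suc l)) \<and>
        (\<forall>l<k. s \<le> \<tau> l \<and> \<tau> l < s + d \<and> x (\<tau> l) \<le> r l \<and> x (Suc (\<tau> l)) = r (Suc l)) \<and>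
        (\<forall>l l'. l < l' \<longrightarrow> l' < k \<longrightarrow> \<tau> l < \<tau> l') \<and> (\<forall>i. s \<le> i \<longrightarrow> i \<le> s + d \<longrightarrow> x i \<le> r k)" for d
    proof (induction d)
      case 0
      show ?case
        by (rule exI[of _ 0], rule exI[of _ "\<lambda>_. 0"], rule exI[of _ "\<lambda>_. r0"]) (use r0 in auto)
    next
      case (Suc d)
      then obtain k \<tau> r where IH: "r 0 = r0" "\<And>l. l < k \<Longrightarrow> r l < r (Suc l)"
        "\<And>l. l < k \<Longrightarrow> s \<le> \<tau> l \<and> \<tau> l < s + d \<and> x (\<tau> l) \<le> r l \<and> x (Suc (\<tau> l)) = r (Suc l)"
        "\<And>l l'. l < l' \<Longrightarrow> l' < k \<Longrightarrow> \<tau> l < \<tau> l'" "\<And>i. s \<le> i \<Longrightarrow> i \<le> s + d \<Longrightarrow> x i \<le> r k"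
        by blast
      show ?case
      proof (cases "x (Suc (s + d)) \<le> r k")
        case True
        have "x i \<le> r k" if "s \<le> i" "i \<le> s + Suc d" for i
          using that True IH(5)[of i] by (cases "i = Suc (s + d)") auto
        thus ?thesis using IH
          by (intro exI[of _ k] exI[of _ \<tau>] exI[of _ r]) (auto simp: less_Suc_eq)
      next
        case False
        define \<tau>' where "\<tau>' = \<tau>(k := s + d)"
        define r' where "r' = r(Suc k := x (Suc (s + d)))"
        have a: "r' l < r' (Suc l)" if "l < Suc k" for l
          using that False IH(2)[of l] by (auto simp: r'_def less_Suc_eq)
        have b: "s \<le> \<tau>' l \<and> \<tau>' l < s + Suc d \<and> x (\<tau>' l) \<le> r' l \<and> x (Suc (\<tau>' l)) = r' (Suc l)"
          if "l < Suc k" for l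
          using that IH(3)[of l] IH(5)[of "s + d"] by (auto simp: r'_def \<tau>'_def less_Suc_eq)
        have c: "\<tau>' l < \<tau>' l'" if "l < l'" "l' < Suc k" for l l'
          using that IH(4)[of l l'] IH(3)[of l] by (auto simp: \<tau>'_def less_Suc_eq)
        have d: "x i \<le> r' (Suc k)" if "s \<le> i" "i \<le> s + Suc d" for i
          using that False IH(5)[of i] by (cases "i = Suc (s + d)") (auto simp: r'_def)
        show ?thesis
          by (rule exI[of _ "Suc k"], rule exI[of _ \<tau>'], rule exI[of _ r'])
            (use a b c d IH(1) in \<open>auto simp: r'_def\<close>)
      qed
    qed
    from this[of K] obtain k \<tau> r where R: "r 0 = r0" "\<And>l. l < k \<Longrightarrow> r l < r (Suc l)"
      "\<And>l. l < k \<Longrightarrow> s \<le> \<tau> l \<and> \<tau> l < s + K \<and> x (\<tau> l) \<le> r l \<and> x (Suc (\<tau> l)) = r (Suc l)"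
      "\<And>l l'. l < l' \<Longrightarrow> l' < k \<Longrightarrow> \<tau> l < \<tau> l'" "\<And>i. s \<le> i \<Longrightarrow> i \<le> s + K \<Longrightarrow> x i \<le> r k"
      by blast
    have mono: "r i \<le> r j" if "i \<le> j" "j \<le> k" for i j
      using that
    proof (induction j rule: nat_induct_at_least)
      case (Suc j)
      thus ?case using R(2)[of j] by simp
    qed simp
    have r_nonneg: "0 \<le> r i" if "i \<le> k" for i using mono[of 0 i] that R(1) r0 by simp
    have rec: "(\<Sum>l\<in>{1..m}. r l) \<le> r 0 + (\<Sum>i\<in>{1..n}. \<beta> i * (sum r {..<m} - sum r {..<m - i}))"
      if m: "m \<le> k" for m
    proof -
      have inj: "inj_on \<tau> {..<m}"
        by (rule linorder_inj_onI) (use R(4) m in \<open>force+\<close>)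
      have "(\<Sum>i\<in>\<tau> ` {..<m}. x (Suc i)) \<le> \<gamma> + (\<Sum>i\<in>{1..n}. \<beta> i * (sum r {..<m} - sum r {..<m - i}))"
      proof (rule dom[unfolded matching_dominated_def, rule_format])
        show "\<tau> ` {..<m} \<subseteq> {s..<s + K}" using R(3) m by force
        fix J g assume J: "J \<subseteq> {..<n}" and g: "inj_on g J" "g ` J \<subseteq> \<tau> ` {..<m}"
        \<comment> \<open>Turns a matching into times into a matching into record indices, along
          which \<open>x (g j) \<le> r (h j)\<close>.\<close>
        define h where "h = (\<lambda>j. the_inv_into {..<m} \<tau> (g j))"
        have h: "h j < m" "\<tau> (h j) = g j" if "j \<in> J" for j
        proof -
          have "g j \<in> \<tau> ` {..<m}" using g(2) that by blast
          thus "h j < m" "\<tau> (h j) = g j" unfolding h_def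
            using the_inv_into_into[OF inj, of "g j" "{..<m}"] f_the_inv_into_f[OF inj, of "g j"] by auto
        qed
        have injh: "inj_on h J"
          by (rule inj_onI) (metis g(1) h(2) inj_onD)
        have "(\<Sum>j\<in>J. b j * x (g j)) \<le> (\<Sum>j\<in>J. b j * r (h j))"
        proof (intro sum_mono mult_left_mono)
          fix j assume j: "j \<in> J"
          show "x (g j) \<le> r (h j)" using R(3)[of "h j"] h[OF j] m by simp
          show "0 \<le> b j" using b_pos[of j] J j by auto
        qed
        also have "\<dots> \<le> (\<Sum>i\<in>{1..n}. \<beta> i * (sum r {..<m} - sum r {..<m - i}))"
          by (rule matching_le) (use r_nonneg mono m J injh h in auto)
        finally show "(\<Sum>j\<in>J. b j * x (g j)) \<le> (\<Sum>i\<in>{1..n}. \<beta> i * (sum r {..<m} - sum r {..<m - i}))" .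
      qed
      also have "(\<Sum>i\<in>\<tau> ` {..<m}. x (Suc i)) = (\<Sum>l<m. r (Suc l))"
        using inj m R(3) by (simp add: sum.reindex)
      also have "(\<Sum>l<m. r (Suc l)) = (\<Sum>l\<in>{1..m}. r l)"
        by (rule sum.reindex_bij_witness[of _ "\<lambda>l. l - 1" Suc]) auto
      finally show ?thesis using r0 R(1) by simp
    qed
    have kk: "k < k1" by (rule k1[of r k]) (use R(1) r0 mono rec in auto)
    have rle: "r m \<le> D ^ m * r0" if "m \<le> k" for m
      using that
    proof (induction m)
      case 0 thus ?case using R(1) by simp
    next
      case (Suc m)
      have rm: "0 \<le> r m" using r_nonneg Suc.prems by simp
      have sub: "sum r {..<Suc m} \<le> real (Suc m) * r m"
      proof -
        have "sum r {..<Suc m} \<le> (\<Sum>l<Suc m. r m)" by (rule sum_mono) (use mono Suc.prems in auto)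
        thus ?thesis by simp
      qed
      have "(\<Sum>i\<in>{1..n}. \<beta> i * (sum r {..<Suc m} - sum r {..<Suc m - i})) \<le> (\<Sum>i\<in>{1..n}. \<beta> i * sum r {..<Suc m})"
      proof (intro sum_mono mult_left_mono)
        fix i assume i: "i \<in> {1..n}"
        have "0 \<le> sum r {..<Suc m - i}" using r_nonneg Suc.prems by (intro sum_nonneg) auto
        thus "sum r {..<Suc m} - sum r {..<Suc m - i} \<le> sum r {..<Suc m}" by simp
        show "0 \<le> \<beta> i" using beta_pos[of i] i by simp
      qed
      also have "\<dots> = b 0 * sum r {..<Suc m}"
        using b_eq_sum_beta[of 0] n_pos by (simp only: sum_distrib_right[symmetric]) simp
      also have "\<dots> \<le> b 0 * (real k1 * r m)"
      proof (rule mult_left_mono)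
        have "real (Suc m) * r m \<le> real k1 * r m" using kk Suc.prems rm by (intro mult_right_mono) auto
        thus "sum r {..<Suc m} \<le> real k1 * r m" using sub by linarith
      qed (use b_0 in simp)
      finally have A: "(\<Sum>l\<in>{1..Suc m}. r l) \<le> r 0 + b 0 * (real k1 * r m)"
        using rec[OF Suc.prems] by linarith
      have "r (Suc m) \<le> r 0 + b 0 * (real k1 * r m) - (\<Sum>l\<in>{1..m}. r l)"
        using A by simp
      moreover have "r 0 - (\<Sum>l\<in>{1..m}. r l) \<le> r m"
        using mono[of 0 m] Suc.prems sum_nonneg[of "{1..m}" r] r_nonneg by auto
      ultimately have "r (Suc m) \<le> D * r m" by (simp add: D_def algebra_simps)
      also have "\<dots> \<le> D * (D ^ m * r0)" using Suc D1 by (intro mult_left_mono) auto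
      finally show ?case by simp
    qed
    have "x t \<le> r k" using R(5) t by blast
    also have "\<dots> \<le> D ^ k * r0" using rle by simp
    also have "\<dots> \<le> D ^ k1 * r0" using D1 kk r0 by (intro mult_right_mono power_increasing) auto
    finally show "x t \<le> D ^ k1 * max (x s) \<gamma>" by (simp add: r0_def)
  qed
qed

definition contraction_window :: "nat \<Rightarrow> real \<Rightarrow> bool" where
  "contraction_window K C \<longleftrightarrow> 1 \<le> K \<and> 1 \<le> C \<and>
     (\<forall>s x \<gamma>. (\<forall>i. 0 \<le> x i) \<longrightarrow> 0 < \<gamma> \<longrightarrow> matching_dominated \<gamma> x {s..<s + K} \<longrightarrow>
       (\<forall>t. s \<le> t \<longrightarrow> t \<le> s + K \<longrightarrow> x t \<le> C * (x s + \<gamma>)) \<and>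
       (\<exists>s'. s < s' \<and> s' \<le> s + K \<and> x s' \<le> x s / 2 + \<gamma>))"

text \<open>Domination for the whole window bounds the sum of all its values by a multiple of
  \<open>x s + \<gamma>\<close> that does not grow with \<open>K\<close>, since the constant of
  \<open>window_bound\<close> does not. If no value fell to \<open>x s / 2 + \<gamma>\<close>, the
  sum would be at least \<open>K * (x s + \<gamma>) / 2\<close>; so a large \<open>K\<close> forces
  a contraction.\<close>

lemma contraction_window_exists: "\<exists>K C. contraction_window K C"
proof -
  obtain C where C: "1 \<le> C"
    "\<And>K s x \<gamma> t. (\<And>i. 0 \<le> x i) \<Longrightarrow> 0 < \<gamma> \<Longrightarrow> matching_dominated \<gamma> x {s..<s + K} \<Longrightarrow>
       s \<le> t \<Longrightarrow> t \<le> s + K \<Longrightarrow> x t \<le> C * max (x s) \<gamma>"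
    by (rule window_bound) blast
  have C': "x t \<le> C * (x s + \<gamma>)" if "\<And>i. 0 \<le> x i" "0 < \<gamma>" "matching_dominated \<gamma> x {s..<s + K}"
    "s \<le> t" "t \<le> s + K" for K s x \<gamma> t
  proof -
    have "x t \<le> C * max (x s) \<gamma>" using C(2)[of x \<gamma> s K t] that by blast
    also have "\<dots> \<le> C * (x s + \<gamma>)" using C(1) that(1)[of s] that(2) by (intro mult_left_mono) auto
    finally show ?thesis .
  qed
  define B where "B = sum b {..<n}"
  have B: "0 < B" unfolding B_def using b_pos n_pos by (intro sum_pos) (auto simp: lessThan_empty_iff)
  obtain K :: nat where K: "2 * (1 + B * C) < real K" using reals_Archimedean2 by blast
  have BC: "0 < B * C" using B C(1) by simp
  have K1: "1 \<le> K" using K BC by (cases K) auto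
  show ?thesis
    unfolding contraction_window_def
  proof (rule exI[of _ K], rule exI[of _ C], intro conjI allI impI)
    show "1 \<le> K" by fact
    show "1 \<le> C" by fact
    show "x t \<le> C * (x s + \<gamma>)" if "\<forall>i. 0 \<le> x i" "0 < \<gamma>" "matching_dominated \<gamma> x {s..<s + K}"
      "s \<le> t" "t \<le> s + K" for s x \<gamma> t
      using C' that by blast
    fix s x \<gamma> assume "\<forall>i. (0::real) \<le> x i" and \<gamma>: "0 < \<gamma>"
      and dom: "matching_dominated \<gamma> x {s..<s + K}"
    hence x: "0 \<le> x i" for i by blast
    define y where "y = x s + \<gamma>"
    have y: "0 < y" using x[of s] \<gamma> by (simp add: y_def)
    have sum: "(\<Sum>i\<in>{s..<s + K}. x (Suc i)) \<le> \<gamma> + B * (C * y)"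
    proof (rule dom[unfolded matching_dominated_def, rule_format])
      fix J and g :: "nat \<Rightarrow> nat" assume J: "J \<subseteq> {..<n}" and g: "inj_on g J" "g ` J \<subseteq> {s..<s + K}"
      have "(\<Sum>j\<in>J. b j * x (g j)) \<le> (\<Sum>j\<in>J. b j * (C * y))"
      proof (intro sum_mono mult_left_mono)
        fix j assume j: "j \<in> J"
        hence "s \<le> g j" "g j \<le> s + K" using g(2) by force+
        thus "x (g j) \<le> C * y" unfolding y_def using C'[of x \<gamma> s K "g j"] x \<gamma> dom by blast
        show "0 \<le> b j" using b_pos[of j] J j by auto
      qed
      also have "\<dots> = sum b J * (C * y)" by (simp add: sum_distrib_right)
      also have "\<dots> \<le> B * (C * y)"
      proof (rule mult_right_mono)
        show "sum b J \<le> B" unfolding B_def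
          by (rule sum_mono2) (use J in \<open>auto intro!: less_imp_le[OF b_pos]\<close>)
      qed (use C(1) y in simp)
      finally show "(\<Sum>j\<in>J. b j * x (g j)) \<le> B * (C * y)" .
    qed simp
    show "\<exists>s'. s < s' \<and> s' \<le> s + K \<and> x s' \<le> x s / 2 + \<gamma>"
    proof (rule ccontr)
      assume "\<not> ?thesis"
      hence big: "x s / 2 + \<gamma> \<le> x (Suc i)" if "i \<in> {s..<s + K}" for i
        using that by (metis Suc_leI atLeastLessThan_iff le_imp_less_Suc linorder_le_cases)
      have "real K * (y / 2) \<le> (\<Sum>i\<in>{s..<s + K}. x s / 2 + \<gamma>)"
      proof -
        have "real K * (y / 2) \<le> real K * (x s / 2 + \<gamma>)" using \<gamma> by (intro mult_left_mono) (auto simp: y_def)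
        thus ?thesis by simp
      qed
      also have "\<dots> \<le> (\<Sum>i\<in>{s..<s + K}. x (Suc i))" by (rule sum_mono) (rule big)
      also note sum
      also have "\<gamma> + B * (C * y) \<le> (1 + B * C) * y" using x[of s] by (simp add: y_def algebra_simps)
      finally have "real K * (y / 2) \<le> (1 + B * C) * y" .
      moreover have "(1 + B * C) * y < (real K / 2) * y" using K y by (intro mult_strict_right_mono) auto
      ultimately show False by simp
    qed
  qed
qed

end

section \<open>From contracting windows to averages and pointwise growth\<close>

lemma contracting_windows:
  fixes x \<gamma> :: "nat \<Rightarrow> real"
  assumes x: "\<And>i. 0 \<le> x i" and \<gamma>: "\<And>i. 0 \<le> \<gamma> i" and K: "1 \<le> K" and C: "1 \<le> C"
    and W1: "\<And>s t. s \<le> t \<Longrightarrow> t \<le> s + K \<Longrightarrow> x t \<le> C * (x s + \<gamma> s)"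
    and W2: "\<And>s. \<exists>s'. s < s' \<and> s' \<le> s + K \<and> x s' \<le> x s / 2 + \<gamma> s"
  shows "(\<Sum>t\<le>T. x t) \<le> 3 * C * real (K + 1) * (x 0 + (\<Sum>t\<le>T. \<gamma> t))"
    and "(\<And>t. t \<le> T \<Longrightarrow> \<gamma> t \<le> G) \<Longrightarrow> x T \<le> C * (x 0 + 3 * G)"
proof -
  \<comment> \<open>Cost factor of a segment of up to \<open>K + 1\<close> times; the extra one is
    there because the last segment includes \<open>T\<close> itself.\<close>
  define D where "D = C * real (K + 1)"
  have D: "0 \<le> D" using C by (simp add: D_def)
  have seg: "(\<Sum>t\<in>{s..<s'}. x t) \<le> D * (x s + \<gamma> s)" if "s \<le> s'" "s' \<le> s + K + 1" for s s'
  proof -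
    have "(\<Sum>t\<in>{s..<s'}. x t) \<le> (\<Sum>t\<in>{s..<s'}. C * (x s + \<gamma> s))"
      by (rule sum_mono) (use W1 that in auto)
    also have "\<dots> = real (s' - s) * (C * (x s + \<gamma> s))" by simp
    also have "\<dots> \<le> real (K + 1) * (C * (x s + \<gamma> s))"
      using that x \<gamma> C by (intro mult_right_mono) auto
    finally show ?thesis by (simp add: D_def mult_ac)
  qed
  \<comment> \<open>Potential argument along the contraction times \<open>s\<close>: halving
    \<open>x s\<close> frees half of the potential \<open>2 * D * x s\<close>, which pays for the
    segment just passed, and each jump adds at most \<open>3 * D * \<gamma> s\<close>.\<close>
  have "\<exists>s. s \<le> T \<and> T \<le> s + K \<and> (\<Sum>t<s. x t) + 2 * D * x s \<le> 2 * D * x 0 + 3 * D * (\<Sum>t<s. \<gamma> t)" for T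
  proof (induction T)
    case 0
    show ?case by (rule exI[of _ 0]) simp
  next
    case (Suc T)
    then obtain s where s: "s \<le> T" "T \<le> s + K"
      "(\<Sum>t<s. x t) + 2 * D * x s \<le> 2 * D * x 0 + 3 * D * (\<Sum>t<s. \<gamma> t)" by blast
    show ?case
    proof (cases "Suc T \<le> s + K")
      case True
      thus ?thesis using s by (intro exI[of _ s]) auto
    next
      case False
      obtain s' where s': "s < s'" "s' \<le> s + K" "x s' \<le> x s / 2 + \<gamma> s" using W2 by blast
      have "(\<Sum>t<s'. x t) = (\<Sum>t<s. x t) + (\<Sum>t\<in>{s..<s'}. x t)"
        using sum.atLeastLessThan_concat[of 0 s s' x] s' by (simp add: lessThan_atLeast0)
      also have "\<dots> \<le> (\<Sum>t<s. x t) + D * (x s + \<gamma> s)" using seg[of s s'] s' by simp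
      finally have 1: "(\<Sum>t<s'. x t) \<le> (\<Sum>t<s. x t) + D * (x s + \<gamma> s)" .
      have 2: "2 * D * x s' \<le> D * x s + 2 * D * \<gamma> s"
        using mult_left_mono[OF s'(3), of "2 * D"] D by (simp add: algebra_simps)
      have "(\<Sum>t<s. \<gamma> t) + \<gamma> s = (\<Sum>t<Suc s. \<gamma> t)" by simp
      also have "\<dots> \<le> (\<Sum>t<s'. \<gamma> t)" by (rule sum_mono2) (use s' \<gamma> in auto)
      finally have "3 * D * ((\<Sum>t<s. \<gamma> t) + \<gamma> s) \<le> 3 * D * (\<Sum>t<s'. \<gamma> t)"
        using D by (intro mult_left_mono) auto
      hence "(\<Sum>t<s'. x t) + 2 * D * x s' \<le> 2 * D * x 0 + 3 * D * (\<Sum>t<s'. \<gamma> t)"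
        using 1 2 s(3) by (simp add: algebra_simps)
      thus ?thesis using s s' False by (intro exI[of _ s']) auto
    qed
  qed
  from this[of T] obtain s where s: "s \<le> T" "T \<le> s + K"
    "(\<Sum>t<s. x t) + 2 * D * x s \<le> 2 * D * x 0 + 3 * D * (\<Sum>t<s. \<gamma> t)" by blast
  have "(\<Sum>t\<le>T. x t) = (\<Sum>t<s. x t) + (\<Sum>t\<in>{s..<Suc T}. x t)"
    using sum.atLeastLessThan_concat[of 0 s "Suc T" x] s
    by (simp only: lessThan_atLeast0 lessThan_Suc_atMost[symmetric])
  also have "\<dots> \<le> (\<Sum>t<s. x t) + D * (x s + \<gamma> s)" using seg[of s "Suc T"] s by simp
  also have "\<dots> \<le> 2 * D * x 0 + 3 * D * ((\<Sum>t<s. \<gamma> t) + \<gamma> s)"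
  proof -
    have "0 \<le> D * x s" "0 \<le> D * \<gamma> s" using D x \<gamma> by auto
    thus ?thesis using s(3) by (simp add: algebra_simps)
  qed
  also have "(\<Sum>t<s. \<gamma> t) + \<gamma> s = (\<Sum>t<Suc s. \<gamma> t)" by simp
  also have "\<dots> \<le> (\<Sum>t\<le>T. \<gamma> t)" by (rule sum_mono2) (use s \<gamma> in auto)
  finally have "(\<Sum>t\<le>T. x t) \<le> 2 * D * x 0 + 3 * D * (\<Sum>t\<le>T. \<gamma> t)" using D by (simp add: mult_left_mono)
  moreover have "0 \<le> D * x 0" using D x by simp
  ultimately show "(\<Sum>t\<le>T. x t) \<le> 3 * C * real (K + 1) * (x 0 + (\<Sum>t\<le>T. \<gamma> t))"
    by (simp add: D_def algebra_simps)
next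
  assume G: "\<And>t. t \<le> T \<Longrightarrow> \<gamma> t \<le> G"
  have G0: "0 \<le> G" using \<gamma>[of 0] G[of 0] by simp
  \<comment> \<open>The level \<open>x 0 + 2 * G\<close> is preserved by halving and adding at most
    \<open>G\<close>.\<close>
  have "\<exists>s. s \<le> T' \<and> T' \<le> s + K \<and> x s \<le> x 0 + 2 * G" if "T' \<le> T" for T'
    using that
  proof (induction T')
    case 0
    show ?case by (rule exI[of _ 0]) (use G0 in simp)
  next
    case (Suc T')
    then obtain s where s: "s \<le> T'" "T' \<le> s + K" "x s \<le> x 0 + 2 * G" by auto
    show ?case
    proof (cases "Suc T' \<le> s + K")
      case True
      thus ?thesis using s by (intro exI[of _ s]) auto
    next
      case False
      obtain s' where s': "s < s'" "s' \<le> s + K" "x s' \<le> x s / 2 + \<gamma> s" using W2 by blast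
      have "x s' \<le> x 0 + 2 * G" using s' s(3) G[of s] s(1) Suc.prems x[of 0] by simp
      thus ?thesis using s s' False by (intro exI[of _ s']) auto
    qed
  qed
  from this[of T] obtain s where s: "s \<le> T" "T \<le> s + K" "x s \<le> x 0 + 2 * G" by auto
  have "x T \<le> C * (x s + \<gamma> s)" using W1 s by blast
  also have "\<dots> \<le> C * (x 0 + 3 * G)" using s G[of s] C by (intro mult_left_mono) auto
  finally show "x T \<le> C * (x 0 + 3 * G)" .
qed

section \<open>The controller\<close>

text \<open>An argmin that carries the cost and the prediction together, by recursion so that
  measurability is an induction on the list; \<open>d\<close> is the pair kept when nothing is
  cheaper.\<close>

primrec cheapest :: "('c \<Rightarrow> bool) \<Rightarrow> ('c \<Rightarrow> real) \<Rightarrow> ('c \<Rightarrow> real) \<Rightarrow> real \<times> real \<Rightarrow> 'c list \<Rightarrow> real \<times> real" where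
  "cheapest P c v d [] = d"
| "cheapest P c v d (x # xs) =
    (if P x \<and> c x < fst (cheapest P c v d xs) then (c x, v x) else cheapest P c v d xs)"

lemma cheapest_cases:
  "cheapest P c v d xs = d \<or> (\<exists>x\<in>set xs. P x \<and> cheapest P c v d xs = (c x, v x))"
  by (induction xs) auto

lemma fst_cheapest_le: "x \<in> set xs \<Longrightarrow> P x \<Longrightarrow> fst (cheapest P c v d xs) \<le> c x"
  by (induction xs) auto

lemma cheapest_cong:
  assumes "\<And>x. x \<in> set xs \<Longrightarrow> P x = P' x" "\<And>x. x \<in> set xs \<Longrightarrow> c x = c' x"
    "\<And>x. x \<in> set xs \<Longrightarrow> v x = v' x" "d = d'"
  shows "cheapest P c v d xs = cheapest P' c' v' d' xs"
  using assms by (induction xs) auto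

locale controller =
  fixes n K :: nat and \<phi> :: "real \<Rightarrow> nat \<Rightarrow> real" and B :: "nat \<Rightarrow> real set"
begin

text \<open>Data rows: index \<open>k < n\<close> is the \<open>k\<close>-th unit vector, with the value \<open>0\<close> as a crude guess of
  \<open>\<theta>\<^sub>k\<close>; index \<open>n + i\<close> is the regressor at time \<open>i\<close>, with the observed value of \<open>\<theta> \<cdot> \<phi>(y\<^sub>i) + w\<^sub>i\<^sub>+\<^sub>1\<close>.\<close>

definition data_row :: "(nat \<Rightarrow> real) \<Rightarrow> nat \<Rightarrow> nat \<Rightarrow> real" where
  "data_row y k = (if k < n then (\<lambda>j. if j = k then 1 else 0) else \<phi> (y (k - n)))"

definition data_val :: "(nat \<Rightarrow> real) \<Rightarrow> (nat \<Rightarrow> real) \<Rightarrow> nat \<Rightarrow> real" where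
  "data_val y u k = (if k < n then 0 else y (Suc (k - n)) - u (k - n))"

definition candidates :: "nat \<Rightarrow> nat list list" where
  "candidates t = List.n_lists n ([0..<n] @ [n + (t - K)..<n + t])"

definition tuple_coeff :: "nat \<Rightarrow> (nat \<Rightarrow> real) \<Rightarrow> nat list \<Rightarrow> nat \<Rightarrow> real" where
  "tuple_coeff t y \<tau> = cramer n (\<lambda>r. data_row y (\<tau> ! r)) (\<phi> (y t))"

text \<open>The default predicts 0. Its error is at most the largest \<open>|\<theta> j|\<close>
  times the cost entered for it, so it obeys the same kind of error bound as the tuples.\<close>

definition window_prediction :: "nat \<Rightarrow> (nat \<Rightarrow> real) \<Rightarrow> (nat \<Rightarrow> real) \<Rightarrow> real" where
  "window_prediction t y u = snd (cheapest
     (\<lambda>\<tau>. rdet n (\<lambda>r. data_row y (\<tau> ! r)) \<noteq> 0)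
     (\<lambda>\<tau>. \<Sum>r<n. \<bar>tuple_coeff t y \<tau> r\<bar>)
     (\<lambda>\<tau>. \<Sum>r<n. tuple_coeff t y \<tau> r * data_val y u (\<tau> ! r))
     (\<Sum>j<n. \<bar>\<phi> (y t) j\<bar>, 0) (candidates t))"

text \<open>The sets \<open>B r\<close> are meant to fix the direction of the regressors at visits,
  so that the sums grow linearly in the number of visits while the noises in the matching sums of
  observations largely cancel.\<close>

definition pooled_row :: "nat \<Rightarrow> (nat \<Rightarrow> real) \<Rightarrow> nat \<Rightarrow> nat \<Rightarrow> real" where
  "pooled_row t y r j = (\<Sum>i<t. if y i \<in> B r then \<phi> (y i) j else 0)"

definition pooled_val :: "nat \<Rightarrow> (nat \<Rightarrow> real) \<Rightarrow> (nat \<Rightarrow> real) \<Rightarrow> nat \<Rightarrow> real" where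
  "pooled_val t y u r = (\<Sum>i<t. if y i \<in> B r then y (Suc i) - u i else 0)"

definition pooled_coeff :: "nat \<Rightarrow> (nat \<Rightarrow> real) \<Rightarrow> nat \<Rightarrow> real" where
  "pooled_coeff t y = cramer n (pooled_row t y) (\<phi> (y t))"

text \<open>A test on outputs alone, as a controller needs. The exponent \<open>3 / 4\<close> lies
  between the noise rate \<open>5 / 8\<close> and the decay rate \<open>15 / 16\<close> that the
  coefficients eventually attain: passing the test bounds the prediction error, and the test is
  eventually passed.\<close>

definition pooled_ok :: "nat \<Rightarrow> (nat \<Rightarrow> real) \<Rightarrow> bool" where
  "pooled_ok t y \<longleftrightarrow> rdet n (pooled_row t y) \<noteq> 0 \<and>
     (\<forall>r<n. \<bar>pooled_coeff t y r\<bar> \<le> real (t + 1) powr (- 3 / 4))"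

definition control :: "nat \<Rightarrow> (nat \<Rightarrow> real) \<Rightarrow> (nat \<Rightarrow> real) \<Rightarrow> real" where
  "control t y u = - (if pooled_ok t y then \<Sum>r<n. pooled_coeff t y r * pooled_val t y u r
     else window_prediction t y u)"

text \<open>Predictions use past inputs, whereas a feedback law may read outputs only; the inputs
  are therefore recomputed from the outputs.\<close>

primrec past_controls :: "(nat \<Rightarrow> real) \<Rightarrow> nat \<Rightarrow> nat \<Rightarrow> real" where
  "past_controls y 0 = (\<lambda>_. 0)"
| "past_controls y (Suc t) = (past_controls y t)(t := control t y (past_controls y t))"

definition feedback :: "nat \<Rightarrow> (nat \<Rightarrow> real) \<Rightarrow> real" where
  "feedback t y = control t y (past_controls y t)"

lemma set_candidates: "set (candidates t) = tuples n ({..<n} \<union> (+) n ` {t - K..<t})"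
proof -
  have "(+) n ` {t - K..<t} = {n + (t - K)..<n + t}" by (simp add: add.commute)
  thus ?thesis by (auto simp: candidates_def tuples_def set_n_lists lessThan_atLeast0)
qed

lemma candidate_nth:
  assumes "\<tau> \<in> set (candidates t)" "r < n"
  shows "\<tau> ! r < n \<or> (\<exists>i. \<tau> ! r = n + i \<and> t - K \<le> i \<and> i < t)"
proof -
  have "set \<tau> \<subseteq> {..<n} \<union> (+) n ` {t - K..<t}" "length \<tau> = n"
    using assms(1) by (auto simp: set_candidates tuples_def)
  hence "\<tau> ! r \<in> {..<n} \<union> (+) n ` {t - K..<t}" using assms(2) nth_mem by blast
  thus ?thesis by (auto simp del: image_add_atLeastLessThan)
qed

lemma past_controls_eq: "i < t \<Longrightarrow> past_controls y t i = feedback i y"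
  by (induction t) (auto simp: feedback_def less_Suc_eq)

text \<open>Causality: the observation belonging to a time \<open>i < t\<close> involves
  \<open>y (Suc i)\<close>, hence nothing beyond time \<open>t\<close>. This makes the closed loop a
  recursion and the control adapted.\<close>

lemma control_cong:
  assumes y: "\<And>i. i \<le> t \<Longrightarrow> y i = y' i" and u: "\<And>i. i < t \<Longrightarrow> u i = u' i"
  shows "control t y u = control t y' u'"
proof -
  have rows: "data_row y (\<tau> ! r) = data_row y' (\<tau> ! r)" "data_val y u (\<tau> ! r) = data_val y' u' (\<tau> ! r)"
    if "\<tau> \<in> set (candidates t)" "r < n" for \<tau> r
    using candidate_nth[OF that] y u by (auto simp: data_row_def data_val_def)
  have rd: "rdet n (\<lambda>r. data_row y (\<tau> ! r)) = rdet n (\<lambda>r. data_row y' (\<tau> ! r))"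
    if "\<tau> \<in> set (candidates t)" for \<tau>
    by (rule rdet_cong) (simp add: rows[OF that])
  have cc: "tuple_coeff t y \<tau> r = tuple_coeff t y' \<tau> r" if "\<tau> \<in> set (candidates t)" for \<tau> r
    unfolding tuple_coeff_def by (rule cramer_cong) (simp_all add: rows[OF that] y)
  have win: "window_prediction t y u = window_prediction t y' u'"
    unfolding window_prediction_def
    by (intro arg_cong[of _ _ snd] cheapest_cong) (simp_all add: rd cc rows y)
  have prow: "pooled_row t y = pooled_row t y'"
    unfolding pooled_row_def by (intro ext sum.cong) (auto simp: y)
  have pval: "pooled_val t y u = pooled_val t y' u'"
    unfolding pooled_val_def by (intro ext sum.cong) (auto simp: y u)
  have pc: "pooled_coeff t y = pooled_coeff t y'"
    unfolding pooled_coeff_def prow by (simp add: y)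
  show ?thesis
    unfolding control_def pooled_ok_def prow pval pc win ..
qed

lemma feedback_cong:
  assumes "\<And>i. i \<le> t \<Longrightarrow> y i = y' i"
  shows "feedback t y = feedback t y'"
proof -
  have "past_controls y t = past_controls y' t"
    using assms
  proof (induction t)
    case (Suc t)
    have "control t y (past_controls y t) = control t y' (past_controls y t)"
      by (rule control_cong) (use Suc.prems in auto)
    thus ?case using Suc by simp
  qed simp
  thus ?thesis unfolding feedback_def using control_cong[of t y y'] assms by simp
qed

end

section \<open>The closed loop along one sample path\<close>

locale closed_loop = controller n K \<phi> B
  for n K :: nat and \<phi> :: "real \<Rightarrow> nat \<Rightarrow> real" and B :: "nat \<Rightarrow> real set" +
  fixes \<theta> w y :: "nat \<Rightarrow> real"
  assumes loop: "y (Suc t) = (\<Sum>j<n. \<theta> j * \<phi> (y t) j) + feedback t y + w (Suc t)"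
begin

text \<open>Equals \<theta> \<cdot> \<phi>(y_t) + u_t: the prediction error of the controller and,
  for random noise, the conditional mean of the next output.\<close>

definition drift :: "nat \<Rightarrow> real" where
  "drift t = y (Suc t) - w (Suc t)"

definition noise_sum :: "nat \<Rightarrow> nat \<Rightarrow> real" where
  "noise_sum r t = (\<Sum>i<t. if y i \<in> B r then w (Suc i) else 0)"

text \<open>The coefficients reproduce \<open>p\<close> from the rows exactly, so
  \<open>\<theta>\<close> cancels and only a combination of the noises remains.\<close>

lemma interpolation_error:
  assumes "rdet n V \<noteq> 0" "\<And>r. r < n \<Longrightarrow> Z r = (\<Sum>j<n. \<theta> j * V r j) + \<nu> r"
  shows "(\<Sum>j<n. \<theta> j * p j) - (\<Sum>r<n. cramer n V p r * Z r) = - (\<Sum>r<n. cramer n V p r * \<nu> r)"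
proof -
  have "(\<Sum>r<n. cramer n V p r * Z r)
      = (\<Sum>r<n. \<Sum>j<n. \<theta> j * (cramer n V p r * V r j)) + (\<Sum>r<n. cramer n V p r * \<nu> r)"
    by (simp add: assms(2) distrib_left sum.distrib sum_distrib_left mult_ac)
  also have "(\<Sum>r<n. \<Sum>j<n. \<theta> j * (cramer n V p r * V r j)) = (\<Sum>j<n. \<theta> j * (\<Sum>r<n. cramer n V p r * V r j))"
    by (subst sum.swap) (simp add: sum_distrib_left)
  also have "\<dots> = (\<Sum>j<n. \<theta> j * p j)" using cramer_expansion[OF assms(1)] by simp
  finally show ?thesis by simp
qed

lemma observation:
  assumes "i < t"
  shows "y (Suc i) - past_controls y t i = (\<Sum>j<n. \<theta> j * \<phi> (y i) j) + w (Suc i)"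
  using loop[of i] past_controls_eq[OF assms, of y] by simp

lemma drift_eq: "drift t = (\<Sum>j<n. \<theta> j * \<phi> (y t) j) + control t y (past_controls y t)"
  using loop[of t] by (simp add: drift_def feedback_def)

lemma drift_pooled:
  assumes "pooled_ok t y"
  shows "\<bar>drift t\<bar> \<le> real (t + 1) powr (- 3 / 4) * (\<Sum>r<n. \<bar>noise_sum r t\<bar>)"
proof -
  have "pooled_val t y (past_controls y t) r = (\<Sum>j<n. \<theta> j * pooled_row t y r j) + noise_sum r t" for r
  proof -
    have "pooled_val t y (past_controls y t) r
        = (\<Sum>i<t. (\<Sum>j<n. \<theta> j * (if y i \<in> B r then \<phi> (y i) j else 0)) + (if y i \<in> B r then w (Suc i) else 0))"
      unfolding pooled_val_def by (intro sum.cong) (auto simp: observation)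
    also have "\<dots> = (\<Sum>j<n. \<theta> j * pooled_row t y r j) + noise_sum r t"
      unfolding pooled_row_def noise_sum_def sum.distrib sum_distrib_left
      by (subst sum.swap) simp
    finally show ?thesis .
  qed
  from interpolation_error[of "pooled_row t y" "pooled_val t y (past_controls y t)" "\<lambda>r. noise_sum r t" "\<phi> (y t)", OF _ this]
  have "drift t = - (\<Sum>r<n. pooled_coeff t y r * noise_sum r t)"
    using assms by (simp add: drift_eq control_def pooled_ok_def pooled_coeff_def)
  hence "\<bar>drift t\<bar> \<le> (\<Sum>r<n. \<bar>pooled_coeff t y r * noise_sum r t\<bar>)"
    using sum_abs[of "\<lambda>r. pooled_coeff t y r * noise_sum r t" "{..<n}"] by simp
  also have "\<dots> \<le> (\<Sum>r<n. real (t + 1) powr (- 3 / 4) * \<bar>noise_sum r t\<bar>)"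
    using assms by (intro sum_mono) (auto simp: abs_mult pooled_ok_def intro!: mult_right_mono)
  finally show ?thesis by (simp add: sum_distrib_left)
qed

text \<open>Here \<open>\<tau>\<close> is any nonsingular tuple from the window, not the one the
  controller uses: every candidate errs by at most \<open>N\<close> times its cost, and the cheapest
  costs no more than \<open>\<tau>\<close>.\<close>

lemma drift_window:
  assumes not_ok: "\<not> pooled_ok t y"
    and N\<theta>: "\<And>j. j < n \<Longrightarrow> \<bar>\<theta> j\<bar> \<le> N" and Nw: "\<And>i. t - K \<le> i \<Longrightarrow> i < t \<Longrightarrow> \<bar>w (Suc i)\<bar> \<le> N"
    and N: "0 \<le> N"
    and \<tau>: "\<tau> \<in> tuples n ({..<n} \<union> (+) n ` {t - K..<t})" "rdet n (\<lambda>r. data_row y (\<tau> ! r)) \<noteq> 0"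
  shows "\<bar>drift t\<bar> \<le> N * (\<Sum>r<n. \<bar>tuple_coeff t y \<tau> r\<bar>)"
proof -
  define u where "u = past_controls y t"
  define P where "P = (\<lambda>\<tau>. rdet n (\<lambda>r. data_row y (\<tau> ! r)) \<noteq> 0)"
  define c where "c = (\<lambda>\<tau>. \<Sum>r<n. \<bar>tuple_coeff t y \<tau> r\<bar>)"
  define v where "v = (\<lambda>\<tau>. \<Sum>r<n. tuple_coeff t y \<tau> r * data_val y u (\<tau> ! r))"
  define d where "d = (\<Sum>j<n. \<bar>\<phi> (y t) j\<bar>, 0::real)"
  define q where "q = cheapest P c v d (candidates t)"
  define s where "s = (\<Sum>j<n. \<theta> j * \<phi> (y t) j)"
  have dr: "drift t = s - snd q"
    using not_ok by (simp add: drift_eq control_def window_prediction_def q_def P_def c_def v_def d_def u_def s_def)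
  have err: "\<bar>s - v \<sigma>\<bar> \<le> N * c \<sigma>" if \<sigma>: "\<sigma> \<in> set (candidates t)" "P \<sigma>" for \<sigma>
  proof -
    \<comment> \<open>The guess 0 for a component of \<open>\<theta>\<close> counts as an
      observation along a unit vector whose noise is minus that component.\<close>
    define \<nu> where "\<nu> = (\<lambda>r. if \<sigma> ! r < n then - \<theta> (\<sigma> ! r) else w (Suc (\<sigma> ! r - n)))"
    have val: "data_val y u (\<sigma> ! r) = (\<Sum>j<n. \<theta> j * data_row y (\<sigma> ! r) j) + \<nu> r" if r: "r < n" for r
    proof (cases "\<sigma> ! r < n")
      case True
      thus ?thesis by (simp add: data_val_def data_row_def \<nu>_def if_distrib cong: if_cong)
    next
      case False
      then obtain i where "\<sigma> ! r = n + i" "i < t" using candidate_nth[OF \<sigma>(1) r] by auto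
      thus ?thesis using observation[of i t] by (simp add: data_val_def data_row_def \<nu>_def u_def)
    qed
    have \<nu>: "\<bar>\<nu> r\<bar> \<le> N" if "r < n" for r
      using candidate_nth[OF \<sigma>(1) that] N\<theta> Nw by (auto simp: \<nu>_def)
    have "s - v \<sigma> = - (\<Sum>r<n. tuple_coeff t y \<sigma> r * \<nu> r)"
      unfolding s_def v_def tuple_coeff_def
      by (rule interpolation_error) (use \<sigma>(2) val in \<open>auto simp: P_def\<close>)
    hence "\<bar>s - v \<sigma>\<bar> \<le> (\<Sum>r<n. \<bar>tuple_coeff t y \<sigma> r * \<nu> r\<bar>)"
      using sum_abs[of "\<lambda>r. tuple_coeff t y \<sigma> r * \<nu> r" "{..<n}"] by simp
    also have "\<dots> \<le> (\<Sum>r<n. N * \<bar>tuple_coeff t y \<sigma> r\<bar>)"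
      using \<nu> by (intro sum_mono) (auto simp: abs_mult mult.commute intro!: mult_right_mono)
    finally show ?thesis by (simp add: c_def sum_distrib_left)
  qed
  have "\<bar>s\<bar> \<le> (\<Sum>j<n. \<bar>\<theta> j * \<phi> (y t) j\<bar>)" unfolding s_def by (rule sum_abs)
  also have "\<dots> \<le> (\<Sum>j<n. N * \<bar>\<phi> (y t) j\<bar>)"
    using N\<theta> by (intro sum_mono) (auto simp: abs_mult intro!: mult_right_mono)
  finally have "\<bar>s - snd d\<bar> \<le> N * fst d" by (simp add: d_def sum_distrib_left)
  hence "\<bar>s - snd q\<bar> \<le> N * fst q"
    using cheapest_cases[of P c v d "candidates t"] err by (auto simp: q_def)
  also have "\<dots> \<le> N * c \<tau>"
    unfolding q_def using N \<tau> by (intro mult_left_mono fst_cheapest_le) (auto simp: set_candidates P_def)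
  finally show ?thesis by (simp add: dr c_def)
qed

sublocale rows: unit_rows n "data_row y"
  by unfold_locales (simp add: data_row_def)

section \<open>Logarithmic size of the outputs\<close>

definition log_output :: "nat \<Rightarrow> real" where
  "log_output t = ln (max 1 \<bar>y t\<bar>)"

lemma log_output_nonneg: "0 \<le> log_output t"
  by (simp add: log_output_def)

abbreviation row_ids :: "nat set \<Rightarrow> nat set" where
  "row_ids U \<equiv> {..<n} \<union> (+) n ` U"

text \<open>Compare with a tuple of maximal minor over the rows of \<open>U\<close>: its
  coefficients are bounded by the quotient of the maximal minors after and before adding time
  \<open>t\<close>. The controller is unaware of \<open>U\<close>, so the bound holds for all
  \<open>U\<close> simultaneously.\<close>

lemma log_output_step:
  assumes U: "U \<subseteq> {t - K..<t}"
    and N: "1 \<le> N" "\<And>j. j < n \<Longrightarrow> \<bar>\<theta> j\<bar> \<le> N" "\<And>i. t - K \<le> i \<Longrightarrow> i \<le> t \<Longrightarrow> \<bar>w (Suc i)\<bar> \<le> N"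
    and ok: "pooled_ok t y \<Longrightarrow> \<bar>drift t\<bar> \<le> N"
  shows "log_output (Suc t) \<le> ln (real (n + 2) * N)
    + (ln (max_minor n (data_row y) (row_ids (insert t U))) - ln (max_minor n (data_row y) (row_ids U)))"
proof -
  have fin: "finite (row_ids U)" "{..<n} \<subseteq> row_ids U"
    using finite_subset[OF U] by auto
  define a where "a = max_minor n (data_row y) (row_ids U)"
  define a' where "a' = max_minor n (data_row y) (row_ids (insert t U))"
  have a1: "1 \<le> a" unfolding a_def by (rule rows.max_minor_ge_1[OF fin])
  have ins: "row_ids (insert t U) = insert (n + t) (row_ids U)" by auto
  have aa: "a \<le> a'"
  proof -
    obtain \<tau> where "\<tau> \<in> tuples n (row_ids U)" "\<bar>rdet n (\<lambda>r. data_row y (\<tau> ! r))\<bar> = a"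
      using rows.max_minor_attained[OF fin] unfolding a_def by blast
    thus ?thesis using rows.max_minor_ge[of "row_ids (insert t U)" \<tau>] fin
      unfolding a'_def by (auto simp: ins tuples_def)
  qed
  obtain \<tau> where \<tau>: "\<tau> \<in> tuples n (row_ids U)" "rdet n (\<lambda>r. data_row y (\<tau> ! r)) \<noteq> 0"
    "\<And>r. r < n \<Longrightarrow> \<bar>cramer n (\<lambda>r. data_row y (\<tau> ! r)) (data_row y (n + t)) r\<bar> \<le> a' / a"
    using rows.cramer_le_max_minor_ratio[OF fin, of "n + t"] unfolding a_def a'_def ins by blast
  have ratio: "1 \<le> a' / a" using a1 aa by simp
  have 1: "\<bar>drift t\<bar> \<le> real n * N * (a' / a) \<or> \<bar>drift t\<bar> \<le> N"
  proof (cases "pooled_ok t y")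
    case True thus ?thesis using ok by simp
  next
    case False
    have "\<bar>drift t\<bar> \<le> N * (\<Sum>r<n. \<bar>tuple_coeff t y \<tau> r\<bar>)"
    proof (rule drift_window[OF False N(2)])
      show "\<bar>w (Suc i)\<bar> \<le> N" if "t - K \<le> i" "i < t" for i using N(3)[of i] that by simp
      show "0 \<le> N" using N(1) by simp
      show "\<tau> \<in> tuples n ({..<n} \<union> (+) n ` {t - K..<t})" using \<tau>(1) image_mono[OF U, of "(+) n"] unfolding tuples_def by blast
    qed (use \<tau>(2) in auto)
    also have "\<dots> \<le> N * (\<Sum>r<n. a' / a)"
      using \<tau>(3) N(1) by (intro mult_left_mono sum_mono) (auto simp: tuple_coeff_def data_row_def)
    finally show ?thesis by (simp add: mult_ac)
  qed
  have 2: "N * 1 \<le> N * (a' / a)" using ratio N(1) by (intro mult_left_mono) auto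
  have 3: "\<bar>y (Suc t)\<bar> \<le> \<bar>drift t\<bar> + \<bar>w (Suc t)\<bar>" unfolding drift_def by linarith
  have 4: "\<bar>w (Suc t)\<bar> \<le> N" using N(3)[of t] by simp
  \<comment> \<open>The factor \<open>n + 2\<close> counts the \<open>n\<close> coefficients, one
    \<open>N\<close> for the noise \<open>w (Suc t)\<close> and one \<open>N\<close> for the case of
    the pooled predictor.\<close>
  have y1: "\<bar>y (Suc t)\<bar> \<le> real (n + 2) * N * (a' / a)"
  proof -
    have "real (n + 2) * N * (a' / a) = real n * N * (a' / a) + 2 * (N * (a' / a))"
      by (simp only: of_nat_add) (simp add: distrib_right del: times_divide_eq_right)
    moreover have "0 \<le> real n * N * (a' / a)" using N(1) ratio by (intro mult_nonneg_nonneg) auto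
    ultimately show ?thesis using 1 2 3 4 by linarith
  qed
  have "1 * 1 * 1 \<le> real (n + 2) * N * (a' / a)" using ratio N(1) by (intro mult_mono) auto
  hence "max 1 \<bar>y (Suc t)\<bar> \<le> real (n + 2) * N * (a' / a)" using y1 by simp
  hence "log_output (Suc t) \<le> ln (real (n + 2) * N * (a' / a))"
    unfolding log_output_def by (subst ln_le_cancel_iff) auto
  also have "\<dots> = ln (real (n + 2) * N) + (ln a' - ln a)"
    using N(1) a1 aa by (subst ln_mult, simp, simp) (simp add: ln_div)
  finally show ?thesis unfolding a_def a'_def .
qed

text \<open>Adding the times of \<open>U\<close> in increasing order telescopes the logarithms of
  the maximal minors; the initial one, over the unit rows alone, is at least 1. Earlier times of
  \<open>U\<close> are at most \<open>K\<close> steps back, hence among the candidates.\<close>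

lemma log_output_sum:
  assumes U: "U \<subseteq> {s..<s + K}"
    and N: "1 \<le> N" "\<And>j. j < n \<Longrightarrow> \<bar>\<theta> j\<bar> \<le> N" "\<And>i. s - K \<le> i \<Longrightarrow> i < s + K \<Longrightarrow> \<bar>w (Suc i)\<bar> \<le> N"
    and ok: "\<And>t. pooled_ok t y \<Longrightarrow> \<bar>drift t\<bar> \<le> N"
  shows "(\<Sum>i\<in>U. log_output (Suc i))
    \<le> real K * ln (real (n + 2) * N) + ln (max_minor n (data_row y) (row_ids U))"
proof -
  have "finite U" using U finite_subset by blast
  hence "U \<subseteq> {s..<s + K} \<longrightarrow> (\<Sum>i\<in>U. log_output (Suc i))
    \<le> real (card U) * ln (real (n + 2) * N) + ln (max_minor n (data_row y) (row_ids U))"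
  proof (induction U rule: finite_linorder_max_induct)
    case empty
    have "1 \<le> max_minor n (data_row y) (row_ids {})" by (rule rows.max_minor_ge_1) auto
    thus ?case by simp
  next
    case (insert t U)
    show ?case
    proof
      assume sub: "insert t U \<subseteq> {s..<s + K}"
      have "log_output (Suc t) \<le> ln (real (n + 2) * N)
        + (ln (max_minor n (data_row y) (row_ids (insert t U))) - ln (max_minor n (data_row y) (row_ids U)))"
      proof (rule log_output_step)
        show "U \<subseteq> {t - K..<t}"
        proof
          fix i assume "i \<in> U"
          hence "i < t" "s \<le> i" "t < s + K" using insert.hyps(2) sub by auto
          thus "i \<in> {t - K..<t}" by auto
        qed
        show "\<bar>w (Suc i)\<bar> \<le> N" if "t - K \<le> i" "i \<le> t" for i
          using N(3)[of i] that sub by (auto intro: diff_le_mono order_trans)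
      qed (use N ok in auto)
      moreover have "t \<notin> U" using insert.hyps(2) by auto
      ultimately show "(\<Sum>i\<in>insert t U. log_output (Suc i))
        \<le> real (card (insert t U)) * ln (real (n + 2) * N) + ln (max_minor n (data_row y) (row_ids (insert t U)))"
        using insert.IH insert.hyps(1) sub by (simp add: distrib_right)
    qed
  qed
  moreover have "real (card U) * ln (real (n + 2) * N) \<le> real K * ln (real (n + 2) * N)"
  proof (rule mult_right_mono)
    show "real (card U) \<le> real K" using card_mono[OF _ U] by simp
    have "1 * 1 \<le> real (n + 2) * N" using N(1) by (intro mult_mono) auto
    thus "0 \<le> ln (real (n + 2) * N)" by simp
  qed
  ultimately show ?thesis using U by simp
qed

end

section \<open>Pathwise stability\<close>

lemma rdet_zero_dependent:
  assumes "rdet n V = 0"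
  obtains c where "\<exists>r<n. c r \<noteq> 0" "\<And>j. j < n \<Longrightarrow> (\<Sum>r<n. c r * V r j) = 0"
proof -
  define A where "A = Matrix.mat n n (\<lambda>(i, j). V j i)"
  have A: "A \<in> carrier_mat n n" by (simp add: A_def)
  have "det A = 0" using assms by (simp add: A_def rdet_def)
  then obtain v where v: "v \<in> carrier_vec n" "v \<noteq> 0\<^sub>v n" "A *\<^sub>v v = 0\<^sub>v n"
    using det_0_iff_vec_prod_zero_field[OF A] by auto
  show ?thesis
  proof (rule that[of "vec_index v"])
    show "\<exists>r<n. v $ r \<noteq> 0"
    proof (rule ccontr)
      assume "\<not> ?thesis"
      hence "v = 0\<^sub>v n" using v(1) by (intro eq_vecI) auto
      thus False using v(2) by simp
    qed
    fix j assume j: "j < n"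
    have "(\<Sum>r<n. v $ r * V r j) = (A *\<^sub>v v) $ j"
      using j v(1) by (auto simp: A_def scalar_prod_def lessThan_atLeast0 mult.commute intro!: sum.cong)
    thus "(\<Sum>r<n. v $ r * V r j) = 0" using v(3) j by simp
  qed
qed

text \<open>Look at the index \<open>q\<close> that maximises \<open>|c q| * N q\<close>. In its
  equation the deviations of \<open>G\<close> from the diagonal matrix add up to at most half of
  this maximum.\<close>

lemma diagonally_dominant_bound:
  fixes G :: "nat \<Rightarrow> nat \<Rightarrow> real" and c N :: "nat \<Rightarrow> real"
  assumes G: "\<And>q r. q < n \<Longrightarrow> r < n \<Longrightarrow> \<bar>G q r - (if q = r then N r else 0)\<bar> \<le> N r / (2 * real n)"
    and N: "\<And>r. r < n \<Longrightarrow> 0 \<le> N r"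
    and h: "\<And>q. q < n \<Longrightarrow> \<bar>\<Sum>r<n. c r * G q r\<bar> \<le> H"
    and r: "r < n"
  shows "\<bar>c r\<bar> * N r \<le> 2 * H"
proof -
  define M where "M = Max ((\<lambda>r. \<bar>c r\<bar> * N r) ` {..<n})"
  have fin: "finite ((\<lambda>r. \<bar>c r\<bar> * N r) ` {..<n})" "(\<lambda>r. \<bar>c r\<bar> * N r) ` {..<n} \<noteq> {}" using r by auto
  obtain q where q: "q < n" "M = \<bar>c q\<bar> * N q" using Max_in[OF fin] by (auto simp: M_def)
  have M: "\<bar>c r\<bar> * N r \<le> M" if "r < n" for r unfolding M_def using fin(1) that by (intro Max_ge) auto
  have "c q * N q = (\<Sum>r<n. c r * (if q = r then N r else 0))"
    using q(1) by (simp add: if_distrib cong: if_cong)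
  also have "\<dots> = (\<Sum>r<n. c r * G q r) - (\<Sum>r<n. c r * (G q r - (if q = r then N r else 0)))"
    by (simp add: sum_subtractf[symmetric] right_diff_distrib)
  finally have "\<bar>c q * N q\<bar> \<le> H + (\<Sum>r<n. \<bar>c r * (G q r - (if q = r then N r else 0))\<bar>)"
    using h[OF q(1)] sum_abs[of "\<lambda>r. c r * (G q r - (if q = r then N r else 0))" "{..<n}"] by linarith
  also have "(\<Sum>r<n. \<bar>c r * (G q r - (if q = r then N r else 0))\<bar>) \<le> (\<Sum>r<n. M / (2 * real n))"
  proof (rule sum_mono)
    fix r assume "r \<in> {..<n}"
    hence r: "r < n" by simp
    have "\<bar>c r * (G q r - (if q = r then N r else 0))\<bar> \<le> \<bar>c r\<bar> * (N r / (2 * real n))"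
      unfolding abs_mult using G[OF q(1) r] by (intro mult_left_mono) auto
    also have "\<dots> = \<bar>c r\<bar> * N r / (2 * real n)" by simp
    also have "\<dots> \<le> M / (2 * real n)" using M[OF r] by (intro divide_right_mono) auto
    finally show "\<bar>c r * (G q r - (if q = r then N r else 0))\<bar> \<le> M / (2 * real n)" .
  qed
  also have "(\<Sum>r<n. M / (2 * real n)) = M / 2" using r by simp
  finally have "M \<le> H + M / 2" using q N[OF q(1)] by (simp add: abs_mult)
  thus ?thesis using M[OF r] by simp
qed

text \<open>A time \<open>i\<close> belongs to the windows of at most \<open>2 * K + 1\<close>
  indices \<open>s\<close>.\<close>

lemma sum_sliding_window_le:
  fixes a :: "nat \<Rightarrow> real"
  assumes a: "\<And>i. 0 \<le> a i"
  shows "(\<Sum>s\<le>T. \<Sum>i\<in>{s - K..<s + K}. a i) \<le> real (2 * K + 1) * (\<Sum>i<T + K. a i)"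
proof -
  have "(\<Sum>s\<le>T. \<Sum>i\<in>{s - K..<s + K}. a i) = (\<Sum>s\<le>T. \<Sum>i<T + K. if i \<in> {s - K..<s + K} then a i else 0)"
  proof (rule sum.cong[OF refl])
    fix s assume "s \<in> {..T}"
    hence "{s - K..<s + K} = {..<T + K} \<inter> {s - K..<s + K}" by auto
    thus "(\<Sum>i\<in>{s - K..<s + K}. a i) = (\<Sum>i<T + K. if i \<in> {s - K..<s + K} then a i else 0)"
      by (simp only: sum.inter_restrict[OF finite_lessThan, symmetric])
  qed
  also have "\<dots> = (\<Sum>i<T + K. \<Sum>s\<le>T. if i \<in> {s - K..<s + K} then a i else 0)" by (rule sum.swap)
  also have "\<dots> \<le> (\<Sum>i<T + K. real (2 * K + 1) * a i)"
  proof (rule sum_mono)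
    fix i
    have "(\<Sum>s\<le>T. if i \<in> {s - K..<s + K} then a i else 0) = (\<Sum>s\<in>{s\<in>{..T}. i \<in> {s - K..<s + K}}. a i)"
      by (rule sum.inter_filter[symmetric]) simp
    also have "\<dots> = real (card {s\<in>{..T}. i \<in> {s - K..<s + K}}) * a i" by simp
    also have "\<dots> \<le> real (2 * K + 1) * a i"
    proof (rule mult_right_mono)
      have "{s\<in>{..T}. i \<in> {s - K..<s + K}} \<subseteq> {i - K..i + K}" by auto
      hence "card {s\<in>{..T}. i \<in> {s - K..<s + K}} \<le> card {i - K..i + K}" by (intro card_mono) auto
      also have "\<dots> \<le> 2 * K + 1" by simp
      finally show "real (card {s\<in>{..T}. i \<in> {s - K..<s + K}}) \<le> real (2 * K + 1)" by (simp only: of_nat_le_iff)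
    qed (rule a)
    finally show "(\<Sum>s\<le>T. if i \<in> {s - K..<s + K} then a i else 0) \<le> real (2 * K + 1) * a i" .
  qed
  finally show ?thesis by (simp add: sum_distrib_left)
qed

lemma card_exceed_le:
  fixes a :: "nat \<Rightarrow> real"
  assumes "\<And>i. 0 \<le> a i" "0 < A"
  shows "real (card {i. i < T \<and> A < a i}) \<le> (\<Sum>i<T. a i) / A"
proof -
  have "A * real (card {i. i < T \<and> A < a i}) = (\<Sum>i\<in>{i. i < T \<and> A < a i}. A)" by simp
  also have "\<dots> \<le> (\<Sum>i\<in>{i. i < T \<and> A < a i}. a i)" by (rule sum_mono) auto
  also have "\<dots> \<le> (\<Sum>i<T. a i)" by (rule sum_mono2) (use assms in auto)
  finally show ?thesis using assms(2) by (simp add: field_simps)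
qed

text \<open>Collects the facts about the noise that hold almost surely, so that the rest is
  deterministic. \<open>g\<close> is a dual system: on \<open>B r\<close> the coordinates of the
  regressor are near the \<open>r\<close>-th unit vector. \<open>visits\<close> is the counting form
  of the fact that from a bounded \<open>drift\<close> Gaussian noise hits \<open>B r\<close> with
  probability bounded below.\<close>

locale stable_path = exponents n b + closed_loop n K \<phi> B \<theta> w y
  for n :: nat and b :: "nat \<Rightarrow> real" and K :: nat and \<phi> :: "real \<Rightarrow> nat \<Rightarrow> real"
    and B :: "nat \<Rightarrow> real set" and \<theta> w y :: "nat \<Rightarrow> real" +
  fixes C0 L :: real and g :: "nat \<Rightarrow> nat \<Rightarrow> real"
  assumes window: "contraction_window K C0"
    and L: "1 \<le> L"
    and growth: "\<And>v j. j < n \<Longrightarrow> \<bar>\<phi> v j\<bar> \<le> L * exp (b j * ln (max 1 \<bar>v\<bar>))"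
    and B: "\<And>r q v. r < n \<Longrightarrow> q < n \<Longrightarrow> v \<in> B r \<Longrightarrow>
       \<bar>(\<Sum>j<n. g q j * \<phi> v j) - (if q = r then 1 else 0)\<bar> \<le> 1 / (2 * real n)"
    and noise_le: "\<exists>C. \<forall>t. \<bar>w (Suc t)\<bar> \<le> C * sqrt (1 + ln (real (t + 1)))"
    and noise_sq: "\<exists>C. \<forall>T. (\<Sum>t<T. (w (Suc t))\<^sup>2) \<le> C * real (T + 1)"
    and noise_sums: "\<exists>C. \<forall>r<n. \<forall>t. \<bar>noise_sum r t\<bar> \<le> C * real (t + 1) powr (5 / 8)"
    and visits: "\<And>l :: nat. \<exists>c>0. \<exists>C. \<forall>r<n. \<forall>T. c * real (card {t. t < T \<and> \<bar>drift t\<bar> \<le> real l})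
       - C * (1 + ln (real (T + 1))) \<le> real (card {t. t < T \<and> y (Suc t) \<in> B r})"
begin

lemma b_le_b0: "j < n \<Longrightarrow> b j \<le> b 0"
  using n_pos by (subst (1 2) b_eq_sum_beta) (auto intro!: sum_mono2 less_imp_le[OF beta_pos])

lemma drift_pooled_bounded: obtains A where "1 \<le> A" "\<And>t. pooled_ok t y \<Longrightarrow> \<bar>drift t\<bar> \<le> A"
proof -
  obtain C where C: "\<And>r t. r < n \<Longrightarrow> \<bar>noise_sum r t\<bar> \<le> C * real (t + 1) powr (5 / 8)"
    using noise_sums by blast
  have "\<bar>noise_sum 0 0\<bar> \<le> C * real (0 + 1) powr (5 / 8)" using C[of 0 0] n_pos by simp
  hence C_nonneg: "0 \<le> C" by simp
  show ?thesis
  proof (rule that[of "1 + real n * C"])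
    show "1 \<le> 1 + real n * C" using C_nonneg by simp
    fix t assume "pooled_ok t y"
    hence "\<bar>drift t\<bar> \<le> real (t + 1) powr (- 3 / 4) * (\<Sum>r<n. \<bar>noise_sum r t\<bar>)" by (rule drift_pooled)
    also have "\<dots> \<le> real (t + 1) powr (- 3 / 4) * (\<Sum>r<n. C * real (t + 1) powr (5 / 8))"
      using C by (intro mult_left_mono sum_mono) auto
    also have "\<dots> = real n * C * (real (t + 1) powr (- 3 / 4) * real (t + 1) powr (5 / 8))" by simp
    also have "real (t + 1) powr (- 3 / 4) * real (t + 1) powr (5 / 8) = real (t + 1) powr (- 1 / 8)"
      by (subst powr_add[symmetric]) simp
    also have "real n * C * \<dots> \<le> real n * C * 1"
      using powr_mono[of "- 1 / 8" 0 "real (t + 1)"] C_nonneg by (intro mult_left_mono) auto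
    finally show "\<bar>drift t\<bar> \<le> 1 + real n * C" by simp
  qed
qed

text \<open>\<open>log_output_sum\<close> bounds the sum by a maximal minor, and
  \<open>max_minor_le\<close> bounds the minor by matchings into \<open>U\<close>. The summand 1
  makes the constant visibly positive, as \<open>contraction_window\<close> requires.\<close>

lemma matching_dominated_log_output:
  assumes N: "1 \<le> N" "\<And>j. j < n \<Longrightarrow> \<bar>\<theta> j\<bar> \<le> N" "\<And>i. s - K \<le> i \<Longrightarrow> i < s + K \<Longrightarrow> \<bar>w (Suc i)\<bar> \<le> N"
    and ok: "\<And>t. pooled_ok t y \<Longrightarrow> \<bar>drift t\<bar> \<le> N"
  shows "matching_dominated (real K * ln (real (n + 2) * N) + ln (fact n * L ^ n) + 1) log_output {s..<s + K}"
  unfolding matching_dominated_def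
proof (intro allI impI)
  fix U H assume U: "U \<subseteq> {s..<s + K}"
    and H: "\<forall>J g. J \<subseteq> {..<n} \<longrightarrow> inj_on g J \<longrightarrow> g ` J \<subseteq> U \<longrightarrow> (\<Sum>j\<in>J. b j * log_output (g j)) \<le> H"
  have fin: "finite (row_ids U)" "{..<n} \<subseteq> row_ids U" using finite_subset[OF U] by auto
  have "max_minor n (data_row y) (row_ids U) \<le> fact n * (L ^ n * exp H)"
  proof (rule rows.max_minor_le[OF fin L, where b = b and x = log_output])
    fix k j assume "k \<in> row_ids U" "n \<le> k" "j < n"
    thus "\<bar>data_row y k j\<bar> \<le> L * exp (b j * log_output (k - n))"
      using growth[of j "y (k - n)"] by (simp add: data_row_def log_output_def)
  next
    fix J g assume "J \<subseteq> {..<n}" "inj_on g J" "g ` J \<subseteq> {i. n + i \<in> row_ids U}"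
    moreover have "{i. n + i \<in> row_ids U} = U" by auto
    ultimately show "(\<Sum>j\<in>J. b j * log_output (g j)) \<le> H" using H by simp
  qed
  moreover have "1 \<le> max_minor n (data_row y) (row_ids U)" by (rule rows.max_minor_ge_1[OF fin])
  ultimately have "ln (max_minor n (data_row y) (row_ids U)) \<le> ln (fact n * L ^ n * exp H)"
    by (subst ln_le_cancel_iff) (auto simp: mult.assoc)
  also have "\<dots> = ln (fact n * L ^ n) + H" using L by (subst ln_mult) auto
  finally show "(\<Sum>i\<in>U. log_output (Suc i)) \<le> real K * ln (real (n + 2) * N) + ln (fact n * L ^ n) + 1 + H"
    using log_output_sum[OF U N ok] by simp
qed

text \<open>The constant of each window depends on the noise near \<open>s\<close> through a
  logarithm, and even \<open>ln z \<le> z\<close> is good enough: averages of the noise are bounded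
  and its maxima are of order \<open>sqrt (ln T)\<close>. These two facts feed the two conclusions
  of \<open>contracting_windows\<close>.\<close>

lemma log_output_bounds:
  obtains c where "\<And>T. (\<Sum>t\<le>T. log_output t) \<le> c * real (T + 1)"
    "\<And>T. log_output T \<le> c * (1 + sqrt (1 + ln (real (T + K + 1))))"
proof -
  obtain A where A: "1 \<le> A" "\<And>t. pooled_ok t y \<Longrightarrow> \<bar>drift t\<bar> \<le> A" by (rule drift_pooled_bounded) blast
  obtain C1 where C1: "\<And>t. \<bar>w (Suc t)\<bar> \<le> C1 * sqrt (1 + ln (real (t + 1)))" using noise_le by blast
  have C1_nonneg: "0 \<le> C1" using C1[of 0] by simp
  obtain C2 where C2: "\<And>T. (\<Sum>t<T. (w (Suc t))\<^sup>2) \<le> C2 * real (T + 1)" using noise_sq by blast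
  have C2_nonneg: "0 \<le> C2" using C2[of 0] by simp
  define a0 where "a0 = A + (\<Sum>j<n. \<bar>\<theta> j\<bar>)"
  have a0: "1 \<le> a0" using A(1) by (auto simp: a0_def intro!: add_increasing2 sum_nonneg)
  \<comment> \<open>A sum rather than a maximum over the window, so that summing over
    \<open>s\<close> gives a sliding-window sum.\<close>
  define N where "N = (\<lambda>s. a0 + (\<Sum>i\<in>{s - K..<s + K}. \<bar>w (Suc i)\<bar>))"
  define \<gamma> where "\<gamma> = (\<lambda>s. real K * ln (real (n + 2) * N s) + ln (fact n * L ^ n) + 1)"
  have Na: "a0 \<le> N s" for s by (auto simp: N_def intro!: sum_nonneg)
  have dom: "matching_dominated (\<gamma> s) log_output {s..<s + K}" for s
    unfolding \<gamma>_def
  proof (rule matching_dominated_log_output)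
    show "1 \<le> N s" using Na[of s] a0 by simp
    show "\<bar>\<theta> j\<bar> \<le> N s" if "j < n" for j
      using Na[of s] A(1) member_le_sum[of j "{..<n}" "\<lambda>j. \<bar>\<theta> j\<bar>"] that by (simp add: a0_def)
    show "\<bar>w (Suc i)\<bar> \<le> N s" if "s - K \<le> i" "i < s + K" for i
      using a0 member_le_sum[of i "{s - K..<s + K}" "\<lambda>i. \<bar>w (Suc i)\<bar>"] that by (simp add: N_def)
    show "\<bar>drift t\<bar> \<le> N s" if "pooled_ok t y" for t
      using A(2)[OF that] Na[of s] sum_nonneg[of "{..<n}" "\<lambda>j. \<bar>\<theta> j\<bar>", OF abs_ge_zero]
      unfolding a0_def by linarith
  qed
  have lnL: "0 \<le> ln (fact n * L ^ n)"
  proof -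
    have "1 * 1 \<le> fact n * L ^ n" using L by (intro mult_mono) auto
    thus ?thesis by simp
  qed
  have \<gamma>_pos: "0 < \<gamma> s" for s
  proof -
    have "1 * 1 \<le> real (n + 2) * N s" using Na[of s] a0 by (intro mult_mono) auto
    thus ?thesis using lnL by (auto simp: \<gamma>_def intro!: add_nonneg_pos)
  qed
  define k0 where "k0 = ln (fact n * L ^ n) + 1"
  define k1 where "k1 = real K * real (n + 2)"
  have k1: "0 \<le> k1" by (simp add: k1_def)
  have \<gamma>_le: "\<gamma> s \<le> k0 + k1 * N s" for s
  proof -
    have "ln (real (n + 2) * N s) \<le> real (n + 2) * N s"
      using Na[of s] a0 by (intro ln_bound) auto
    hence "real K * ln (real (n + 2) * N s) \<le> real K * (real (n + 2) * N s)" by (intro mult_left_mono) auto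
    thus ?thesis by (simp add: \<gamma>_def k0_def k1_def)
  qed
  have K1: "1 \<le> K" and C0: "1 \<le> C0" using window by (simp_all add: contraction_window_def)
  have contr: "(\<forall>t. s \<le> t \<longrightarrow> t \<le> s + K \<longrightarrow> log_output t \<le> C0 * (log_output s + \<gamma> s)) \<and>
      (\<exists>s'. s < s' \<and> s' \<le> s + K \<and> log_output s' \<le> log_output s / 2 + \<gamma> s)" for s
    using window \<gamma>_pos[of s] dom[of s] log_output_nonneg unfolding contraction_window_def by blast
  note cw = contracting_windows[of log_output \<gamma> K C0, OF log_output_nonneg less_imp_le[OF \<gamma>_pos] K1 C0
      contr[THEN conjunct1, rule_format] contr[THEN conjunct2]]
  define m1 where "m1 = k0 + k1 * a0 + k1 * (real (2 * K + 1) * ((1 + C2) * real (K + 1)))"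
  have sum_w: "(\<Sum>i<T + K. \<bar>w (Suc i)\<bar>) \<le> (1 + C2) * (real (K + 1) * real (T + 1))" for T
  proof -
    have "(\<Sum>i<T + K. \<bar>w (Suc i)\<bar>) \<le> (\<Sum>i<T + K. 1 + (w (Suc i))\<^sup>2)"
    proof (rule sum_mono)
      fix i
      have "0 \<le> (\<bar>w (Suc i)\<bar> - 1)\<^sup>2" by simp
      hence "2 * \<bar>w (Suc i)\<bar> \<le> 1 + (w (Suc i))\<^sup>2" by (simp add: power2_diff)
      thus "\<bar>w (Suc i)\<bar> \<le> 1 + (w (Suc i))\<^sup>2" by simp
    qed
    also have "\<dots> \<le> real (T + K + 1) + C2 * real (T + K + 1)" using C2[of "T + K"] by (simp add: sum.distrib)
    also have "\<dots> = (1 + C2) * real (T + K + 1)" by (simp add: algebra_simps)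
    also have "\<dots> \<le> (1 + C2) * (real (K + 1) * real (T + 1))"
      using C2_nonneg by (intro mult_left_mono) (auto simp: algebra_simps)
    finally show ?thesis .
  qed
  have sum_\<gamma>: "(\<Sum>t\<le>T. \<gamma> t) \<le> m1 * real (T + 1)" for T
  proof -
    define Q where "Q = (\<Sum>s\<le>T. \<Sum>i\<in>{s - K..<s + K}. \<bar>w (Suc i)\<bar>)"
    have "Q \<le> real (2 * K + 1) * (\<Sum>i<T + K. \<bar>w (Suc i)\<bar>)"
      unfolding Q_def by (rule sum_sliding_window_le) simp
    also have "\<dots> \<le> real (2 * K + 1) * ((1 + C2) * (real (K + 1) * real (T + 1)))"
      by (intro mult_left_mono sum_w) simp
    finally have "k1 * Q \<le> k1 * (real (2 * K + 1) * ((1 + C2) * (real (K + 1) * real (T + 1))))"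
      using k1 by (rule mult_left_mono)
    moreover have "(\<Sum>t\<le>T. \<gamma> t) \<le> (\<Sum>t\<le>T. k0 + k1 * N t)" by (rule sum_mono) (rule \<gamma>_le)
    moreover have "(\<Sum>t\<le>T. k0 + k1 * N t) = (k0 + k1 * a0) * real (T + 1) + k1 * Q"
      unfolding Q_def N_def by (simp add: sum.distrib sum_distrib_left[symmetric] algebra_simps)
    moreover have "m1 * real (T + 1) = (k0 + k1 * a0) * real (T + 1)
        + k1 * (real (2 * K + 1) * ((1 + C2) * (real (K + 1) * real (T + 1))))"
      unfolding m1_def by (simp only: distrib_right mult.assoc)
    ultimately show ?thesis by linarith
  qed
  have \<gamma>_le2: "\<gamma> s \<le> k0 + k1 * (a0 + real (2 * K) * (C1 * sqrt (1 + ln (real (T + K + 1)))))"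
    if "s \<le> T" for s T
  proof -
    have "(\<Sum>i\<in>{s - K..<s + K}. \<bar>w (Suc i)\<bar>) \<le> (\<Sum>i\<in>{s - K..<s + K}. C1 * sqrt (1 + ln (real (T + K + 1))))"
    proof (rule sum_mono)
      fix i assume i: "i \<in> {s - K..<s + K}"
      have "\<bar>w (Suc i)\<bar> \<le> C1 * sqrt (1 + ln (real (i + 1)))" by (rule C1)
      also have "\<dots> \<le> C1 * sqrt (1 + ln (real (T + K + 1)))"
        using i that C1_nonneg by (intro mult_left_mono real_sqrt_le_mono add_left_mono) (auto intro!: ln_mono)
      finally show "\<bar>w (Suc i)\<bar> \<le> C1 * sqrt (1 + ln (real (T + K + 1)))" .
    qed
    also have "\<dots> = real (card {s - K..<s + K}) * (C1 * sqrt (1 + ln (real (T + K + 1))))" by simp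
    also have "\<dots> \<le> real (2 * K) * (C1 * sqrt (1 + ln (real (T + K + 1))))"
      using C1_nonneg by (intro mult_right_mono mult_nonneg_nonneg) auto
    finally have "N s \<le> a0 + real (2 * K) * (C1 * sqrt (1 + ln (real (T + K + 1))))" by (simp add: N_def)
    hence "k1 * N s \<le> k1 * (a0 + real (2 * K) * (C1 * sqrt (1 + ln (real (T + K + 1)))))"
      using k1 by (rule mult_left_mono)
    thus ?thesis using \<gamma>_le[of s] by simp
  qed
  have k0_nonneg: "0 \<le> k0" using lnL by (simp add: k0_def)
  define x0 where "x0 = log_output 0"
  have x0: "0 \<le> x0" by (simp add: x0_def log_output_nonneg)
  define c where "c = 3 * C0 * real (K + 1) * (x0 + m1) + C0 * (x0 + 3 * (k0 + k1 * a0)) + C0 * (3 * (k1 * (real (2 * K) * C1)))"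
  have m1_nonneg: "0 \<le> m1" unfolding m1_def using k0_nonneg k1 a0 C2_nonneg by auto
  show ?thesis
  proof (rule that[of c])
    fix T
    have "(\<Sum>t\<le>T. log_output t) \<le> 3 * C0 * real (K + 1) * (x0 + (\<Sum>t\<le>T. \<gamma> t))"
      using cw(1)[of T] by (simp add: x0_def)
    also have "\<dots> \<le> 3 * C0 * real (K + 1) * ((x0 + m1) * real (T + 1))"
    proof (rule mult_left_mono)
      have "x0 * 1 \<le> x0 * real (T + 1)" using x0 by (intro mult_left_mono) auto
      thus "x0 + (\<Sum>t\<le>T. \<gamma> t) \<le> (x0 + m1) * real (T + 1)" using sum_\<gamma>[of T] by (simp add: distrib_right)
    qed (use C0 in simp)
    also have "\<dots> = (3 * C0 * real (K + 1) * (x0 + m1)) * real (T + 1)" by simp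
    also have "\<dots> \<le> c * real (T + 1)"
      unfolding c_def using C0 x0 k0_nonneg k1 a0 C1_nonneg by (intro mult_right_mono) auto
    finally show "(\<Sum>t\<le>T. log_output t) \<le> c * real (T + 1)" .
    define S where "S = sqrt (1 + ln (real (T + K + 1)))"
    have S: "0 \<le> S" by (simp add: S_def)
    have "log_output T \<le> C0 * (x0 + 3 * (k0 + k1 * (a0 + real (2 * K) * (C1 * S))))"
      using cw(2)[of T "k0 + k1 * (a0 + real (2 * K) * (C1 * S))"] \<gamma>_le2 by (simp add: x0_def S_def)
    also have "\<dots> = C0 * (x0 + 3 * (k0 + k1 * a0)) * 1 + C0 * (3 * (k1 * (real (2 * K) * C1))) * S"
      by (simp add: algebra_simps)
    also have "\<dots> \<le> c * 1 + c * S"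
      using S C0 x0 k0_nonneg k1 a0 C1_nonneg m1_nonneg
      by (intro add_mono mult_right_mono) (auto simp: c_def intro!: add_increasing add_increasing2)
    finally show "log_output T \<le> c * (1 + sqrt (1 + ln (real (T + K + 1))))" by (simp add: S_def distrib_left)
  qed
qed

text \<open>The drift is the difference of the next output and its noise, so it is bounded when both
  are. By Markov's inequality each of them is large at most a quarter of the time.\<close>

lemma drift_often_bounded:
  obtains l :: nat where "\<And>T. 1 \<le> T \<Longrightarrow> real T / 2 \<le> real (card {t. t < T \<and> \<bar>drift t\<bar> \<le> real l})"
proof -
  obtain c where c: "\<And>T. (\<Sum>t\<le>T. log_output t) \<le> c * real (T + 1)"
    "\<And>T. log_output T \<le> c * (1 + sqrt (1 + ln (real (T + K + 1))))"
    by (rule log_output_bounds) blast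
  obtain C2 where C2: "\<And>T. (\<Sum>t<T. (w (Suc t))\<^sup>2) \<le> C2 * real (T + 1)" using noise_sq by blast
  have C2_nonneg: "0 \<le> C2" using C2[of 0] by simp
  have c_nonneg: "0 \<le> c" using c(1)[of 0] log_output_nonneg[of 0] by simp
  \<comment> \<open>The factor 8 is the wanted 4 times the loss in \<open>T + 1 \<le> 2 * T\<close>;
    adding 1 keeps the threshold positive.\<close>
  define a where "a = 8 * (c + 1)"
  define d where "d = 8 * (C2 + 1)"
  have d: "1 \<le> d" using C2_nonneg by (simp add: d_def)
  obtain l :: nat where l: "exp a + d < real l" using reals_Archimedean2 by blast
  show ?thesis
  proof (rule that[of l])
    fix T :: nat assume T: "1 \<le> T"
    have "real (card {t. t < T \<and> a < log_output (Suc t)}) \<le> (\<Sum>t<T. log_output (Suc t)) / a"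
      by (rule card_exceed_le) (use c_nonneg in \<open>auto simp: log_output_nonneg a_def\<close>)
    also have "\<dots> \<le> (c * (2 * real T)) / a"
    proof (rule divide_right_mono)
      have "(\<Sum>t<T. log_output (Suc t)) \<le> (\<Sum>t\<le>T. log_output t)"
        using log_output_nonneg[of 0] sum.lessThan_Suc_shift[of log_output T]
        by (simp add: lessThan_Suc_atMost)
      also have "\<dots> \<le> c * real (T + 1)" by (rule c(1))
      also have "\<dots> \<le> c * (2 * real T)" using c_nonneg T by (intro mult_left_mono) auto
      finally show "(\<Sum>t<T. log_output (Suc t)) \<le> c * (2 * real T)" .
    qed (use c_nonneg in \<open>simp add: a_def\<close>)
    also have "\<dots> \<le> real T / 4"
    proof -
      have "c * (8 * real T) \<le> (c + 1) * (8 * real T)" by (intro mult_right_mono) auto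
      thus ?thesis using c_nonneg by (simp add: a_def divide_le_eq algebra_simps)
    qed
    finally have 1: "real (card {t. t < T \<and> a < log_output (Suc t)}) \<le> real T / 4" .
    have "real (card {t. t < T \<and> d < (w (Suc t))\<^sup>2}) \<le> (\<Sum>t<T. (w (Suc t))\<^sup>2) / d"
      by (rule card_exceed_le) (use d in auto)
    also have "\<dots> \<le> (C2 * (2 * real T)) / d"
    proof (rule divide_right_mono)
      have "(\<Sum>t<T. (w (Suc t))\<^sup>2) \<le> C2 * real (T + 1)" by (rule C2)
      also have "\<dots> \<le> C2 * (2 * real T)" using C2_nonneg T by (intro mult_left_mono) auto
      finally show "(\<Sum>t<T. (w (Suc t))\<^sup>2) \<le> C2 * (2 * real T)" .
    qed (use d in simp)
    also have "\<dots> \<le> real T / 4"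
    proof -
      have "C2 * (8 * real T) \<le> (C2 + 1) * (8 * real T)" by (intro mult_right_mono) auto
      thus ?thesis using C2_nonneg by (simp add: d_def divide_le_eq algebra_simps)
    qed
    finally have 2: "real (card {t. t < T \<and> d < (w (Suc t))\<^sup>2}) \<le> real T / 4" .
    have sub: "{..<T} \<subseteq> {t. t < T \<and> \<bar>drift t\<bar> \<le> real l} \<union> {t. t < T \<and> a < log_output (Suc t)} \<union> {t. t < T \<and> d < (w (Suc t))\<^sup>2}"
    proof
      fix t assume t: "t \<in> {..<T}"
      show "t \<in> {t. t < T \<and> \<bar>drift t\<bar> \<le> real l} \<union> {t. t < T \<and> a < log_output (Suc t)} \<union> {t. t < T \<and> d < (w (Suc t))\<^sup>2}"
      proof (cases "a < log_output (Suc t) \<or> d < (w (Suc t))\<^sup>2")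
        case True thus ?thesis using t by auto
      next
        case False
        hence "ln (max 1 \<bar>y (Suc t)\<bar>) \<le> a" "(w (Suc t))\<^sup>2 \<le> d" by (auto simp: log_output_def)
        hence "max 1 \<bar>y (Suc t)\<bar> \<le> exp a" using exp_ln[of "max 1 \<bar>y (Suc t)\<bar>"]
          exp_le_cancel_iff[of "ln (max 1 \<bar>y (Suc t)\<bar>)" a] by simp
        moreover have "\<bar>w (Suc t)\<bar> \<le> d"
        proof (rule power2_le_imp_le)
          have "d * 1 \<le> d * d" using d by (intro mult_left_mono) auto
          thus "\<bar>w (Suc t)\<bar>\<^sup>2 \<le> d\<^sup>2" using \<open>(w (Suc t))\<^sup>2 \<le> d\<close> by (simp add: power2_eq_square)
        qed (use d in simp)
        ultimately have "\<bar>drift t\<bar> \<le> real l" using l unfolding drift_def by linarith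
        thus ?thesis using t by auto
      qed
    qed
    have "card {..<T} \<le> card ({t. t < T \<and> \<bar>drift t\<bar> \<le> real l} \<union> {t. t < T \<and> a < log_output (Suc t)} \<union> {t. t < T \<and> d < (w (Suc t))\<^sup>2})"
      using sub by (intro card_mono) auto
    also have "\<dots> \<le> card {t. t < T \<and> \<bar>drift t\<bar> \<le> real l} + card {t. t < T \<and> a < log_output (Suc t)} + card {t. t < T \<and> d < (w (Suc t))\<^sup>2}"
      by (meson add_right_mono card_Un_le order_trans)
    finally have "T \<le> card {t. t < T \<and> \<bar>drift t\<bar> \<le> real l} + card {t. t < T \<and> a < log_output (Suc t)} + card {t. t < T \<and> d < (w (Suc t))\<^sup>2}"
      by simp
    hence "real T \<le> real (card {t. t < T \<and> \<bar>drift t\<bar> \<le> real l}) + real (card {t. t < T \<and> a < log_output (Suc t)}) + real (card {t. t < T \<and> d < (w (Suc t))\<^sup>2})"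
      by (simp only: of_nat_add[symmetric] of_nat_le_iff)
    thus "real T / 2 \<le> real (card {t. t < T \<and> \<bar>drift t\<bar> \<le> real l})" using 1 2 by simp
  qed
qed

text \<open>Half of the times have bounded drift, and visits are proportional to these up to a
  logarithm. Passing from \<open>c / 2\<close> to \<open>c / 4\<close> absorbs the logarithm and the
  shift from \<open>i\<close> to \<open>Suc i\<close>.\<close>

lemma visits_linear:
  obtains c where "0 < c" "\<forall>\<^sub>F t in sequentially. \<forall>r<n. c * real t \<le> real (card {i. i < t \<and> y i \<in> B r})"
proof -
  obtain l where l: "\<And>T. 1 \<le> T \<Longrightarrow> real T / 2 \<le> real (card {t. t < T \<and> \<bar>drift t\<bar> \<le> real l})"
    by (rule drift_often_bounded) blast
  obtain c C where c: "0 < c" and C: "\<And>r T. r < n \<Longrightarrow> c * real (card {t. t < T \<and> \<bar>drift t\<bar> \<le> real l})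
       - C * (1 + ln (real (T + 1))) \<le> real (card {t. t < T \<and> y (Suc t) \<in> B r})"
    using visits[of l] by blast
  have "\<forall>\<^sub>F t in sequentially. c / 4 * real t \<le> c / 2 * (real t - 1) - C * (1 + ln (real t))"
    using c by real_asymp
  moreover have "\<forall>\<^sub>F t :: nat in sequentially. 2 \<le> t" by (rule eventually_ge_at_top)
  ultimately have "\<forall>\<^sub>F t in sequentially. \<forall>r<n. c / 4 * real t \<le> real (card {i. i < t \<and> y i \<in> B r})"
  proof eventually_elim
    case (elim t)
    show ?case
    proof (intro allI impI)
      fix r assume r: "r < n"
      have "c / 2 * (real t - 1) = c * (real (t - 1) / 2)" using elim by (simp add: of_nat_diff)
      also have "\<dots> \<le> c * real (card {i. i < t - 1 \<and> \<bar>drift i\<bar> \<le> real l})"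
        using c l[of "t - 1"] elim by (intro mult_left_mono) auto
      also have "\<dots> \<le> real (card {i. i < t - 1 \<and> y (Suc i) \<in> B r}) + C * (1 + ln (real t))"
        using C[OF r, of "t - 1"] elim by simp
      also have "card {i. i < t - 1 \<and> y (Suc i) \<in> B r} = card (Suc ` {i. i < t - 1 \<and> y (Suc i) \<in> B r})"
        by (simp add: card_image)
      also have "real \<dots> \<le> real (card {i. i < t \<and> y i \<in> B r})"
        by (intro of_nat_mono card_mono) auto
      finally show "c / 4 * real t \<le> real (card {i. i < t \<and> y i \<in> B r})" using elim by simp
    qed
  qed
  thus ?thesis using that[of "c / 4"] c by simp
qed

text \<open>\<open>sqrt (ln t)\<close> is negligible against \<open>ln t\<close>, so any positive
  power of \<open>t\<close> would do; \<open>1 / 16\<close> fits the coefficient test because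
  \<open>1 / 16 - 1 < - 3 / 4\<close>.\<close>

lemma output_power_small: "\<forall>\<^sub>F t in sequentially. exp (b 0 * log_output t) \<le> real (t + 1) powr (1 / 16)"
proof -
  obtain c where c: "\<And>T. (\<Sum>t\<le>T. log_output t) \<le> c * real (T + 1)"
    "\<And>T. log_output T \<le> c * (1 + sqrt (1 + ln (real (T + K + 1))))"
    by (rule log_output_bounds) blast
  define k where "k = b 0 * c"
  have "\<forall>\<^sub>F t in sequentially. k * (1 + sqrt (1 + ln (real t + real K + 1))) \<le> 1 / 16 * ln (real t + 1)"
    by real_asymp
  thus ?thesis
  proof eventually_elim
    case (elim t)
    have "b 0 * log_output t \<le> b 0 * (c * (1 + sqrt (1 + ln (real (t + K + 1)))))"
      using c(2)[of t] b_0 by (intro mult_left_mono) auto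
    also have "\<dots> \<le> 1 / 16 * ln (real (t + 1))" using elim by (simp add: k_def mult.assoc add_ac)
    finally show ?case by (simp add: powr_def)
  qed
qed

text \<open>The dual vectors turn the pooled rows into a matrix dominated by its diagonal, the visit
  counts. Hence the rows are independent, and the coefficients of \<open>\<phi> (y t)\<close> are of
  the order of its size divided by the linearly growing counts.\<close>

lemma pooled_eventually_ok: "\<forall>\<^sub>F t in sequentially. pooled_ok t y"
proof -
  obtain c where c: "0 < c" "\<forall>\<^sub>F t in sequentially. \<forall>r<n. c * real t \<le> real (card {i. i < t \<and> y i \<in> B r})"
    by (rule visits_linear) blast
  define \<Gamma> where "\<Gamma> = (\<Sum>q<n. \<Sum>j<n. \<bar>g q j\<bar>)"
  have \<Gamma>: "0 \<le> \<Gamma>" by (simp add: \<Gamma>_def sum_nonneg)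
  define k where "k = 2 * (\<Gamma> * L) / c"
  have "\<forall>\<^sub>F t in sequentially. k * (real t + 1) powr (1 / 16) / real t \<le> (real t + 1) powr (- 3 / 4)"
    by real_asymp
  moreover note c(2) output_power_small eventually_ge_at_top[of "1 :: nat"]
  ultimately show ?thesis
  proof eventually_elim
    case (elim t)
    define N where "N = (\<lambda>r. real (card {i. i < t \<and> y i \<in> B r}))"
    define G where "G = (\<lambda>q r. \<Sum>j<n. g q j * pooled_row t y r j)"
    have N: "c * real t \<le> N r" "0 < N r" if "r < n" for r
    proof -
      show 1: "c * real t \<le> N r" using elim(2) that by (simp add: N_def)
      have "0 < c * real t" using c(1) elim(4) by simp
      thus "0 < N r" using 1 by linarith
    qed
    have G: "\<bar>G q r - (if q = r then N r else 0)\<bar> \<le> N r / (2 * real n)" if q: "q < n" and r: "r < n" for q r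
    proof -
      have "G q r = (\<Sum>i<t. \<Sum>j<n. g q j * (if y i \<in> B r then \<phi> (y i) j else 0))"
        unfolding G_def pooled_row_def sum_distrib_left by (rule sum.swap)
      also have "\<dots> = (\<Sum>i<t. if y i \<in> B r then (\<Sum>j<n. g q j * \<phi> (y i) j) else 0)"
        by (intro sum.cong) auto
      also have "\<dots> = (\<Sum>i\<in>{i. i < t \<and> y i \<in> B r}. \<Sum>j<n. g q j * \<phi> (y i) j)"
        by (subst sum.inter_filter[symmetric]) (auto intro!: sum.cong)
      finally have "G q r - (if q = r then N r else 0)
          = (\<Sum>i\<in>{i. i < t \<and> y i \<in> B r}. (\<Sum>j<n. g q j * \<phi> (y i) j) - (if q = r then 1 else 0))"
        by (simp add: sum_subtractf N_def)
      also have "\<bar>\<dots>\<bar> \<le> (\<Sum>i\<in>{i. i < t \<and> y i \<in> B r}. 1 / (2 * real n))"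
        by (rule sum_abs[THEN order_trans], rule sum_mono) (use B[OF r q] in auto)
      finally show ?thesis by (simp add: N_def)
    qed
    \<comment> \<open>Pairing a linear relation among the pooled rows with \<open>g q\<close> gives
      the equation of index \<open>q\<close> for the matrix \<open>G\<close>.\<close>
    have GH: "\<bar>\<Sum>r<n. d r * G q r\<bar> \<le> H"
      if "\<And>j. j < n \<Longrightarrow> (\<Sum>r<n. d r * pooled_row t y r j) = p j" "\<bar>\<Sum>j<n. g q j * p j\<bar> \<le> H" for d q p H
    proof -
      have "(\<Sum>r<n. d r * G q r) = (\<Sum>j<n. g q j * (\<Sum>r<n. d r * pooled_row t y r j))"
        unfolding G_def sum_distrib_left by (subst sum.swap) (simp add: mult_ac)
      thus ?thesis using that by simp
    qed
    have nz: "rdet n (pooled_row t y) \<noteq> 0"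
    proof
      assume "rdet n (pooled_row t y) = 0"
      then obtain d where d: "\<exists>r<n. d r \<noteq> 0" "\<And>j. j < n \<Longrightarrow> (\<Sum>r<n. d r * pooled_row t y r j) = 0"
        by (rule rdet_zero_dependent) blast
      \<comment> \<open>With right side 0 the same dominance bound excludes a nontrivial
        relation.\<close>
      have "\<bar>d r\<bar> * N r \<le> 2 * 0" if "r < n" for r
        by (rule diagonally_dominant_bound[of n G N d 0 r, OF G _ GH[OF d(2)] that])
          (use N(2) in \<open>auto simp: less_imp_le\<close>)
      moreover obtain r where "r < n" "d r \<noteq> 0" using d(1) by blast
      ultimately have "\<bar>d r\<bar> * N r \<le> 0" "0 < \<bar>d r\<bar> * N r" using N(2)[of r] by auto
      thus False by simp
    qed
    have "\<bar>pooled_coeff t y r\<bar> \<le> real (t + 1) powr (- 3 / 4)" if r: "r < n" for r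
    proof -
      define H where "H = \<Gamma> * (L * exp (b 0 * log_output t))"
      have h: "\<bar>\<Sum>j<n. g q j * \<phi> (y t) j\<bar> \<le> H" if q: "q < n" for q
      proof -
        have "\<bar>\<Sum>j<n. g q j * \<phi> (y t) j\<bar> \<le> (\<Sum>j<n. \<bar>g q j\<bar> * (L * exp (b 0 * log_output t)))"
        proof (rule sum_abs[THEN order_trans], rule sum_mono)
          fix j assume "j \<in> {..<n}"
          hence j: "j < n" by simp
          have "\<bar>\<phi> (y t) j\<bar> \<le> L * exp (b j * log_output t)" using growth[OF j, of "y t"] by (simp add: log_output_def)
          also have "\<dots> \<le> L * exp (b 0 * log_output t)"
            using b_le_b0[OF j] log_output_nonneg L by (auto intro!: mult_right_mono)
          finally show "\<bar>g q j * \<phi> (y t) j\<bar> \<le> \<bar>g q j\<bar> * (L * exp (b 0 * log_output t))"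
            unfolding abs_mult by (rule mult_left_mono) simp
        qed
        also have "\<dots> = (\<Sum>j<n. \<bar>g q j\<bar>) * (L * exp (b 0 * log_output t))" by (simp add: sum_distrib_right)
        also have "\<dots> \<le> H" unfolding H_def \<Gamma>_def
          using L q by (intro mult_right_mono member_le_sum[of q "{..<n}" "\<lambda>q. \<Sum>j<n. \<bar>g q j\<bar>"]) (auto intro: sum_nonneg)
        finally show ?thesis .
      qed
      have "\<bar>pooled_coeff t y r\<bar> * N r \<le> 2 * H"
      proof (rule diagonally_dominant_bound[of n G N _ H r, OF G _ _ r])
        show "\<bar>\<Sum>r<n. pooled_coeff t y r * G q r\<bar> \<le> H" if "q < n" for q
          by (rule GH[OF _ h[OF that]]) (use cramer_expansion[OF nz] in \<open>simp add: pooled_coeff_def\<close>)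
      qed (use N(2) in \<open>auto simp: less_imp_le\<close>)
      moreover have "\<bar>pooled_coeff t y r\<bar> * (c * real t) \<le> \<bar>pooled_coeff t y r\<bar> * N r"
        using N(1)[OF r] by (intro mult_left_mono) auto
      ultimately have "\<bar>pooled_coeff t y r\<bar> * (c * real t) \<le> 2 * H" by linarith
      hence "\<bar>pooled_coeff t y r\<bar> \<le> 2 * H / (c * real t)"
        using c(1) elim(4) by (subst pos_le_divide_eq) auto
      also have "\<dots> = k * exp (b 0 * log_output t) / real t" by (simp add: H_def k_def)
      also have "\<dots> \<le> k * real (t + 1) powr (1 / 16) / real t"
        using elim(3) \<Gamma> L c(1) by (intro divide_right_mono mult_left_mono) (auto simp: k_def)
      also have "\<dots> \<le> real (t + 1) powr (- 3 / 4)" using elim(1) by (simp add: add.commute)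
      finally show ?thesis .
    qed
    thus ?case using nz by (simp add: pooled_ok_def)
  qed
qed

lemma stable: "\<exists>C. \<forall>T\<ge>1. (\<Sum>i=1..T. (y i)\<^sup>2) \<le> C * real T"
proof -
  obtain A where A: "1 \<le> A" "\<And>t. pooled_ok t y \<Longrightarrow> \<bar>drift t\<bar> \<le> A" by (rule drift_pooled_bounded) blast
  obtain C2 where C2: "\<And>T. (\<Sum>t<T. (w (Suc t))\<^sup>2) \<le> C2 * real (T + 1)" using noise_sq by blast
  have C2_nonneg: "0 \<le> C2" using C2[of 0] by simp
  obtain t0 where t0: "\<And>t. t0 \<le> t \<Longrightarrow> pooled_ok t y"
    using pooled_eventually_ok by (auto simp: eventually_sequentially)
  \<comment> \<open>Finitely many times precede the permanent use of the pooled predictor; their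
    drifts go into the constant.\<close>
  define D where "D = A + (\<Sum>t<t0. \<bar>drift t\<bar>)"
  have D: "\<bar>drift t\<bar> \<le> D" for t
  proof (cases "t < t0")
    case True
    thus ?thesis using A(1) member_le_sum[of t "{..<t0}" "\<lambda>t. \<bar>drift t\<bar>"] by (simp add: D_def)
  next
    case False
    thus ?thesis using A(2)[OF t0[of t]] sum_nonneg[of "{..<t0}" "\<lambda>t. \<bar>drift t\<bar>", OF abs_ge_zero] False
      unfolding D_def by linarith
  qed
  show ?thesis
  proof (intro exI[of _ "2 * D\<^sup>2 + 4 * C2"] allI impI)
    fix T :: nat assume T: "1 \<le> T"
    have "(\<Sum>i=1..T. (y i)\<^sup>2) = (\<Sum>t<T. (y (Suc t))\<^sup>2)"
      by (rule sum.reindex_bij_witness[of _ Suc "\<lambda>i. i - 1"]) auto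
    also have "\<dots> \<le> (\<Sum>t<T. 2 * D\<^sup>2 + 2 * (w (Suc t))\<^sup>2)"
    proof (rule sum_mono)
      fix t
      have "y (Suc t) = drift t + w (Suc t)" by (simp add: drift_def)
      hence "(y (Suc t))\<^sup>2 \<le> 2 * (drift t)\<^sup>2 + 2 * (w (Suc t))\<^sup>2"
        using sum_squares_bound[of "drift t" "w (Suc t)"] by (simp add: power2_sum)
      moreover have "(drift t)\<^sup>2 \<le> D\<^sup>2" using D[of t] abs_le_square_iff[of "drift t" D] by simp
      ultimately show "(y (Suc t))\<^sup>2 \<le> 2 * D\<^sup>2 + 2 * (w (Suc t))\<^sup>2" by simp
    qed
    also have "\<dots> = real T * (2 * D\<^sup>2) + 2 * (\<Sum>t<T. (w (Suc t))\<^sup>2)" by (simp add: sum.distrib sum_distrib_left)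
    also have "(\<Sum>t<T. (w (Suc t))\<^sup>2) \<le> C2 * (2 * real T)"
    proof -
      have "C2 * real (T + 1) \<le> C2 * (2 * real T)" using C2_nonneg T by (intro mult_left_mono) auto
      thus ?thesis using C2[of T] by simp
    qed
    finally show "(\<Sum>i=1..T. (y i)\<^sup>2) \<le> (2 * D\<^sup>2 + 4 * C2) * real T" by (simp add: algebra_simps)
  qed
qed

end

section \<open>Gaussian noise\<close>

text \<open>Weights \<open>1 / (T + 1)^2\<close> give the sum of all \<open>exp (A T)\<close> a
  finite expectation. Almost surely each weighted term is then bounded by the finite sum, at the
  price of \<open>2 * ln (T + 1)\<close>. The \<open>A T\<close> may be unrelated, which later
  allows parameters depending on \<open>T\<close>.\<close>

lemma AE_log_bound_of_exp_moment:
  fixes A :: "nat \<Rightarrow> 'a \<Rightarrow> real"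
  assumes meas: "\<And>T. A T \<in> borel_measurable M"
    and le1: "\<And>T. (\<integral>\<^sup>+\<omega>. ennreal (exp (A T \<omega>)) \<partial>M) \<le> 1"
  shows "AE \<omega> in M. \<exists>C. \<forall>T. A T \<omega> \<le> C + 2 * ln (real (T + 1))"
proof -
  define c where "c = (\<lambda>T :: nat. inverse (real (Suc T) ^ 2))"
  have c: "0 < c T" for T by (simp add: c_def)
  have "summable c"
    unfolding c_def using inverse_power_summable[of 2, where ?'a = real] by (subst summable_Suc_iff) auto
  hence c_fin: "(\<Sum>T. ennreal (c T)) < \<infinity>"
    using c by (subst suminf_ennreal2) (auto simp: less_imp_le)
  note meas[measurable]
  have "(\<integral>\<^sup>+\<omega>. (\<Sum>T. ennreal (c T) * ennreal (exp (A T \<omega>))) \<partial>M)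
      = (\<Sum>T. ennreal (c T) * (\<integral>\<^sup>+\<omega>. ennreal (exp (A T \<omega>)) \<partial>M))"
    by (subst nn_integral_suminf) (auto simp: nn_integral_cmult)
  also have "\<dots> \<le> (\<Sum>T. ennreal (c T) * 1)"
    by (intro suminf_le mult_left_mono le1) auto
  also have "\<dots> < \<infinity>" using c_fin by simp
  finally have "AE \<omega> in M. (\<Sum>T. ennreal (c T) * ennreal (exp (A T \<omega>))) \<noteq> \<infinity>"
    by (intro nn_integral_noteq_infinite) auto
  thus ?thesis
  proof eventually_elim
    case (elim \<omega>)
    define S where "S = (\<Sum>T. ennreal (c T) * ennreal (exp (A T \<omega>)))"
    have fin: "S < \<infinity>" using elim by (simp add: S_def top.not_eq_extremum)
    define s where "s = enn2real S + 1"
    have s: "0 < s" by (simp add: s_def add_nonneg_pos)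
    show ?case
    proof (intro exI[of _ "ln s"] allI)
      fix T
      have "ennreal (c T) * ennreal (exp (A T \<omega>)) \<le> S"
        unfolding S_def using sum_le_suminf[of "\<lambda>T. ennreal (c T) * ennreal (exp (A T \<omega>))" "{T}"] by auto
      hence "ennreal (c T * exp (A T \<omega>)) \<le> ennreal (enn2real S)"
        using fin c[of T] by (simp add: ennreal_mult less_imp_le)
      hence "c T * exp (A T \<omega>) \<le> enn2real S" by (subst (asm) ennreal_le_iff) auto
      hence "c T * exp (A T \<omega>) \<le> s" by (simp add: s_def)
      hence "exp (A T \<omega>) \<le> s * real (Suc T) ^ 2" by (simp add: c_def field_simps)
      hence "A T \<omega> \<le> ln (s * real (Suc T) ^ 2)" using s by (subst ln_ge_iff) auto
      also have "\<dots> = ln s + 2 * ln (real (T + 1))" using s by (subst ln_mult) (auto simp: ln_realpow)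
      finally show "A T \<omega> \<le> ln s + 2 * ln (real (T + 1))" .
    qed
  qed
qed

section \<open>Exponential moments and hitting probabilities of the normal law\<close>

abbreviation normal_law :: "real \<Rightarrow> real measure" where
  "normal_law \<sigma> \<equiv> density lborel (\<lambda>x. ennreal (normal_density 0 \<sigma> x))"

lemma nn_integral_normal_density: "0 < \<sigma> \<Longrightarrow> (\<integral>\<^sup>+x. ennreal (normal_density \<mu> \<sigma> x) \<partial>lborel) = 1"
  by (simp add: nn_integral_eq_integral normal_density_nonneg)

text \<open>Completing the square: the exponential factor shifts the density to the mean
  \<open>l * \<sigma>\<^sup>2\<close>.\<close>

lemma normal_law_exp_moment:
  assumes "0 < \<sigma>"
  shows "(\<integral>\<^sup>+x. ennreal (exp (l * x - l\<^sup>2 * \<sigma>\<^sup>2 / 2)) \<partial>normal_law \<sigma>) = 1"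
proof -
  have "normal_density 0 \<sigma> x * exp (l * x - l\<^sup>2 * \<sigma>\<^sup>2 / 2) = normal_density (l * \<sigma>\<^sup>2) \<sigma> x" for x
  proof -
    have "- x\<^sup>2 / (2 * \<sigma>\<^sup>2) + (l * x - l\<^sup>2 * \<sigma>\<^sup>2 / 2) = - (x - l * \<sigma>\<^sup>2)\<^sup>2 / (2 * \<sigma>\<^sup>2)"
      using assms by (simp add: field_simps power2_eq_square)
    thus ?thesis unfolding normal_density_def by (simp add: exp_add[symmetric] del: exp_add)
  qed
  hence "(\<integral>\<^sup>+x. ennreal (exp (l * x - l\<^sup>2 * \<sigma>\<^sup>2 / 2)) \<partial>normal_law \<sigma>)
      = (\<integral>\<^sup>+x. ennreal (normal_density (l * \<sigma>\<^sup>2) \<sigma> x) \<partial>lborel)"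
    by (subst nn_integral_density) (auto simp: ennreal_mult[symmetric] normal_density_nonneg)
  thus ?thesis using nn_integral_normal_density[OF assms] by simp
qed

text \<open>The factor halves the exponent of the density, which doubles the variance;
  \<open>exp (ln 2 / 2) = sqrt 2\<close> corrects the normalisation.\<close>

lemma normal_law_exp_square_moment:
  assumes "0 < \<sigma>"
  shows "(\<integral>\<^sup>+x. ennreal (exp (x\<^sup>2 / (4 * \<sigma>\<^sup>2) - ln 2 / 2)) \<partial>normal_law \<sigma>) = 1"
proof -
  have "normal_density 0 \<sigma> x * exp (x\<^sup>2 / (4 * \<sigma>\<^sup>2) - ln 2 / 2) = normal_density 0 (sqrt 2 * \<sigma>) x" for x
  proof -
    have e: "exp (ln 2 / 2 :: real) = sqrt 2"
      by (rule power2_eq_imp_eq) (auto simp: exp_double[symmetric])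
    have 1: "exp (- x\<^sup>2 / (2 * \<sigma>\<^sup>2)) * exp (x\<^sup>2 / (4 * \<sigma>\<^sup>2)) = exp (- x\<^sup>2 / (2 * (sqrt 2 * \<sigma>)\<^sup>2))"
      using assms by (subst exp_add[symmetric]) (simp add: field_simps power_mult_distrib)
    have 2: "sqrt (2 * pi * (sqrt 2 * \<sigma>)\<^sup>2) = sqrt 2 * sqrt (2 * pi * \<sigma>\<^sup>2)"
      by (simp add: power_mult_distrib real_sqrt_mult)
    have "normal_density 0 \<sigma> x * exp (x\<^sup>2 / (4 * \<sigma>\<^sup>2) - ln 2 / 2)
        = 1 / (sqrt 2 * sqrt (2 * pi * \<sigma>\<^sup>2)) * (exp (- x\<^sup>2 / (2 * \<sigma>\<^sup>2)) * exp (x\<^sup>2 / (4 * \<sigma>\<^sup>2)))"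
      unfolding normal_density_def exp_diff e by simp
    also have "\<dots> = normal_density 0 (sqrt 2 * \<sigma>) x"
      unfolding 1 normal_density_def 2 by simp
    finally show ?thesis .
  qed
  hence "(\<integral>\<^sup>+x. ennreal (exp (x\<^sup>2 / (4 * \<sigma>\<^sup>2) - ln 2 / 2)) \<partial>normal_law \<sigma>)
      = (\<integral>\<^sup>+x. ennreal (normal_density 0 (sqrt 2 * \<sigma>) x) \<partial>lborel)"
    by (subst nn_integral_density) (auto simp: ennreal_mult[symmetric] normal_density_nonneg)
  thus ?thesis using nn_integral_normal_density[of "sqrt 2 * \<sigma>"] assms by simp
qed

lemma normal_law_interval_lower_bound:
  assumes "0 < \<sigma>" "\<alpha> < \<beta>"
  obtains p where "0 < p" "p < 1" "\<And>m. \<bar>m\<bar> \<le> l \<Longrightarrow> ennreal p \<le> emeasure (normal_law \<sigma>) {x. m + x \<in> {\<alpha><..<\<beta>}}"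
proof -
  \<comment> \<open>Bounds \<open>|x|\<close> whenever \<open>m + x\<close> lies in the interval and
    \<open>|m| \<le> l\<close>, so the density at \<open>R\<close> is a lower bound uniform in
    \<open>m\<close>.\<close>
  define R where "R = \<bar>\<alpha>\<bar> + \<bar>\<beta>\<bar> + \<bar>l\<bar>"
  define d where "d = normal_density 0 \<sigma> R"
  have d: "0 < d" using assms(1) by (simp add: d_def normal_density_pos)
  \<comment> \<open>The minimum with \<open>1 / 2\<close> ensures \<open>p < 1\<close>, from which
    \<open>AE_visits\<close> gets the positivity of its \<open>q\<close>.\<close>
  define p where "p = min (1 / 2) (d * (\<beta> - \<alpha>))"
  show ?thesis
  proof (rule that[of p])
    show "0 < p" using d assms(2) by (simp add: p_def)
    show "p < 1" by (simp add: p_def)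
    fix m assume m: "\<bar>m\<bar> \<le> l"
    have "ennreal p \<le> ennreal (d * (\<beta> - \<alpha>))" by (intro ennreal_leI) (simp add: p_def)
    also have "\<dots> = ennreal d * emeasure lborel {\<alpha> - m<..<\<beta> - m}"
      using d assms(2) by (simp add: ennreal_mult)
    also have "\<dots> = (\<integral>\<^sup>+x. ennreal d * indicator {\<alpha> - m<..<\<beta> - m} x \<partial>lborel)"
      by (subst nn_integral_cmult_indicator) auto
    also have "\<dots> \<le> (\<integral>\<^sup>+x. ennreal (normal_density 0 \<sigma> x) * indicator {x. m + x \<in> {\<alpha><..<\<beta>}} x \<partial>lborel)"
    proof (rule nn_integral_mono)
      fix x :: real
      show "ennreal d * indicator {\<alpha> - m<..<\<beta> - m} x
          \<le> ennreal (normal_density 0 \<sigma> x) * indicator {x. m + x \<in> {\<alpha><..<\<beta>}} x"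
      proof (cases "x \<in> {\<alpha> - m<..<\<beta> - m}")
        case True
        hence "\<bar>x\<bar> \<le> R" using m unfolding R_def by auto
        hence "x\<^sup>2 \<le> R\<^sup>2" using abs_le_square_iff[of x R] by (simp add: R_def)
        hence "d \<le> normal_density 0 \<sigma> x"
          unfolding d_def normal_density_def using assms(1)
          by (intro mult_left_mono) (auto intro!: divide_right_mono)
        thus ?thesis using True by (auto simp: indicator_def intro!: ennreal_leI)
      qed simp
    qed
    also have "\<dots> = emeasure (normal_law \<sigma>) {x. m + x \<in> {\<alpha><..<\<beta>}}"
      by (subst emeasure_density) auto
    finally show "ennreal p \<le> emeasure (normal_law \<sigma>) {x. m + x \<in> {\<alpha><..<\<beta>}}" .
  qed
qed

section \<open>Exponential supermartingales of the noise\<close>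

locale gaussian_noise = prob_space M for M :: "'a measure" +
  fixes \<sigma> :: real and w :: "nat \<Rightarrow> 'a \<Rightarrow> real"
  assumes sigma_pos: "0 < \<sigma>"
    and indep: "indep_vars (\<lambda>_. borel) w {1..}"
    and law: "\<And>t. 1 \<le> t \<Longrightarrow> distr M borel (w t) = normal_law \<sigma>"
begin

abbreviation hist_space :: "nat \<Rightarrow> (nat \<Rightarrow> real) measure" where
  "hist_space t \<equiv> PiM {Suc 0..t} (\<lambda>_. borel)"

definition hist :: "nat \<Rightarrow> 'a \<Rightarrow> nat \<Rightarrow> real" where
  "hist t \<omega> = (\<lambda>i\<in>{Suc 0..t}. w i \<omega>)"

lemma w_measurable: "1 \<le> t \<Longrightarrow> w t \<in> borel_measurable M"
  using indep by (auto simp: indep_vars_def)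

lemma hist_measurable[measurable]: "hist t \<in> measurable M (hist_space t)"
  unfolding hist_def by (intro measurable_restrict w_measurable) auto

text \<open>The index blocks up to \<open>t\<close> and \<open>{Suc t}\<close> are independent; the
  second block, a product with one factor, is then replaced by its only coordinate.\<close>

lemma distr_hist_next:
  "distr M (hist_space t \<Otimes>\<^sub>M borel) (\<lambda>\<omega>. (hist t \<omega>, w (Suc t) \<omega>)) = distr M (hist_space t) (hist t) \<Otimes>\<^sub>M normal_law \<sigma>"
proof -
  have "indep_var (hist_space t) (hist t) (PiM {Suc t} (\<lambda>_. borel)) (\<lambda>\<omega>. \<lambda>i\<in>{Suc t}. w i \<omega>)"
    unfolding hist_def by (rule indep_var_restrict[OF indep]) auto
  hence joint: "distr M (hist_space t \<Otimes>\<^sub>M PiM {Suc t} (\<lambda>_. borel)) (\<lambda>\<omega>. (hist t \<omega>, \<lambda>i\<in>{Suc t}. w i \<omega>))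
      = distr M (hist_space t) (hist t) \<Otimes>\<^sub>M distr M (PiM {Suc t} (\<lambda>_. borel)) (\<lambda>\<omega>. \<lambda>i\<in>{Suc t}. w i \<omega>)"
    by (simp add: indep_var_distribution_eq)
  have [measurable]: "(\<lambda>\<omega>. \<lambda>i\<in>{Suc t}. w i \<omega>) \<in> measurable M (PiM {Suc t} (\<lambda>_. borel))"
    by (intro measurable_restrict w_measurable) auto
  have [measurable]: "(\<lambda>f. f (Suc t)) \<in> measurable (PiM {Suc t} (\<lambda>_. borel)) (borel :: real measure)"
    by (rule measurable_component_singleton) simp
  have comp: "distr (distr M (PiM {Suc t} (\<lambda>_. borel)) (\<lambda>\<omega>. \<lambda>i\<in>{Suc t}. w i \<omega>)) borel (\<lambda>f. f (Suc t)) = normal_law \<sigma>"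
    using law[of "Suc t"] by (subst distr_distr) (auto simp: comp_def)
  interpret D: prob_space "distr (distr M (PiM {Suc t} (\<lambda>_. borel)) (\<lambda>\<omega>. \<lambda>i\<in>{Suc t}. w i \<omega>)) borel (\<lambda>f. f (Suc t))"
    unfolding comp by (rule prob_space_normal_density[OF sigma_pos])
  have "distr M (hist_space t) (hist t) \<Otimes>\<^sub>M normal_law \<sigma>
      = distr (distr M (hist_space t) (hist t)) (hist_space t) (\<lambda>h. h)
        \<Otimes>\<^sub>M distr (distr M (PiM {Suc t} (\<lambda>_. borel)) (\<lambda>\<omega>. \<lambda>i\<in>{Suc t}. w i \<omega>)) borel (\<lambda>f. f (Suc t))"
    unfolding comp by (subst distr_distr) (auto simp: comp_def)
  also have "\<dots> = distr (distr M (hist_space t) (hist t) \<Otimes>\<^sub>M distr M (PiM {Suc t} (\<lambda>_. borel)) (\<lambda>\<omega>. \<lambda>i\<in>{Suc t}. w i \<omega>))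
      (hist_space t \<Otimes>\<^sub>M borel) (\<lambda>(h, f). (h, f (Suc t)))"
    by (rule pair_measure_distr) (use D.sigma_finite_measure_axioms in auto)
  also have "\<dots> = distr M (hist_space t \<Otimes>\<^sub>M borel) (\<lambda>\<omega>. (hist t \<omega>, w (Suc t) \<omega>))"
    unfolding joint[symmetric] by (subst distr_distr) (auto simp: comp_def)
  finally show ?thesis ..
qed

text \<open>Integrate the last noise first: for each fixed history its factor has integral at most
  1. The product law of history and next noise thus takes the place of conditional
  expectations.\<close>

lemma exp_supermartingale:
  fixes a :: "nat \<Rightarrow> (nat \<Rightarrow> real) \<Rightarrow> real \<Rightarrow> real"
  assumes meas: "\<And>t. (\<lambda>p. a t (fst p) (snd p)) \<in> borel_measurable (hist_space t \<Otimes>\<^sub>M borel)"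
    and le1: "\<And>t h. h \<in> space (hist_space t) \<Longrightarrow> (\<integral>\<^sup>+x. ennreal (exp (a t h x)) \<partial>normal_law \<sigma>) \<le> 1"
  shows "(\<integral>\<^sup>+\<omega>. ennreal (exp (\<Sum>t<T. a t (hist t \<omega>) (w (Suc t) \<omega>))) \<partial>M) \<le> 1"
    and "(\<lambda>\<omega>. \<Sum>t<T. a t (hist t \<omega>) (w (Suc t) \<omega>)) \<in> borel_measurable M"
proof -
  note meas[measurable]
  interpret N: prob_space "normal_law \<sigma>" by (rule prob_space_normal_density[OF sigma_pos])
  show "(\<lambda>\<omega>. \<Sum>t<T. a t (hist t \<omega>) (w (Suc t) \<omega>)) \<in> borel_measurable M"
  proof (rule borel_measurable_sum)
    fix t
    have [measurable]: "w (Suc t) \<in> borel_measurable M" by (rule w_measurable) simp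
    have "(\<lambda>\<omega>. (hist t \<omega>, w (Suc t) \<omega>)) \<in> measurable M (hist_space t \<Otimes>\<^sub>M borel)" by measurable
    from measurable_compose[OF this meas[of t]]
    show "(\<lambda>\<omega>. a t (hist t \<omega>) (w (Suc t) \<omega>)) \<in> borel_measurable M" by simp
  qed
  show "(\<integral>\<^sup>+\<omega>. ennreal (exp (\<Sum>t<T. a t (hist t \<omega>) (w (Suc t) \<omega>))) \<partial>M) \<le> 1"
  proof (induction T)
    case 0
    show ?case by (simp add: emeasure_space_1)
  next
    case (Suc T)
    have [measurable]: "w (Suc T) \<in> borel_measurable M" by (rule w_measurable) simp
    \<comment> \<open>The earlier terms, rewritten as a function of the history at time
      \<open>T\<close>, so that they are constant in the inner integral.\<close>
    define G where "G = (\<lambda>h. \<Sum>t<T. a t (restrict h {Suc 0..t}) (h (Suc t)))"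
    have [measurable]: "G \<in> borel_measurable (hist_space T)"
      unfolding G_def
    proof (rule borel_measurable_sum)
      fix t assume t: "t \<in> {..<T}"
      have "(\<lambda>h. (restrict h {Suc 0..t}, h (Suc t))) \<in> measurable (hist_space T) (hist_space t \<Otimes>\<^sub>M borel)"
        using t by (intro measurable_Pair measurable_restrict_subset measurable_component_singleton) auto
      from measurable_compose[OF this meas[of t]]
      show "(\<lambda>h. a t (restrict h {Suc 0..t}) (h (Suc t))) \<in> borel_measurable (hist_space T)" by simp
    qed
    have G: "(\<Sum>t<T. a t (hist t \<omega>) (w (Suc t) \<omega>)) = G (hist T \<omega>)" for \<omega>
      unfolding G_def
    proof (rule sum.cong[OF refl])
      fix t assume t: "t \<in> {..<T}"
      have "restrict (hist T \<omega>) {Suc 0..t} = hist t \<omega>" using t by (auto simp: hist_def fun_eq_iff)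
      moreover have "hist T \<omega> (Suc t) = w (Suc t) \<omega>" using t by (simp add: hist_def)
      ultimately show "a t (hist t \<omega>) (w (Suc t) \<omega>) = a t (restrict (hist T \<omega>) {Suc 0..t}) (hist T \<omega> (Suc t))" by simp
    qed
    define F where "F = (\<lambda>p. ennreal (exp (G (fst p))) * ennreal (exp (a T (fst p) (snd p))))"
    have [measurable]: "F \<in> borel_measurable (hist_space T \<Otimes>\<^sub>M borel)" unfolding F_def by measurable
    interpret H: prob_space "distr M (hist_space T) (hist T)" by (rule prob_space_distr) simp
    have "(\<integral>\<^sup>+\<omega>. ennreal (exp (\<Sum>t<Suc T. a t (hist t \<omega>) (w (Suc t) \<omega>))) \<partial>M)
        = (\<integral>\<^sup>+\<omega>. F (hist T \<omega>, w (Suc T) \<omega>) \<partial>M)"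
      by (simp add: F_def G exp_add ennreal_mult)
    also have "\<dots> = (\<integral>\<^sup>+p. F p \<partial>distr M (hist_space T \<Otimes>\<^sub>M borel) (\<lambda>\<omega>. (hist T \<omega>, w (Suc T) \<omega>)))"
      by (subst nn_integral_distr) auto
    also have "\<dots> = (\<integral>\<^sup>+h. \<integral>\<^sup>+x. F (h, x) \<partial>normal_law \<sigma> \<partial>distr M (hist_space T) (hist T))"
      unfolding distr_hist_next by (subst N.nn_integral_fst[symmetric]) auto
    also have "\<dots> \<le> (\<integral>\<^sup>+h. ennreal (exp (G h)) \<partial>distr M (hist_space T) (hist T))"
    proof (rule nn_integral_mono)
      fix h assume "h \<in> space (distr M (hist_space T) (hist T))"
      hence h: "h \<in> space (hist_space T)" by simp
      have [measurable]: "a T h \<in> borel_measurable borel"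
        using measurable_compose[OF measurable_Pair1'[OF h] meas[of T]] by simp
      have "(\<integral>\<^sup>+x. F (h, x) \<partial>normal_law \<sigma>) = ennreal (exp (G h)) * (\<integral>\<^sup>+x. ennreal (exp (a T h x)) \<partial>normal_law \<sigma>)"
        unfolding F_def by (simp add: nn_integral_cmult)
      also have "\<dots> \<le> ennreal (exp (G h)) * 1" by (intro mult_left_mono le1[OF h]) simp
      finally show "(\<integral>\<^sup>+x. F (h, x) \<partial>normal_law \<sigma>) \<le> ennreal (exp (G h))" by simp
    qed
    also have "\<dots> = (\<integral>\<^sup>+\<omega>. ennreal (exp (G (hist T \<omega>))) \<partial>M)"
      by (subst nn_integral_distr) auto
    also have "\<dots> \<le> 1" using Suc.IH by (simp add: G)
    finally show ?case .
  qed
qed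

text \<open>The exponents may change with the horizon \<open>T\<close>: each horizon has its own
  supermartingale, and only the final moments are combined.\<close>

lemma AE_exp_supermartingale:
  fixes a :: "nat \<Rightarrow> nat \<Rightarrow> (nat \<Rightarrow> real) \<Rightarrow> real \<Rightarrow> real"
  assumes "\<And>T t. (\<lambda>p. a T t (fst p) (snd p)) \<in> borel_measurable (hist_space t \<Otimes>\<^sub>M borel)"
    and "\<And>T t h. h \<in> space (hist_space t) \<Longrightarrow> (\<integral>\<^sup>+x. ennreal (exp (a T t h x)) \<partial>normal_law \<sigma>) \<le> 1"
  shows "AE \<omega> in M. \<exists>C. \<forall>T. (\<Sum>t<T. a T t (hist t \<omega>) (w (Suc t) \<omega>)) \<le> C + 2 * ln (real (T + 1))"
  by (rule AE_log_bound_of_exp_moment) (use exp_supermartingale[of "a _"] assms in auto)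

lemma AE_noise_square_sum: "AE \<omega> in M. \<exists>C. \<forall>T. (\<Sum>t<T. (w (Suc t) \<omega>)\<^sup>2) \<le> C * real (T + 1)"
proof -
  have "AE \<omega> in M. \<exists>C. \<forall>T. (\<Sum>t<T. (w (Suc t) \<omega>)\<^sup>2 / (4 * \<sigma>\<^sup>2) - ln 2 / 2) \<le> C + 2 * ln (real (T + 1))"
    by (rule AE_exp_supermartingale[of "\<lambda>T t h x. x\<^sup>2 / (4 * \<sigma>\<^sup>2) - ln 2 / 2"])
      (use normal_law_exp_square_moment[OF sigma_pos] in auto)
  thus ?thesis
  proof eventually_elim
    case (elim \<omega>)
    then obtain C where C: "\<And>T. (\<Sum>t<T. (w (Suc t) \<omega>)\<^sup>2 / (4 * \<sigma>\<^sup>2) - ln 2 / 2) \<le> C + 2 * ln (real (T + 1))" by blast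
    have C0: "0 \<le> C" using C[of 0] by simp
    show ?case
    proof (intro exI[of _ "4 * \<sigma>\<^sup>2 * (C + 2 + ln 2 / 2)"] allI)
      fix T
      have "(\<Sum>t<T. (w (Suc t) \<omega>)\<^sup>2) / (4 * \<sigma>\<^sup>2) - real T * (ln 2 / 2) \<le> C + 2 * ln (real (T + 1))"
        using C[of T] by (simp add: sum_subtractf sum_divide_distrib)
      also have "\<dots> \<le> C * real (T + 1) + 2 * real (T + 1)"
      proof -
        have "ln (real (T + 1)) \<le> real (T + 1)" by (intro ln_bound) auto
        moreover have "C * 1 \<le> C * real (T + 1)" using C0 by (intro mult_left_mono) auto
        ultimately show ?thesis by simp
      qed
      finally have "(\<Sum>t<T. (w (Suc t) \<omega>)\<^sup>2) / (4 * \<sigma>\<^sup>2) \<le> (C + 2) * real (T + 1) + real T * (ln 2 / 2)"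
        by (simp add: distrib_right)
      also have "\<dots> \<le> (C + 2) * real (T + 1) + real (T + 1) * (ln 2 / 2)"
        by (intro add_left_mono mult_right_mono) auto
      also have "\<dots> = (C + 2 + ln 2 / 2) * real (T + 1)" by (simp add: algebra_simps)
      finally show "(\<Sum>t<T. (w (Suc t) \<omega>)\<^sup>2) \<le> 4 * \<sigma>\<^sup>2 * (C + 2 + ln 2 / 2) * real (T + 1)"
        using sigma_pos by (simp add: divide_le_eq mult_ac)
    qed
  qed
qed

lemma AE_noise_growth: "AE \<omega> in M. \<exists>C. \<forall>t. \<bar>w (Suc t) \<omega>\<bar> \<le> C * sqrt (1 + ln (real (t + 1)))"
proof -
  have "AE \<omega> in M. \<exists>C. \<forall>T. (w (Suc T) \<omega>)\<^sup>2 / (4 * \<sigma>\<^sup>2) - ln 2 / 2 \<le> C + 2 * ln (real (T + 1))"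
  proof (rule AE_log_bound_of_exp_moment)
    fix T
    have [measurable]: "w (Suc T) \<in> borel_measurable M" by (rule w_measurable) simp
    show "(\<lambda>\<omega>. (w (Suc T) \<omega>)\<^sup>2 / (4 * \<sigma>\<^sup>2) - ln 2 / 2) \<in> borel_measurable M" by measurable
    have "(\<integral>\<^sup>+\<omega>. ennreal (exp ((w (Suc T) \<omega>)\<^sup>2 / (4 * \<sigma>\<^sup>2) - ln 2 / 2)) \<partial>M)
        = (\<integral>\<^sup>+x. ennreal (exp (x\<^sup>2 / (4 * \<sigma>\<^sup>2) - ln 2 / 2)) \<partial>distr M borel (w (Suc T)))"
      by (subst nn_integral_distr) auto
    thus "(\<integral>\<^sup>+\<omega>. ennreal (exp ((w (Suc T) \<omega>)\<^sup>2 / (4 * \<sigma>\<^sup>2) - ln 2 / 2)) \<partial>M) \<le> 1"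
      using law[of "Suc T"] normal_law_exp_square_moment[OF sigma_pos] by simp
  qed
  thus ?thesis
  proof eventually_elim
    case (elim \<omega>)
    then obtain C where C: "\<And>T. (w (Suc T) \<omega>)\<^sup>2 / (4 * \<sigma>\<^sup>2) - ln 2 / 2 \<le> C + 2 * ln (real (T + 1))" by blast
    define D where "D = 4 * \<sigma>\<^sup>2 * (\<bar>C\<bar> + ln 2 / 2 + 2)"
    show ?case
    proof (intro exI[of _ "sqrt D"] allI)
      fix t
      have l: "0 \<le> ln (real (t + 1))" by simp
      have "(w (Suc t) \<omega>)\<^sup>2 / (4 * \<sigma>\<^sup>2) \<le> (\<bar>C\<bar> + ln 2 / 2) * 1 + 2 * ln (real (t + 1))" using C[of t] by simp
      also have "\<dots> \<le> (\<bar>C\<bar> + ln 2 / 2) * (1 + ln (real (t + 1))) + 2 * (1 + ln (real (t + 1)))"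
        using l by (intro add_mono mult_left_mono) auto
      also have "\<dots> = (\<bar>C\<bar> + ln 2 / 2 + 2) * (1 + ln (real (t + 1)))" by (simp add: distrib_right)
      finally have "(w (Suc t) \<omega>)\<^sup>2 \<le> D * (1 + ln (real (t + 1)))"
        using sigma_pos by (simp add: D_def divide_le_eq mult_ac)
      hence "sqrt ((w (Suc t) \<omega>)\<^sup>2) \<le> sqrt (D * (1 + ln (real (t + 1))))" by (rule real_sqrt_le_mono)
      thus "\<bar>w (Suc t) \<omega>\<bar> \<le> sqrt D * sqrt (1 + ln (real (t + 1)))" by (simp add: real_sqrt_mult)
    qed
  qed
qed

text \<open>With the exponential parameter \<open>1 / sqrt (T + 1)\<close> for horizon
  \<open>T\<close> the compensator stays bounded, so the sum is at most \<open>sqrt (T + 1)\<close>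
  times a constant plus logarithm; this fits under the exponent
  \<open>5 / 8 = 1 / 2 + 1 / 8\<close>.\<close>

lemma AE_selected_noise_sum:
  fixes s :: "nat \<Rightarrow> (nat \<Rightarrow> real) \<Rightarrow> bool"
  assumes s: "\<And>t. Measurable.pred (hist_space t) (s t)"
  shows "AE \<omega> in M. \<exists>C. \<forall>T. \<bar>\<Sum>t<T. if s t (hist t \<omega>) then w (Suc t) \<omega> else 0\<bar> \<le> C * real (T + 1) powr (5 / 8)"
proof -
  note s[measurable]
  \<comment> \<open>\<open>\<epsilon>\<close> is 1 or -1, for the upper and the lower bound.\<close>
  have one: "AE \<omega> in M. \<exists>C. \<forall>T. \<epsilon> * (\<Sum>t<T. if s t (hist t \<omega>) then w (Suc t) \<omega> else 0) \<le> C * real (T + 1) powr (5 / 8)"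
    if \<epsilon>: "\<epsilon>\<^sup>2 = 1" for \<epsilon> :: real
  proof -
    define l where "l = (\<lambda>T. \<epsilon> * real (T + 1) powr (- 1 / 2))"
    define a where "a = (\<lambda>T t h x. (if s t h then l T * x else 0) - (l T)\<^sup>2 * \<sigma>\<^sup>2 / 2)"
    have "AE \<omega> in M. \<exists>C. \<forall>T. (\<Sum>t<T. a T t (hist t \<omega>) (w (Suc t) \<omega>)) \<le> C + 2 * ln (real (T + 1))"
    proof (rule AE_exp_supermartingale)
      show "(\<lambda>p. a T t (fst p) (snd p)) \<in> borel_measurable (hist_space t \<Otimes>\<^sub>M borel)" for T t
        unfolding a_def by measurable
      interpret N: prob_space "normal_law \<sigma>" by (rule prob_space_normal_density[OF sigma_pos])
      show "(\<integral>\<^sup>+x. ennreal (exp (a T t h x)) \<partial>normal_law \<sigma>) \<le> 1" for T t h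
      proof (cases "s t h")
        case True
        thus ?thesis using normal_law_exp_moment[OF sigma_pos, of "l T"] by (simp add: a_def)
      next
        case False
        have "(\<integral>\<^sup>+x. ennreal (exp (a T t h x)) \<partial>normal_law \<sigma>) \<le> (\<integral>\<^sup>+x. 1 \<partial>normal_law \<sigma>)"
          using False by (intro nn_integral_mono) (auto simp: a_def)
        also have "\<dots> = 1" using N.emeasure_space_1 by (simp del: space_density)
        finally show ?thesis .
      qed
    qed
    thus ?thesis
    proof eventually_elim
      case (elim \<omega>)
      then obtain C where C: "\<And>T. (\<Sum>t<T. a T t (hist t \<omega>) (w (Suc t) \<omega>)) \<le> C + 2 * ln (real (T + 1))" by blast
      \<comment> \<open>The 16 comes from
        \<open>2 * ln x \<le> 2 * (8 * x powr (1 / 8))\<close>.\<close>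
      define D where "D = \<bar>C\<bar> + \<sigma>\<^sup>2 / 2 + 16"
      show ?case
      proof (intro exI[of _ D] allI)
        fix T
        define x where "x = real (T + 1)"
        have x: "1 \<le> x" by (simp add: x_def)
        define S where "S = (\<Sum>t<T. if s t (hist t \<omega>) then w (Suc t) \<omega> else 0)"
        have "(\<Sum>t<T. a T t (hist t \<omega>) (w (Suc t) \<omega>)) = l T * S - real T * ((l T)\<^sup>2 * \<sigma>\<^sup>2 / 2)"
          unfolding a_def S_def sum_subtractf sum_distrib_left by (auto intro!: sum.cong)
        moreover have "(l T)\<^sup>2 = 1 / x"
        proof -
          have "(x powr (- 1 / 2))\<^sup>2 = x powr (- 1)"
            unfolding power2_eq_square by (subst powr_add[symmetric]) simp
          thus ?thesis using x \<epsilon> by (simp add: l_def x_def power_mult_distrib power_divide powr_minus_divide)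
        qed
        moreover have "real T * (1 / x * \<sigma>\<^sup>2 / 2) \<le> \<sigma>\<^sup>2 / 2"
        proof -
          have "real T / x * (\<sigma>\<^sup>2 / 2) \<le> 1 * (\<sigma>\<^sup>2 / 2)" by (intro mult_right_mono) (auto simp: x_def)
          thus ?thesis by simp
        qed
        ultimately have "l T * S \<le> \<bar>C\<bar> + \<sigma>\<^sup>2 / 2 + 2 * ln x" using C[of T] by (simp add: x_def)
        also have "\<dots> \<le> (\<bar>C\<bar> + \<sigma>\<^sup>2 / 2) * x powr (1 / 8) + 2 * (8 * x powr (1 / 8))"
        proof -
          have "ln x \<le> x powr (1 / 8) / (1 / 8)" using x by (intro ln_powr_bound) auto
          moreover have "(\<bar>C\<bar> + \<sigma>\<^sup>2 / 2) * 1 \<le> (\<bar>C\<bar> + \<sigma>\<^sup>2 / 2) * x powr (1 / 8)"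
            using x by (intro mult_left_mono ge_one_powr_ge_zero) auto
          ultimately show ?thesis by simp
        qed
        also have "\<dots> = D * x powr (1 / 8)" by (simp add: D_def algebra_simps)
        finally have "x powr (1 / 2) * (l T * S) \<le> x powr (1 / 2) * (D * x powr (1 / 8))"
          by (intro mult_left_mono) auto
        also have "\<dots> = D * (x powr (1 / 2) * x powr (1 / 8))" by simp
        also have "x powr (1 / 2) * x powr (1 / 8) = x powr (5 / 8)" by (subst powr_add[symmetric]) simp
        also have "x powr (1 / 2) * (l T * S) = \<epsilon> * (x powr (1 / 2) * x powr (- 1 / 2)) * S"
          by (simp add: l_def x_def mult_ac)
        also have "x powr (1 / 2) * x powr (- 1 / 2) = 1" using x by (subst powr_add[symmetric]) simp
        finally show "\<epsilon> * (\<Sum>t<T. if s t (hist t \<omega>) then w (Suc t) \<omega> else 0) \<le> D * real (T + 1) powr (5 / 8)"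
          by (simp add: S_def x_def)
      qed
    qed
  qed
  have "(1 :: real)\<^sup>2 = 1" "(- 1 :: real)\<^sup>2 = 1" by simp_all
  from one[OF this(1)] one[OF this(2)] show ?thesis
  proof eventually_elim
    case (elim \<omega>)
    define S where "S = (\<lambda>T. \<Sum>t<T. if s t (hist t \<omega>) then w (Suc t) \<omega> else 0)"
    obtain C C' where C: "\<And>T. 1 * S T \<le> C * real (T + 1) powr (5 / 8)" "\<And>T. - 1 * S T \<le> C' * real (T + 1) powr (5 / 8)"
      using elim unfolding S_def by blast
    have "\<bar>S T\<bar> \<le> max C C' * real (T + 1) powr (5 / 8)" for T
    proof -
      have "C * real (T + 1) powr (5 / 8) \<le> max C C' * real (T + 1) powr (5 / 8)"
        "C' * real (T + 1) powr (5 / 8) \<le> max C C' * real (T + 1) powr (5 / 8)"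
        by (intro mult_right_mono; simp)+
      thus ?thesis using C(1)[of T] C(2)[of T] by linarith
    qed
    thus ?case unfolding S_def by blast
  qed
qed

text \<open>Count \<open>k\<close> for each time with bounded mean and minus 1 for each visit. For a
  small enough \<open>k\<close>, determined by the hitting probability, every factor has exponential
  moment at most 1, so the first count exceeds the second by at most a logarithm.\<close>

lemma AE_visits:
  fixes m :: "nat \<Rightarrow> (nat \<Rightarrow> real) \<Rightarrow> real" and B :: "real set"
  assumes m: "\<And>t. m t \<in> borel_measurable (hist_space t)" and B: "B \<in> sets borel"
    and I: "\<alpha> < \<beta>" "{\<alpha><..<\<beta>} \<subseteq> B"
  shows "AE \<omega> in M. \<exists>c>0. \<exists>C. \<forall>T. c * real (card {t. t < T \<and> \<bar>m t (hist t \<omega>)\<bar> \<le> l}) - C * (1 + ln (real (T + 1)))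
      \<le> real (card {t. t < T \<and> m t (hist t \<omega>) + w (Suc t) \<omega> \<in> B})"
proof -
  note m[measurable] B[measurable]
  interpret N: prob_space "normal_law \<sigma>" by (rule prob_space_normal_density[OF sigma_pos])
  obtain p where p: "0 < p" "p < 1"
    "\<And>m. \<bar>m\<bar> \<le> l \<Longrightarrow> ennreal p \<le> emeasure (normal_law \<sigma>) {x. m + x \<in> {\<alpha><..<\<beta>}}"
    by (rule normal_law_interval_lower_bound[OF sigma_pos I(1)]) blast
  define e where "e = exp (- 1 :: real)"
  have e: "0 < e" "e < 1" by (auto simp: e_def)
  \<comment> \<open>At a time with bounded mean, the expectation of \<open>e\<close> raised to the
    visit indicator is \<open>1 - (1 - e)\<close> times the visit probability, hence at most
    \<open>q\<close>; \<open>k = - ln q\<close> compensates this exactly.\<close>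
  define q where "q = 1 - (1 - e) * p"
  have q: "0 < q" "q < 1"
  proof -
    have "(1 - e) * p < 1 * 1" using e p by (intro mult_strict_mono) auto
    thus "0 < q" by (simp add: q_def)
    show "q < 1" using e p by (simp add: q_def)
  qed
  define k where "k = - ln q"
  have k: "0 < k" using q by (simp add: k_def)
  define a where "a = (\<lambda>(T :: nat) t h x. (if \<bar>m t h\<bar> \<le> l then k else 0) - (if m t h + x \<in> B then 1 else 0 :: real))"
  have "AE \<omega> in M. \<exists>C. \<forall>T. (\<Sum>t<T. a T t (hist t \<omega>) (w (Suc t) \<omega>)) \<le> C + 2 * ln (real (T + 1))"
  proof (rule AE_exp_supermartingale)
    show "(\<lambda>p. a T t (fst p) (snd p)) \<in> borel_measurable (hist_space t \<Otimes>\<^sub>M borel)" for T t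
      unfolding a_def by measurable
    show "(\<integral>\<^sup>+x. ennreal (exp (a T t h x)) \<partial>normal_law \<sigma>) \<le> 1" for T t h
    proof (cases "\<bar>m t h\<bar> \<le> l")
      case False
      have "(\<integral>\<^sup>+x. ennreal (exp (a T t h x)) \<partial>normal_law \<sigma>) \<le> (\<integral>\<^sup>+x. 1 \<partial>normal_law \<sigma>)"
        using False by (intro nn_integral_mono) (auto simp: a_def)
      also have "\<dots> = 1" using N.emeasure_space_1 by (simp del: space_density)
      finally show ?thesis .
    next
      case True
      define Z where "Z = {x. m t h + x \<in> B}"
      have Z[measurable]: "Z \<in> sets borel" unfolding Z_def by measurable
      have "ennreal p \<le> emeasure (normal_law \<sigma>) {x. m t h + x \<in> {\<alpha><..<\<beta>}}" by (rule p(3)[OF True])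
      also have "\<dots> \<le> emeasure (normal_law \<sigma>) Z"
        using I(2) by (intro emeasure_mono) (auto simp: Z_def)
      finally have pZ: "p \<le> measure (normal_law \<sigma>) Z"
        by (simp add: N.emeasure_eq_measure)
      have indZ: "integrable (normal_law \<sigma>) (indicator Z :: real \<Rightarrow> real)"
        by (intro integrable_real_indicator) (auto simp: N.emeasure_eq_measure)
      have "(\<integral>\<^sup>+x. ennreal (exp (a T t h x)) \<partial>normal_law \<sigma>)
          = (\<integral>\<^sup>+x. ennreal (exp k * (1 - (1 - e) * indicator Z x)) \<partial>normal_law \<sigma>)"
        using True by (intro nn_integral_cong arg_cong[of _ _ ennreal])
          (auto simp: a_def Z_def e_def exp_diff exp_minus field_simps)
      also have "\<dots> = ennreal (\<integral>x. exp k * (1 - (1 - e) * indicator Z x) \<partial>normal_law \<sigma>)"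
        using e by (intro nn_integral_eq_integral integrable_mult_right Bochner_Integration.integrable_diff
          N.integrable_const indZ) (auto simp: indicator_def)
      also have "(\<integral>x. exp k * (1 - (1 - e) * indicator Z x) \<partial>normal_law \<sigma>) = exp k * (1 - (1 - e) * measure (normal_law \<sigma>) Z)"
        using N.prob_space by (simp add: N.emeasure_eq_measure)
      also have "ennreal \<dots> \<le> ennreal (exp k * q)"
        using pZ e by (intro ennreal_leI mult_left_mono) (auto simp: q_def)
      also have "exp k * q = 1" using q by (simp add: k_def exp_minus)
      finally show ?thesis by simp
    qed
  qed
  thus ?thesis
  proof eventually_elim
    case (elim \<omega>)
    then obtain C where C: "\<And>T. (\<Sum>t<T. a T t (hist t \<omega>) (w (Suc t) \<omega>)) \<le> C + 2 * ln (real (T + 1))" by blast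
    show ?case
    proof (rule exI[of _ k], intro conjI exI[of _ "\<bar>C\<bar> + 2"] allI k)
      fix T
      have 1: "(\<Sum>t<T. if \<bar>m t (hist t \<omega>)\<bar> \<le> l then k else 0) = k * real (card {t. t < T \<and> \<bar>m t (hist t \<omega>)\<bar> \<le> l})"
        by (subst sum.inter_filter[symmetric]) (auto simp: lessThan_def)
      have 2: "(\<Sum>t<T. if m t (hist t \<omega>) + w (Suc t) \<omega> \<in> B then 1 else 0 :: real)
          = real (card {t. t < T \<and> m t (hist t \<omega>) + w (Suc t) \<omega> \<in> B})"
        by (subst sum.inter_filter[symmetric]) (auto simp: lessThan_def)
      have "0 \<le> \<bar>C\<bar> * ln (real (T + 1))" by simp
      moreover have "(\<bar>C\<bar> + 2) * (1 + ln (real (T + 1)))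
          = \<bar>C\<bar> + 2 + \<bar>C\<bar> * ln (real (T + 1)) + 2 * ln (real (T + 1))"
        by (simp only: distrib_left distrib_right)
      ultimately have "C + 2 * ln (real (T + 1)) \<le> (\<bar>C\<bar> + 2) * (1 + ln (real (T + 1)))"
        by linarith
      thus "k * real (card {t. t < T \<and> \<bar>m t (hist t \<omega>)\<bar> \<le> l}) - (\<bar>C\<bar> + 2) * (1 + ln (real (T + 1)))
          \<le> real (card {t. t < T \<and> m t (hist t \<omega>) + w (Suc t) \<omega> \<in> B})"
        using C[of T] unfolding a_def sum_subtractf 1 2 by linarith
    qed
  qed
qed

end

section \<open>Measurability of the closed loop\<close>

lemma measurable_rdet:
  assumes "\<And>r j. r < n \<Longrightarrow> j < n \<Longrightarrow> (\<lambda>\<omega>. V \<omega> r j) \<in> borel_measurable N"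
  shows "(\<lambda>\<omega>. rdet n (V \<omega>)) \<in> borel_measurable N"
  unfolding rdet_leibniz
proof (intro borel_measurable_sum borel_measurable_times borel_measurable_prod borel_measurable_const)
  fix p i assume "p \<in> {p. p permutes {0..<n}}" "i \<in> {0..<n}"
  thus "(\<lambda>\<omega>. V \<omega> (p i) i) \<in> borel_measurable N"
    using permutes_in_image[of p "{0..<n}" i] by (intro assms) auto
qed

lemma measurable_cramer:
  assumes "\<And>r j. r < n \<Longrightarrow> j < n \<Longrightarrow> (\<lambda>\<omega>. V \<omega> r j) \<in> borel_measurable N"
    and "\<And>j. j < n \<Longrightarrow> (\<lambda>\<omega>. p \<omega> j) \<in> borel_measurable N"
  shows "(\<lambda>\<omega>. cramer n (V \<omega>) (p \<omega>) r) \<in> borel_measurable N"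
  unfolding cramer_def
proof (intro borel_measurable_divide measurable_rdet)
  fix i j assume "i < n" "j < n"
  thus "(\<lambda>\<omega>. ((V \<omega>)(r := p \<omega>)) i j) \<in> borel_measurable N" using assms by (cases "i = r") auto
qed (use assms in auto)

lemma measurable_cheapest:
  assumes "\<And>x. x \<in> set xs \<Longrightarrow> Measurable.pred N (\<lambda>\<omega>. P \<omega> x)"
    and "\<And>x. x \<in> set xs \<Longrightarrow> (\<lambda>\<omega>. c \<omega> x) \<in> borel_measurable N"
    and "\<And>x. x \<in> set xs \<Longrightarrow> (\<lambda>\<omega>. v \<omega> x) \<in> borel_measurable N"
    and "d \<in> borel_measurable N"
  shows "(\<lambda>\<omega>. cheapest (P \<omega>) (c \<omega>) (v \<omega>) (d \<omega>) xs) \<in> borel_measurable N"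
  using assms
proof (induction xs)
  case (Cons x xs)
  have [measurable]: "Measurable.pred N (\<lambda>\<omega>. P \<omega> x)" "(\<lambda>\<omega>. c \<omega> x) \<in> borel_measurable N"
    "(\<lambda>\<omega>. v \<omega> x) \<in> borel_measurable N"
    using Cons.prems by auto
  have [measurable]: "(\<lambda>\<omega>. cheapest (P \<omega>) (c \<omega>) (v \<omega>) (d \<omega>) xs) \<in> borel_measurable N"
    using Cons by auto
  have [measurable]: "fst \<in> borel_measurable (borel :: (real \<times> real) measure)"
    by (rule borel_measurable_continuous_onI) (rule continuous_on_fst[OF continuous_on_id])
  have "(\<lambda>\<omega>. (c \<omega> x, v \<omega> x)) \<in> borel_measurable N" by (rule borel_measurable_Pair) measurable
  thus ?case by simp
qed simp

locale measurable_controller = controller n K \<phi> B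
  for n K :: nat and \<phi> :: "real \<Rightarrow> nat \<Rightarrow> real" and B :: "nat \<Rightarrow> real set" +
  assumes phi_measurable: "j < n \<Longrightarrow> (\<lambda>v. \<phi> v j) \<in> borel_measurable borel"
    and B_measurable: "r < n \<Longrightarrow> B r \<in> sets borel"
begin

lemma measurable_phi: "j < n \<Longrightarrow> x \<in> borel_measurable N \<Longrightarrow> (\<lambda>\<omega>. \<phi> (x \<omega>) j) \<in> borel_measurable N"
  using measurable_compose[OF _ phi_measurable] by blast

lemma measurable_in_B: "r < n \<Longrightarrow> x \<in> borel_measurable N \<Longrightarrow> Measurable.pred N (\<lambda>\<omega>. x \<omega> \<in> B r)"
  using B_measurable by measurable

lemma measurable_control:
  assumes y: "\<And>i. i \<le> t \<Longrightarrow> y i \<in> borel_measurable N" and u: "\<And>i. i < t \<Longrightarrow> u i \<in> borel_measurable N"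
  shows "(\<lambda>\<omega>. control t (\<lambda>i. y i \<omega>) (\<lambda>i. u i \<omega>)) \<in> borel_measurable N"
proof -
  have phi_t: "(\<lambda>\<omega>. \<phi> (y t \<omega>) j) \<in> borel_measurable N" if "j < n" for j
    using measurable_phi[OF that y] by simp
  have row: "(\<lambda>\<omega>. data_row (\<lambda>i. y i \<omega>) (\<tau> ! r) j) \<in> borel_measurable N"
    and val: "(\<lambda>\<omega>. data_val (\<lambda>i. y i \<omega>) (\<lambda>i. u i \<omega>) (\<tau> ! r)) \<in> borel_measurable N"
    if "\<tau> \<in> set (candidates t)" "r < n" "j < n" for \<tau> r j
    using candidate_nth[OF that(1,2)] that(3) y u
    by (auto simp: data_row_def data_val_def intro!: measurable_phi)
  have coeff: "(\<lambda>\<omega>. tuple_coeff t (\<lambda>i. y i \<omega>) \<tau> r) \<in> borel_measurable N" if "\<tau> \<in> set (candidates t)" for \<tau> r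
    unfolding tuple_coeff_def by (rule measurable_cramer) (use row[OF that] phi_t in auto)
  have [measurable]: "snd \<in> borel_measurable (borel :: (real \<times> real) measure)"
    by (rule borel_measurable_continuous_onI) (rule continuous_on_snd[OF continuous_on_id])
  have [measurable]: "(\<lambda>\<omega>. window_prediction t (\<lambda>i. y i \<omega>) (\<lambda>i. u i \<omega>)) \<in> borel_measurable N"
    unfolding window_prediction_def
  proof (intro measurable_compose[OF measurable_cheapest, where g = snd])
    fix \<tau> assume \<tau>: "\<tau> \<in> set (candidates t)"
    have [measurable]: "(\<lambda>\<omega>. rdet n (\<lambda>r. data_row (\<lambda>i. y i \<omega>) (\<tau> ! r))) \<in> borel_measurable N"
      by (rule measurable_rdet) (rule row[OF \<tau>])
    show "Measurable.pred N (\<lambda>\<omega>. rdet n (\<lambda>r. data_row (\<lambda>i. y i \<omega>) (\<tau> ! r)) \<noteq> 0)" by measurable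
    show "(\<lambda>\<omega>. \<Sum>r<n. \<bar>tuple_coeff t (\<lambda>i. y i \<omega>) \<tau> r\<bar>) \<in> borel_measurable N"
      by (intro borel_measurable_sum borel_measurable_abs coeff[OF \<tau>])
    show "(\<lambda>\<omega>. \<Sum>r<n. tuple_coeff t (\<lambda>i. y i \<omega>) \<tau> r * data_val (\<lambda>i. y i \<omega>) (\<lambda>i. u i \<omega>) (\<tau> ! r)) \<in> borel_measurable N"
      using val[OF \<tau>] by (intro borel_measurable_sum borel_measurable_times coeff[OF \<tau>]) auto
  next
    show "(\<lambda>\<omega>. (\<Sum>j<n. \<bar>\<phi> (y t \<omega>) j\<bar>, 0 :: real)) \<in> borel_measurable N"
      using phi_t by (intro borel_measurable_Pair borel_measurable_sum borel_measurable_abs) auto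
  qed measurable
  have prow: "(\<lambda>\<omega>. pooled_row t (\<lambda>i. y i \<omega>) r j) \<in> borel_measurable N" if "r < n" "j < n" for r j
    unfolding pooled_row_def
    by (intro borel_measurable_sum measurable_If measurable_phi predE[OF measurable_in_B] that) (use y in auto)
  have [measurable]: "(\<lambda>\<omega>. pooled_val t (\<lambda>i. y i \<omega>) (\<lambda>i. u i \<omega>) r) \<in> borel_measurable N" if "r < n" for r
    unfolding pooled_val_def
    by (intro borel_measurable_sum measurable_If borel_measurable_diff predE[OF measurable_in_B] that) (use y u in auto)
  have [measurable]: "(\<lambda>\<omega>. pooled_coeff t (\<lambda>i. y i \<omega>) r) \<in> borel_measurable N" for r
    unfolding pooled_coeff_def by (rule measurable_cramer) (use prow phi_t in auto)
  have [measurable]: "(\<lambda>\<omega>. rdet n (pooled_row t (\<lambda>i. y i \<omega>))) \<in> borel_measurable N"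
    by (rule measurable_rdet) (rule prow)
  have [measurable]: "Measurable.pred N (\<lambda>\<omega>. pooled_ok t (\<lambda>i. y i \<omega>))"
    unfolding pooled_ok_def by measurable
  have [measurable]: "(\<lambda>\<omega>. \<Sum>r<n. pooled_coeff t (\<lambda>i. y i \<omega>) r * pooled_val t (\<lambda>i. y i \<omega>) (\<lambda>i. u i \<omega>) r) \<in> borel_measurable N"
    by (intro borel_measurable_sum borel_measurable_times) auto
  show ?thesis unfolding control_def by measurable
qed

lemma measurable_past_controls:
  "(\<And>i. i < t \<Longrightarrow> y i \<in> borel_measurable N) \<Longrightarrow> (\<lambda>\<omega>. past_controls (\<lambda>i. y i \<omega>) t k) \<in> borel_measurable N"
proof (induction t arbitrary: k)
  case (Suc t)
  have "(\<lambda>\<omega>. control t (\<lambda>i. y i \<omega>) (\<lambda>i. past_controls (\<lambda>i. y i \<omega>) t i)) \<in> borel_measurable N"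
    by (rule measurable_control) (use Suc in auto)
  thus ?case using Suc by simp
qed simp

lemma measurable_feedback:
  assumes "\<And>i. i \<le> t \<Longrightarrow> y i \<in> borel_measurable N"
  shows "(\<lambda>\<omega>. feedback t (\<lambda>i. y i \<omega>)) \<in> borel_measurable N"
  using measurable_control[of t y N "\<lambda>i \<omega>. past_controls (\<lambda>i. y i \<omega>) t i"] measurable_past_controls[of t y N] assms
  by (simp add: feedback_def)

text \<open>\<open>path \<theta> y\<^sub>0 w t\<close> is the output history up to time \<open>t\<close>; its values after \<open>t\<close> are junk.\<close>

primrec path :: "(nat \<Rightarrow> real) \<Rightarrow> real \<Rightarrow> (nat \<Rightarrow> real) \<Rightarrow> nat \<Rightarrow> nat \<Rightarrow> real" where
  "path \<theta> y\<^sub>0 w 0 = (\<lambda>_. y\<^sub>0)"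
| "path \<theta> y\<^sub>0 w (Suc t) = (path \<theta> y\<^sub>0 w t)(Suc t :=
     (\<Sum>j<n. \<theta> j * \<phi> (path \<theta> y\<^sub>0 w t t) j) + feedback t (path \<theta> y\<^sub>0 w t) + w (Suc t))"

definition outputs :: "(nat \<Rightarrow> real) \<Rightarrow> real \<Rightarrow> (nat \<Rightarrow> real) \<Rightarrow> nat \<Rightarrow> real" where
  "outputs \<theta> y\<^sub>0 w t = path \<theta> y\<^sub>0 w t t"

lemma path_eq_outputs: "i \<le> t \<Longrightarrow> path \<theta> y\<^sub>0 w t i = outputs \<theta> y\<^sub>0 w i"
  by (induction t) (auto simp: outputs_def le_Suc_eq)

lemma outputs_0[simp]: "outputs \<theta> y\<^sub>0 w 0 = y\<^sub>0"
  by (simp add: outputs_def)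

text \<open>The junk values of \<open>path\<close> after time \<open>t\<close> are invisible to
  \<open>feedback t\<close> by causality.\<close>

lemma outputs_Suc:
  "outputs \<theta> y\<^sub>0 w (Suc t)
    = (\<Sum>j<n. \<theta> j * \<phi> (outputs \<theta> y\<^sub>0 w t) j) + feedback t (outputs \<theta> y\<^sub>0 w) + w (Suc t)"
  using feedback_cong[of t "path \<theta> y\<^sub>0 w t" "outputs \<theta> y\<^sub>0 w"] path_eq_outputs[of _ t \<theta> y\<^sub>0 w]
  by (simp add: outputs_def[of _ _ _ "Suc t"])

lemma closed_loop_outputs: "closed_loop n K \<phi> B \<theta> w (outputs \<theta> y\<^sub>0 w)"
  by unfold_locales (rule outputs_Suc)

lemma outputs_cong:
  assumes "\<And>j. j < n \<Longrightarrow> \<theta> j = \<theta>' j" "\<And>i. 1 \<le> i \<Longrightarrow> i \<le> t \<Longrightarrow> w i = w' i"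
  shows "outputs \<theta> y\<^sub>0 w t = outputs \<theta>' y\<^sub>0 w' t"
proof -
  have "path \<theta> y\<^sub>0 w t = path \<theta>' y\<^sub>0 w' t"
    using assms(2)
  proof (induction t)
    case (Suc t)
    thus ?case using assms(1) by simp
  qed simp
  thus ?thesis by (simp add: outputs_def)
qed

lemma measurable_outputs:
  assumes \<theta>: "\<And>j. j < n \<Longrightarrow> (\<lambda>\<omega>. \<theta> \<omega> j) \<in> borel_measurable N"
    and w: "\<And>i. 1 \<le> i \<Longrightarrow> i \<le> t \<Longrightarrow> (\<lambda>\<omega>. w \<omega> i) \<in> borel_measurable N"
  shows "(\<lambda>\<omega>. outputs (\<theta> \<omega>) y\<^sub>0 (w \<omega>) t) \<in> borel_measurable N"
  using w
proof (induction t rule: less_induct)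
  case (less t)
  show ?case
  proof (cases t)
    case (Suc s)
    have IH: "(\<lambda>\<omega>. outputs (\<theta> \<omega>) y\<^sub>0 (w \<omega>) i) \<in> borel_measurable N" if "i \<le> s" for i
      using less.IH[of i] less.prems Suc that by auto
    have "(\<lambda>\<omega>. \<Sum>j<n. \<theta> \<omega> j * \<phi> (outputs (\<theta> \<omega>) y\<^sub>0 (w \<omega>) s) j) \<in> borel_measurable N"
      by (intro borel_measurable_sum borel_measurable_times measurable_phi IH) (use \<theta> in auto)
    moreover have "(\<lambda>\<omega>. feedback s (outputs (\<theta> \<omega>) y\<^sub>0 (w \<omega>))) \<in> borel_measurable N"
      using measurable_feedback[of s "\<lambda>i \<omega>. outputs (\<theta> \<omega>) y\<^sub>0 (w \<omega>) i" N] IH by simp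
    moreover have "(\<lambda>\<omega>. w \<omega> (Suc s)) \<in> borel_measurable N" using less.prems Suc by auto
    ultimately show ?thesis unfolding Suc outputs_Suc by simp
  qed simp
qed

end

section \<open>Almost sure stability\<close>

locale gaussian_loop = exponents n b + measurable_controller n K \<phi> B + gaussian_noise M \<sigma> w
  for n :: nat and b :: "nat \<Rightarrow> real" and K :: nat and \<phi> :: "real \<Rightarrow> nat \<Rightarrow> real"
    and B :: "nat \<Rightarrow> real set" and M :: "'a measure" and \<sigma> :: real and w :: "nat \<Rightarrow> 'a \<Rightarrow> real" +
  fixes C0 L :: real and g :: "nat \<Rightarrow> nat \<Rightarrow> real"
  assumes window: "contraction_window K C0"
    and L: "1 \<le> L"
    and growth: "\<And>v j. j < n \<Longrightarrow> \<bar>\<phi> v j\<bar> \<le> L * exp (b j * ln (max 1 \<bar>v\<bar>))"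
    and B: "\<And>r q v. r < n \<Longrightarrow> q < n \<Longrightarrow> v \<in> B r \<Longrightarrow>
       \<bar>(\<Sum>j<n. g q j * \<phi> v j) - (if q = r then 1 else 0)\<bar> \<le> 1 / (2 * real n)"
    and B_interval: "\<And>r. r < n \<Longrightarrow> \<exists>\<alpha> \<beta>. \<alpha> < \<beta> \<and> {\<alpha><..<\<beta>} \<subseteq> B r"
begin

text \<open>Here \<open>\<theta>\<close> is a fixed vector. The outputs up to time \<open>t\<close>
  are then functions of the noises up to \<open>t\<close>, so the drift and the selection by
  \<open>B r\<close> are predictable, as the supermartingale estimates need.\<close>

lemma AE_stable:
  "AE \<omega> in M. \<exists>C. \<forall>T\<ge>1. (\<Sum>i=1..T. (outputs \<theta> y\<^sub>0 (\<lambda>i. w i \<omega>) i)\<^sup>2) \<le> C * real T"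
proof -
  define y where "y = (\<lambda>\<omega>. outputs \<theta> y\<^sub>0 (\<lambda>i. w i \<omega>))"
  \<comment> \<open>The drift as a function of the noise history alone.\<close>
  define m where "m = (\<lambda>t h. (\<Sum>j<n. \<theta> j * \<phi> (outputs \<theta> y\<^sub>0 h t) j) + feedback t (outputs \<theta> y\<^sub>0 h))"
  have out_hist: "outputs \<theta> y\<^sub>0 (hist t \<omega>) i = y \<omega> i" if "i \<le> t" for i t \<omega>
    unfolding y_def by (rule outputs_cong) (use that in \<open>auto simp: hist_def\<close>)
  have m_hist: "y \<omega> (Suc t) = m t (hist t \<omega>) + w (Suc t) \<omega>" for t \<omega>
  proof -
    have "feedback t (outputs \<theta> y\<^sub>0 (hist t \<omega>)) = feedback t (y \<omega>)"
      by (rule feedback_cong) (rule out_hist)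
    thus ?thesis using outputs_Suc[of \<theta> y\<^sub>0 "\<lambda>i. w i \<omega>" t] out_hist[of t t \<omega>] by (simp add: m_def y_def)
  qed
  have out_meas: "(\<lambda>h. outputs \<theta> y\<^sub>0 h i) \<in> borel_measurable (hist_space t)" if "i \<le> t" for i t
    by (rule measurable_outputs) (use that in auto)
  have m_meas: "m t \<in> borel_measurable (hist_space t)" for t
    unfolding m_def using measurable_feedback[of t "\<lambda>i h. outputs \<theta> y\<^sub>0 h i" "hist_space t"] out_meas
    by (intro borel_measurable_add borel_measurable_sum borel_measurable_times measurable_phi) auto
  have sums: "AE \<omega> in M. \<forall>r\<in>{..<n}. \<exists>C. \<forall>T. \<bar>\<Sum>t<T. if y \<omega> t \<in> B r then w (Suc t) \<omega> else 0\<bar> \<le> C * real (T + 1) powr (5 / 8)"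
  proof (rule AE_finite_allI[OF finite_lessThan])
    fix r assume r: "r \<in> {..<n}"
    have "AE \<omega> in M. \<exists>C. \<forall>T. \<bar>\<Sum>t<T. if outputs \<theta> y\<^sub>0 (hist t \<omega>) t \<in> B r then w (Suc t) \<omega> else 0\<bar> \<le> C * real (T + 1) powr (5 / 8)"
      by (rule AE_selected_noise_sum) (use r out_meas in \<open>auto intro!: measurable_in_B\<close>)
    thus "AE \<omega> in M. \<exists>C. \<forall>T. \<bar>\<Sum>t<T. if y \<omega> t \<in> B r then w (Suc t) \<omega> else 0\<bar> \<le> C * real (T + 1) powr (5 / 8)"
      by (simp add: out_hist)
  qed
  \<comment> \<open>\<open>l\<close> runs through the naturals and \<open>r\<close> through a finite
    set, so one null set serves all of them.\<close>
  have vis: "AE \<omega> in M. \<forall>l :: nat. \<forall>r\<in>{..<n}. \<exists>c>0. \<exists>C. \<forall>T.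
      c * real (card {t. t < T \<and> \<bar>m t (hist t \<omega>)\<bar> \<le> real l}) - C * (1 + ln (real (T + 1)))
      \<le> real (card {t. t < T \<and> y \<omega> (Suc t) \<in> B r})"
    unfolding AE_all_countable
  proof (intro allI AE_finite_allI[OF finite_lessThan])
    fix l :: nat and r assume r: "r \<in> {..<n}"
    obtain \<alpha> \<beta> where I: "\<alpha> < \<beta>" "{\<alpha><..<\<beta>} \<subseteq> B r" using B_interval r by blast
    show "AE \<omega> in M. \<exists>c>0. \<exists>C. \<forall>T.
      c * real (card {t. t < T \<and> \<bar>m t (hist t \<omega>)\<bar> \<le> real l}) - C * (1 + ln (real (T + 1)))
      \<le> real (card {t. t < T \<and> y \<omega> (Suc t) \<in> B r})"
      unfolding m_hist by (rule AE_visits[OF m_meas B_measurable I]) (use r in auto)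
  qed
  from AE_noise_square_sum AE_noise_growth sums vis show ?thesis
  proof eventually_elim
    case (elim \<omega>)
    interpret CL: closed_loop n K \<phi> B \<theta> "\<lambda>i. w i \<omega>" "y \<omega>"
      unfolding y_def by (rule closed_loop_outputs)
    have drift: "CL.drift t = m t (hist t \<omega>)" for t
      by (simp add: CL.drift_def m_hist)
    interpret stable_path n b K \<phi> B \<theta> "\<lambda>i. w i \<omega>" "y \<omega>" C0 L g
    proof unfold_locales
      show "\<exists>C. \<forall>r<n. \<forall>t. \<bar>CL.noise_sum r t\<bar> \<le> C * real (t + 1) powr (5 / 8)"
      proof -
        obtain C where "\<forall>r\<in>{..<n}. \<forall>T. \<bar>CL.noise_sum r T\<bar> \<le> C r * real (T + 1) powr (5 / 8)"
          using bchoice[OF elim(3)] unfolding CL.noise_sum_def by blast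
        hence C: "\<bar>CL.noise_sum r T\<bar> \<le> C r * real (T + 1) powr (5 / 8)" if "r < n" for r T
          using that by blast
        have "\<bar>CL.noise_sum r T\<bar> \<le> (\<Sum>r<n. \<bar>C r\<bar>) * real (T + 1) powr (5 / 8)" if r: "r < n" for r T
        proof -
          have "C r \<le> (\<Sum>r<n. \<bar>C r\<bar>)" using member_le_sum[of r "{..<n}" "\<lambda>r. \<bar>C r\<bar>"] r by simp
          hence "C r * real (T + 1) powr (5 / 8) \<le> (\<Sum>r<n. \<bar>C r\<bar>) * real (T + 1) powr (5 / 8)"
            by (rule mult_right_mono) simp
          thus ?thesis using C[OF r, of T] by linarith
        qed
        thus ?thesis by blast
      qed
      show "\<exists>c>0. \<exists>C. \<forall>r<n. \<forall>T. c * real (card {t. t < T \<and> \<bar>CL.drift t\<bar> \<le> real l})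
         - C * (1 + ln (real (T + 1))) \<le> real (card {t. t < T \<and> y \<omega> (Suc t) \<in> B r})" for l
      proof -
        have "\<forall>r\<in>{..<n}. \<exists>c>0. \<exists>C. \<forall>T. c * real (card {t. t < T \<and> \<bar>CL.drift t\<bar> \<le> real l})
           - C * (1 + ln (real (T + 1))) \<le> real (card {t. t < T \<and> y \<omega> (Suc t) \<in> B r})"
          unfolding drift using elim(4) by blast
        then obtain c where c: "\<forall>r\<in>{..<n}. 0 < c r \<and> (\<exists>C. \<forall>T. c r * real (card {t. t < T \<and> \<bar>CL.drift t\<bar> \<le> real l})
           - C * (1 + ln (real (T + 1))) \<le> real (card {t. t < T \<and> y \<omega> (Suc t) \<in> B r}))"
          by (rule bchoice[THEN exE])
        hence "\<forall>r\<in>{..<n}. \<exists>C. \<forall>T. c r * real (card {t. t < T \<and> \<bar>CL.drift t\<bar> \<le> real l})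
           - C * (1 + ln (real (T + 1))) \<le> real (card {t. t < T \<and> y \<omega> (Suc t) \<in> B r})" by blast
        then obtain C where C: "\<forall>r\<in>{..<n}. \<forall>T. c r * real (card {t. t < T \<and> \<bar>CL.drift t\<bar> \<le> real l})
           - C r * (1 + ln (real (T + 1))) \<le> real (card {t. t < T \<and> y \<omega> (Suc t) \<in> B r})"
          by (rule bchoice[THEN exE])
        define c' where "c' = Min (c ` {..<n})"
        have ne: "c ` {..<n} \<noteq> {}" using n_pos by (auto simp: lessThan_empty_iff)
        have c': "0 < c'" unfolding c'_def using c ne by (subst Min_gr_iff) auto
        have "c' * real (card {t. t < T \<and> \<bar>CL.drift t\<bar> \<le> real l}) - (\<Sum>r<n. \<bar>C r\<bar>) * (1 + ln (real (T + 1)))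
            \<le> real (card {t. t < T \<and> y \<omega> (Suc t) \<in> B r})" if r: "r < n" for r T
        proof -
          have "c' * real (card {t. t < T \<and> \<bar>CL.drift t\<bar> \<le> real l}) \<le> c r * real (card {t. t < T \<and> \<bar>CL.drift t\<bar> \<le> real l})"
            unfolding c'_def using r by (intro mult_right_mono Min_le) auto
          moreover have "C r * (1 + ln (real (T + 1))) \<le> (\<Sum>r<n. \<bar>C r\<bar>) * (1 + ln (real (T + 1)))"
          proof (rule mult_right_mono)
            show "C r \<le> (\<Sum>r<n. \<bar>C r\<bar>)" using member_le_sum[of r "{..<n}" "\<lambda>r. \<bar>C r\<bar>"] r by simp
          qed simp
          moreover have "c r * real (card {t. t < T \<and> \<bar>CL.drift t\<bar> \<le> real l})
             - C r * (1 + ln (real (T + 1))) \<le> real (card {t. t < T \<and> y \<omega> (Suc t) \<in> B r})" using C r by blast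
          ultimately show ?thesis by linarith
        qed
        thus ?thesis using c' by blast
      qed
      show "\<bar>(\<Sum>j<n. g q j * \<phi> v j) - (if q = r then 1 else 0)\<bar> \<le> 1 / (2 * real n)"
        if "r < n" "q < n" "v \<in> B r" for r q v using B that by blast
      show "\<bar>\<phi> v j\<bar> \<le> L * exp (b j * ln (max 1 \<bar>v\<bar>))" if "j < n" for v j using growth that by blast
      show "\<exists>C. \<forall>t. \<bar>w (Suc t) \<omega>\<bar> \<le> C * sqrt (1 + ln (real (t + 1)))" by (rule elim(2))
      show "\<exists>C. \<forall>T. (\<Sum>t<T. (w (Suc t) \<omega>)\<^sup>2) \<le> C * real (T + 1)" by (rule elim(1))
    qed (fact window L)+
    show ?case using stable unfolding y_def .
  qed
qed

end

section \<open>Visiting sets, and passage to the random parameter\<close>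

lemma dual_matrix:
  assumes "rdet n V \<noteq> 0"
  obtains g where "\<And>q r. q < n \<Longrightarrow> r < n \<Longrightarrow> (\<Sum>j<n. g q j * V r j) = (if q = r then 1 else 0)"
proof -
  define A where "A = Matrix.mat n n (\<lambda>(i, j). V j i)"
  have A: "A \<in> carrier_mat n n" by (simp add: A_def)
  have dA: "det A = rdet n V" by (simp add: A_def rdet_def)
  have aA: "adj_mat A \<in> carrier_mat n n" using adj_mat(1)[OF A] .
  show ?thesis
  proof (rule that[of "\<lambda>q j. adj_mat A $$ (q, j) / det A"])
    fix q r assume qr: "q < n" "r < n"
    have "(\<Sum>j<n. adj_mat A $$ (q, j) * V r j) = (adj_mat A * A) $$ (q, r)"
      using qr aA A by (auto simp: A_def scalar_prod_def lessThan_atLeast0 intro!: sum.cong)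
    also have "\<dots> = (if q = r then det A else 0)" unfolding adj_mat(3)[OF A] using qr by simp
    finally show "(\<Sum>j<n. adj_mat A $$ (q, j) / det A * V r j) = (if q = r then 1 else 0)"
      using assms dA by (simp add: sum_divide_distrib[symmetric])
  qed
qed

text \<open>Exchange argument starting from the unit vectors. The dual functional \<open>g k\<close>
  of the vector to be replaced is nonzero, so by independence it does not vanish on all
  \<open>\<phi> v\<close> with \<open>v\<close> in \<open>E\<close>; a point where it is nonzero
  keeps the tuple nonsingular.\<close>

lemma independent_functions_points:
  fixes \<phi> :: "real \<Rightarrow> nat \<Rightarrow> real"
  assumes indep: "\<And>c. (\<And>v. v \<in> E \<Longrightarrow> (\<Sum>j<n. c j * \<phi> v j) = 0) \<Longrightarrow> (\<And>j. j < n \<Longrightarrow> c j = 0)"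
  obtains x where "\<And>r. r < n \<Longrightarrow> x r \<in> E" "rdet n (\<lambda>r. \<phi> (x r)) \<noteq> 0"
proof -
  have "\<exists>x. (\<forall>r<k. x r \<in> E) \<and> rdet n (\<lambda>r. if r < k then \<phi> (x r) else (\<lambda>j. if j = r then 1 else 0)) \<noteq> 0"
    if "k \<le> n" for k
    using that
  proof (induction k)
    case 0
    show ?case by (simp add: rdet_unit)
  next
    case (Suc k)
    then obtain x where x: "\<forall>r<k. x r \<in> E"
      and nz: "rdet n (\<lambda>r. if r < k then \<phi> (x r) else (\<lambda>j. if j = r then 1 else 0)) \<noteq> 0" by auto
    define V where "V = (\<lambda>r. if r < k then \<phi> (x r) else (\<lambda>j. if j = r then 1 else 0))"
    obtain g where g: "\<And>q r. q < n \<Longrightarrow> r < n \<Longrightarrow> (\<Sum>j<n. g q j * V r j) = (if q = r then 1 else 0)"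
      using dual_matrix[of n V] nz unfolding V_def by blast
    have k: "k < n" using Suc.prems by simp
    obtain v where v: "v \<in> E" "(\<Sum>j<n. g k j * \<phi> v j) \<noteq> 0"
    proof (rule ccontr)
      assume "\<not> thesis"
      hence "\<And>v. v \<in> E \<Longrightarrow> (\<Sum>j<n. g k j * \<phi> v j) = 0" using that by blast
      hence "g k j = 0" if "j < n" for j using indep[of "g k"] that by blast
      thus False using g[OF k k] by simp
    qed
    define W where "W = V(k := \<phi> v)"
    have "rdet n W \<noteq> 0"
    proof
      assume "rdet n W = 0"
      then obtain c where c: "\<exists>r<n. c r \<noteq> 0" "\<And>j. j < n \<Longrightarrow> (\<Sum>r<n. c r * W r j) = 0"
        by (rule rdet_zero_dependent) blast
      have eq: "(\<Sum>r<n. c r * (\<Sum>j<n. g q j * W r j)) = 0" for q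
      proof -
        have "(\<Sum>r<n. c r * (\<Sum>j<n. g q j * W r j)) = (\<Sum>j<n. g q j * (\<Sum>r<n. c r * W r j))"
          unfolding sum_distrib_left by (subst sum.swap) (simp add: mult_ac)
        thus ?thesis using c(2) by simp
      qed
      \<comment> \<open>In the dual coordinates of the old tuple only the vector of index
        \<open>k\<close> has changed: \<open>q = k\<close> forces \<open>c k = 0\<close>, and then
        the other \<open>q\<close> force the remaining coefficients to vanish.\<close>
      have split: "(\<Sum>r<n. c r * (\<Sum>j<n. g q j * W r j))
          = c k * (\<Sum>j<n. g q j * \<phi> v j) + (if q = k then 0 else c q)" if q: "q < n" for q
      proof -
        have "(\<Sum>r<n. c r * (\<Sum>j<n. g q j * W r j))
            = (\<Sum>r<n. (if r = k then c k * (\<Sum>j<n. g q j * \<phi> v j) else 0) + (if r = q then (if q = k then 0 else c q) else 0))"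
          by (intro sum.cong refl) (use g q in \<open>auto simp: W_def\<close>)
        also have "\<dots> = c k * (\<Sum>j<n. g q j * \<phi> v j) + (if q = k then 0 else c q)"
          using k q by (simp add: sum.distrib)
        finally show ?thesis .
      qed
      have ck: "c k = 0" using eq[of k] split[OF k] v(2) by simp
      hence "c q = 0" if "q < n" for q using eq[of q] split[OF that] that by (cases "q = k") auto
      thus False using c(1) by blast
    qed
    moreover have "W = (\<lambda>r. if r < Suc k then \<phi> ((x(k := v)) r) else (\<lambda>j. if j = r then 1 else 0))"
      by (auto simp: W_def V_def fun_eq_iff less_Suc_eq)
    ultimately have "rdet n (\<lambda>r. if r < Suc k then \<phi> ((x(k := v)) r) else (\<lambda>j. if j = r then 1 else 0)) \<noteq> 0" by simp
    moreover have "\<forall>r<Suc k. (x(k := v)) r \<in> E" using x v(1) by (auto simp: less_Suc_eq)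
    ultimately show ?case by blast
  qed
  then obtain x where x: "\<forall>r<n. x r \<in> E"
    "rdet n (\<lambda>r. if r < n then \<phi> (x r) else (\<lambda>j. if j = r then 1 else 0)) \<noteq> 0" by blast
  moreover have "rdet n (\<lambda>r. if r < n then \<phi> (x r) else (\<lambda>j. if j = r then 1 else 0)) = rdet n (\<lambda>r. \<phi> (x r))"
    by (rule rdet_cong) simp
  ultimately show ?thesis using that by metis
qed

lemma interval_near_dual_points:
  fixes \<phi> :: "real \<Rightarrow> nat \<Rightarrow> real"
  assumes cont: "\<And>j. j < n \<Longrightarrow> isCont (\<lambda>v. \<phi> v j) x" and e: "0 < e"
    and d: "\<And>q. q < n \<Longrightarrow> (\<Sum>j<n. g q j * \<phi> x j) = d q"
  shows "\<exists>\<alpha> \<beta>. \<alpha> < \<beta> \<and> {\<alpha><..<\<beta>} \<subseteq> {v. \<forall>q<n. \<bar>(\<Sum>j<n. g q j * \<phi> v j) - d q\<bar> < e}"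
proof -
  have "\<forall>\<^sub>F v in nhds x. \<forall>q\<in>{..<n}. \<bar>(\<Sum>j<n. g q j * \<phi> v j) - d q\<bar> < e"
  proof (rule eventually_ball_finite[OF finite_lessThan], rule ballI)
    fix q assume q: "q \<in> {..<n}"
    have "isCont (\<lambda>v. \<bar>(\<Sum>j<n. g q j * \<phi> v j) - d q\<bar>) x"
      by (intro continuous_intros cont) auto
    hence "((\<lambda>v. \<bar>(\<Sum>j<n. g q j * \<phi> v j) - d q\<bar>) \<longlongrightarrow> \<bar>(\<Sum>j<n. g q j * \<phi> x j) - d q\<bar>) (nhds x)"
      unfolding isCont_def
      by (rule tendsto_at_iff_tendsto_nhds[of "\<lambda>v. \<bar>(\<Sum>j<n. g q j * \<phi> v j) - d q\<bar>" x, THEN iffD1])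
    from order_tendstoD(2)[OF this, of e] show "\<forall>\<^sub>F v in nhds x. \<bar>(\<Sum>j<n. g q j * \<phi> v j) - d q\<bar> < e"
      using q d e by auto
  qed
  then obtain \<delta> where \<delta>: "0 < \<delta>" "\<And>v. dist v x < \<delta> \<Longrightarrow> \<forall>q\<in>{..<n}. \<bar>(\<Sum>j<n. g q j * \<phi> v j) - d q\<bar> < e"
    unfolding eventually_nhds_metric by blast
  show ?thesis
  proof (intro exI conjI)
    show "x - \<delta> < x + \<delta>" using \<delta>(1) by simp
    show "{x - \<delta><..<x + \<delta>} \<subseteq> {v. \<forall>q<n. \<bar>(\<Sum>j<n. g q j * \<phi> v j) - d q\<bar> < e}"
      using \<delta>(2) by (auto simp: dist_real_def abs_less_iff)
  qed
qed

text \<open>Independence makes the joint law a product, so Fubini's theorem combines the null sets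
  belonging to the fixed values of \<open>X\<close> into one.\<close>

lemma AE_of_independent_pair:
  assumes M: "prob_space M" and ind: "prob_space.indep_var M S X T Y"
    and Q: "{p \<in> space (S \<Otimes>\<^sub>M T). Q (fst p) (snd p)} \<in> sets (S \<Otimes>\<^sub>M T)"
    and AE: "\<And>x. x \<in> space S \<Longrightarrow> AE \<omega> in M. Q x (Y \<omega>)"
  shows "AE \<omega> in M. Q (X \<omega>) (Y \<omega>)"
proof -
  interpret prob_space M by fact
  have [measurable]: "X \<in> measurable M S" "Y \<in> measurable M T"
    and joint: "distr M S X \<Otimes>\<^sub>M distr M T Y = distr M (S \<Otimes>\<^sub>M T) (\<lambda>\<omega>. (X \<omega>, Y \<omega>))"
    using ind by (auto simp: indep_var_distribution_eq)
  interpret X: prob_space "distr M S X" by (rule prob_space_distr) simp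
  interpret Y: prob_space "distr M T Y" by (rule prob_space_distr) simp
  interpret XY: pair_sigma_finite "distr M S X" "distr M T Y" ..
  have "AE p in distr M S X \<Otimes>\<^sub>M distr M T Y. Q (fst p) (snd p)"
  proof (rule XY.AE_pair_measure)
    show "{p \<in> space (distr M S X \<Otimes>\<^sub>M distr M T Y). Q (fst p) (snd p)} \<in> sets (distr M S X \<Otimes>\<^sub>M distr M T Y)"
      using Q by (simp add: space_pair_measure cong: sets_pair_measure_cong)
    show "AE x in distr M S X. AE y in distr M T Y. Q (fst (x, y)) (snd (x, y))"
    proof (rule AE_I2)
      fix x assume x: "x \<in> space (distr M S X)"
      have "{y \<in> space T. Q x y} = Pair x -` {p \<in> space (S \<Otimes>\<^sub>M T). Q (fst p) (snd p)}"
        using x by (auto simp: space_pair_measure)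
      hence "{y \<in> space T. Q x y} \<in> sets T" using sets_Pair1[OF Q] by simp
      thus "AE y in distr M T Y. Q (fst (x, y)) (snd (x, y))" using AE[of x] x by (simp add: AE_distr_iff)
    qed
  qed
  thus ?thesis unfolding joint using Q by (subst (asm) AE_distr_iff) auto
qed

theorem theorem2p1:
  fixes M :: "'a measure"
    and n :: nat
    and \<theta> w :: "nat \<Rightarrow> 'a \<Rightarrow> real"
    and \<theta>\<^sub>0 b :: "nat \<Rightarrow> real"
    and f :: "nat \<Rightarrow> real \<Rightarrow> real"
    and E :: "real set"
    and \<sigma> :: real
  assumes "prob_space M"
    and "n \<ge> 2"
    and f_meas: "\<forall>j\<in>{1..n}. f j \<in> borel_measurable borel"
    and "open E"
    and f_smooth: "\<forall>j\<in>{1..n}. C_k_on n (f j) E"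
    and "\<sigma> > 0"
    and A1: "iid_normal_noise M \<sigma> w"
    and A2: "normal_parameter M n \<theta>\<^sub>0 \<theta> w"
    and A3: "lin_indep_on n f E"
    and b_decreasing: "\<forall>i\<in>{1..<n}. b i > b (i + 1)"
    and "b n > 0"
    and "b 1 > 1"
    and P_pos: "\<forall>x\<in>{1<..<b 1}.
      x ^ (n + 1) - b 1 * x ^ n + (\<Sum>i=1..n-1. (b i - b (i + 1)) * x ^ (n - i)) + b n > 0"
    and growth: "\<exists>L\<^sub>1>0. \<exists>L\<^sub>2>0. \<forall>x. \<forall>j\<in>{1..n}. \<bar>f j x\<bar> \<le> L\<^sub>1 + L\<^sub>2 * \<bar>x\<bar> powr b j"
  shows "as_globally_stabilizable M n f \<theta> w"
proof -
  interpret prob_space M by fact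
  \<comment> \<open>Shift to the indices \<open>0, ..., n - 1\<close>, which are also the matrix
    indices.\<close>
  define \<phi> where "\<phi> = (\<lambda>v j. f (Suc j) v)"
  have phi_eq: "f (Suc j) v = \<phi> v j" for j v by (simp add: \<phi>_def)
  interpret X: exponents n "\<lambda>j. b (Suc j)"
  proof
    show "1 \<le> n" using \<open>n \<ge> 2\<close> by simp
    show "b (Suc (Suc i)) < b (Suc i)" if "Suc i < n" for i using b_decreasing that by auto
    show "0 < b (Suc (n - 1))" using \<open>b n > 0\<close> \<open>n \<ge> 2\<close> by simp
    show "1 < b (Suc 0)" using \<open>b 1 > 1\<close> by simp
    show "0 < x ^ (n + 1) - b (Suc 0) * x ^ n + (\<Sum>i=1..n-1. (b (Suc (i - 1)) - b (Suc i)) * x ^ (n - i)) + b (Suc (n - 1))"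
      if "1 < x" "x < b (Suc 0)" for x
    proof -
      have "(\<Sum>i=1..n-1. (b (Suc (i - 1)) - b (Suc i)) * x ^ (n - i)) = (\<Sum>i=1..n-1. (b i - b (i + 1)) * x ^ (n - i))"
        by (rule sum.cong) auto
      moreover have "Suc (n - 1) = n" using \<open>n \<ge> 2\<close> by simp
      ultimately show ?thesis using P_pos[rule_format, of x] that by simp
    qed
  qed
  obtain L1 L2 where L12: "L1 > 0" "L2 > 0" "\<And>x j. j \<in> {1..n} \<Longrightarrow> \<bar>f j x\<bar> \<le> L1 + L2 * \<bar>x\<bar> powr b j"
    using growth by blast
  define L where "L = 1 + L1 + L2"
  have phi_growth: "\<bar>\<phi> v j\<bar> \<le> L * exp (b (Suc j) * ln (max 1 \<bar>v\<bar>))" if j: "j < n" for v j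
  proof -
    have bj: "0 \<le> b (Suc j)" using X.b_pos[OF j] by simp
    define z where "z = max 1 \<bar>v\<bar> powr b (Suc j)"
    have "1 \<le> z" unfolding z_def using bj by (intro ge_one_powr_ge_zero) auto
    moreover have "\<bar>v\<bar> powr b (Suc j) \<le> z" unfolding z_def using bj by (intro powr_mono2) auto
    ultimately have "L1 * 1 + L2 * \<bar>v\<bar> powr b (Suc j) \<le> L1 * z + L2 * z"
      using L12 by (intro add_mono mult_left_mono) auto
    also have "\<dots> \<le> L * z" using \<open>1 \<le> z\<close> by (simp add: L_def algebra_simps)
    finally have "\<bar>\<phi> v j\<bar> \<le> L * z" using L12(3)[of "Suc j" v] j by (simp add: \<phi>_def)
    moreover have "z = exp (b (Suc j) * ln (max 1 \<bar>v\<bar>))" by (simp add: z_def powr_def)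
    ultimately show ?thesis by simp
  qed
  have sum_shift: "(\<Sum>j=1..n. h j) = (\<Sum>j<n. h (Suc j))" for h :: "nat \<Rightarrow> real"
    by (rule sum.reindex_bij_witness[of _ Suc "\<lambda>i. i - 1"]) auto
  obtain x where x: "\<And>r. r < n \<Longrightarrow> x r \<in> E" "rdet n (\<lambda>r. \<phi> (x r)) \<noteq> 0"
  proof (rule independent_functions_points[of E \<phi> n])
    fix c j assume c: "\<And>v. v \<in> E \<Longrightarrow> (\<Sum>j<n. c j * \<phi> v j) = 0" and j: "j < n"
    have "\<forall>v\<in>E. (\<Sum>j=1..n. c (j - 1) * f j v) = 0"
      using c unfolding sum_shift by (simp add: \<phi>_def)
    hence "\<forall>j\<in>{1..n}. c (j - 1) = 0"
      using A3[unfolded lin_indep_on_def, THEN spec[of _ "\<lambda>j. c (j - 1)"]] by blast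
    from bspec[OF this, of "Suc j"] show "c j = 0" using j by simp
  qed blast
  obtain g where g: "\<And>q r. q < n \<Longrightarrow> r < n \<Longrightarrow> (\<Sum>j<n. g q j * \<phi> (x r) j) = (if q = r then 1 else 0)"
    using dual_matrix[OF x(2)] by blast
  \<comment> \<open>All points whose dual coordinates differ from those of \<open>x r\<close> by
    less than \<open>1 / (2 * n)\<close>; over \<open>n\<close> coordinates this uses half of what
    diagonal dominance allows.\<close>
  define B where "B = (\<lambda>r. {v. \<forall>q<n. \<bar>(\<Sum>j<n. g q j * \<phi> v j) - (if q = r then 1 else 0)\<bar> < 1 / (2 * real n)})"
  have phi_meas: "(\<lambda>v. \<phi> v j) \<in> borel_measurable borel" if "j < n" for j
    using f_meas that by (auto simp: \<phi>_def)
  have B_meas: "B r \<in> sets borel" for r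
  proof -
    have [measurable]: "(\<lambda>v. \<Sum>j<n. g q j * \<phi> v j) \<in> borel_measurable borel" for q
      by (intro borel_measurable_sum borel_measurable_times phi_meas) auto
    show ?thesis unfolding B_def by measurable
  qed
  have B_interval: "\<exists>\<alpha> \<beta>. \<alpha> < \<beta> \<and> {\<alpha><..<\<beta>} \<subseteq> B r" if r: "r < n" for r
    unfolding B_def
  proof (rule interval_near_dual_points)
    show "isCont (\<lambda>v. \<phi> v j) (x r)" if "j < n" for j
    proof -
      have "C_k_on n (f (Suc j)) E" using f_smooth that by auto
      hence "((deriv ^^ 0) (f (Suc j))) field_differentiable (at (x r))"
        using x(1)[OF r] \<open>n \<ge> 2\<close> unfolding C_k_on_def by (metis not_numeral_le_zero not_gr_zero)
      thus ?thesis unfolding \<phi>_def using field_differentiable_imp_continuous_at by fastforce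
    qed
    show "0 < 1 / (2 * real n)" using \<open>n \<ge> 2\<close> by simp
  qed (use g r in auto)
  obtain K C0 where K: "X.contraction_window K C0" using X.contraction_window_exists by blast
  have indep: "indep_vars (\<lambda>_. borel) w {1..}"
    and law1: "\<And>t. 1 \<le> t \<Longrightarrow> distr M borel (w t) = distr M borel (w 1)"
    and law: "distributed M lborel (w 1) (\<lambda>x. ennreal (normal_density 0 \<sigma> x))"
    using A1 unfolding iid_normal_noise_def by blast+
  have law2: "distr M borel (w 1) = normal_law \<sigma>"
  proof -
    have "distr M borel (w 1) = distr M lborel (w 1)" by (rule distr_cong) auto
    thus ?thesis using law by (simp add: distributed_def)
  qed
  interpret GL: gaussian_loop n "\<lambda>j. b (Suc j)" K \<phi> B M \<sigma> w C0 L g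
  proof unfold_locales
    show "distr M borel (w t) = normal_law \<sigma>" if "1 \<le> t" for t using law1[OF that] law2 by simp
    show "1 \<le> L" using L12 by (simp add: L_def)
    show "\<bar>(\<Sum>j<n. g q j * \<phi> v j) - (if q = r then 1 else 0)\<bar> \<le> 1 / (2 * real n)"
      if "r < n" "q < n" "v \<in> B r" for r q v using that unfolding B_def by (auto simp: less_imp_le)
    show "B r \<in> sets borel" for r by (rule B_meas)
  qed (fact \<open>\<sigma> > 0\<close> indep K phi_meas B_interval phi_growth)+
  have ind: "indep_var (PiM {1..n} (\<lambda>_. borel)) (random_vector n \<theta>) (PiM {1..} (\<lambda>_. borel)) (noise_sequence w)"
    using A2 by (simp add: normal_parameter_def)
  show ?thesis
    unfolding as_globally_stabilizable_def
  proof (intro exI[of _ GL.feedback] conjI allI)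
    fix t
    show "GL.feedback t \<in> borel_measurable (PiM {..t} (\<lambda>_. borel))"
      using GL.measurable_feedback[of t "\<lambda>i y. y i" "PiM {..t} (\<lambda>_. borel)"] by simp
  next
    fix y\<^sub>0 :: real
    define y where "y = (\<lambda>t \<omega>. GL.outputs (\<lambda>j. \<theta> (Suc j) \<omega>) y\<^sub>0 (\<lambda>i. w i \<omega>) t)"
    define u where "u = (\<lambda>t \<omega>. GL.feedback t (\<lambda>i. y i \<omega>))"
    define Q where "Q = (\<lambda>\<theta>' w'. \<exists>C. \<forall>T\<ge>1. (\<Sum>i=1..T. (GL.outputs (\<lambda>j. \<theta>' (Suc j)) y\<^sub>0 w' i)\<^sup>2) \<le> C * real T)"
    \<comment> \<open>With a natural constant \<open>Q\<close> becomes a countable union of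
      measurable conditions.\<close>
    have Q_nat: "Q \<theta>' w' \<longleftrightarrow> (\<exists>C :: nat. \<forall>T\<ge>1. (\<Sum>i=1..T. (GL.outputs (\<lambda>j. \<theta>' (Suc j)) y\<^sub>0 w' i)\<^sup>2) \<le> real C * real T)"
      for \<theta>' w'
    proof
      assume "Q \<theta>' w'"
      then obtain C where C: "\<And>T. T \<ge> 1 \<Longrightarrow> (\<Sum>i=1..T. (GL.outputs (\<lambda>j. \<theta>' (Suc j)) y\<^sub>0 w' i)\<^sup>2) \<le> C * real T"
        unfolding Q_def by blast
      obtain N :: nat where "C \<le> real N" using real_arch_simple by blast
      hence "C * real T \<le> real N * real T" for T by (rule mult_right_mono) simp
      thus "\<exists>C :: nat. \<forall>T\<ge>1. (\<Sum>i=1..T. (GL.outputs (\<lambda>j. \<theta>' (Suc j)) y\<^sub>0 w' i)\<^sup>2) \<le> real C * real T"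
        using C order_trans by blast
    qed (auto simp: Q_def)
    have "AE \<omega> in M. Q (random_vector n \<theta> \<omega>) (noise_sequence w \<omega>)"
    proof (rule AE_of_independent_pair[OF \<open>prob_space M\<close> ind])
      let ?S = "PiM {1..n} (\<lambda>_. borel) \<Otimes>\<^sub>M PiM {1..} (\<lambda>_. borel) :: ((nat \<Rightarrow> real) \<times> (nat \<Rightarrow> real)) measure"
      have [measurable]: "(\<lambda>p. GL.outputs (\<lambda>j. fst p (Suc j)) y\<^sub>0 (snd p) i) \<in> borel_measurable ?S" for i
      proof (rule GL.measurable_outputs)
        show "(\<lambda>p. fst p (Suc j)) \<in> borel_measurable ?S" if "j < n" for j
          using that by (intro measurable_compose[OF measurable_fst measurable_component_singleton]) auto
        show "(\<lambda>p. snd p i) \<in> borel_measurable ?S" if "1 \<le> i" for i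
          using that by (intro measurable_compose[OF measurable_snd measurable_component_singleton]) auto
      qed
      show "{p \<in> space ?S. Q (fst p) (snd p)} \<in> sets ?S" unfolding Q_nat by measurable
      fix \<theta>' :: "nat \<Rightarrow> real"
      \<comment> \<open>Outputs read the noise at indices from 1 on, where the restricted sequence
        agrees with \<open>w\<close>.\<close>
      have "GL.outputs (\<lambda>j. \<theta>' (Suc j)) y\<^sub>0 (noise_sequence w \<omega>) i = GL.outputs (\<lambda>j. \<theta>' (Suc j)) y\<^sub>0 (\<lambda>i. w i \<omega>) i" for \<omega> i
        by (rule GL.outputs_cong) (auto simp: noise_sequence_def)
      thus "AE \<omega> in M. Q \<theta>' (noise_sequence w \<omega>)" using GL.AE_stable by (simp add: Q_def)
    qed
    moreover have "GL.outputs (\<lambda>j. random_vector n \<theta> \<omega> (Suc j)) y\<^sub>0 (noise_sequence w \<omega>) i = y i \<omega>" for \<omega> i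
      unfolding y_def by (rule GL.outputs_cong) (auto simp: noise_sequence_def random_vector_def)
    ultimately have "AE \<omega> in M. \<exists>C. \<forall>T\<ge>1. (\<Sum>i=1..T. (y i \<omega>)\<^sup>2) \<le> C * real T" by (simp add: Q_def)
    hence AE_fin: "AE \<omega> in M. (SUP t\<in>{1..}. ereal (1 / real t * (\<Sum>i=1..t. (y i \<omega>)\<^sup>2))) < \<infinity>"
    proof eventually_elim
      case (elim \<omega>)
      then obtain C where C: "\<And>T. T \<ge> 1 \<Longrightarrow> (\<Sum>i=1..T. (y i \<omega>)\<^sup>2) \<le> C * real T" by blast
      have "(SUP t\<in>{1..}. ereal (1 / real t * (\<Sum>i=1..t. (y i \<omega>)\<^sup>2))) \<le> ereal C"
        using C by (intro SUP_least) (auto simp: divide_le_eq)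
      thus ?case by (rule order.strict_trans1) simp
    qed
    have y_meas: "y i \<in> borel_measurable (output_sigma M y t)" if "i \<le> t" for i t
    proof (rule measurableI)
      have sub: "{y i -` B \<inter> space M | i B. i \<le> t \<and> B \<in> sets borel} \<subseteq> Pow (space M)" by auto
      fix A :: "real set" assume "A \<in> sets borel"
      hence "y i -` A \<inter> space M \<in> {y i -` B \<inter> space M | i B. i \<le> t \<and> B \<in> sets borel}" using that by blast
      thus "y i -` A \<inter> space (output_sigma M y t) \<in> sets (output_sigma M y t)"
        unfolding output_sigma_def using sub by (simp add: space_measure_of sets_measure_of)
    qed simp
    show "\<exists>u y. system_trajectory M n f \<theta> w y\<^sub>0 u y \<and>
           (\<forall>t. \<forall>\<omega>\<in>space M. u t \<omega> = GL.feedback t (\<lambda>i\<in>{..t}. y i \<omega>)) \<and>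
           (\<forall>t. u t \<in> borel_measurable (output_sigma M y t)) \<and>
           (AE \<omega> in M. (SUP t\<in>{1..}. ereal (1 / real t * (\<Sum>i=1..t. (y i \<omega>)\<^sup>2))) < \<infinity>)"
    proof (rule exI[of _ u], rule exI[of _ y], intro conjI allI ballI AE_fin)
      show "system_trajectory M n f \<theta> w y\<^sub>0 u y"
        unfolding system_trajectory_def sum_shift phi_eq by (simp add: y_def u_def GL.outputs_Suc)
      show "u t \<omega> = GL.feedback t (\<lambda>i\<in>{..t}. y i \<omega>)" for t \<omega>
        unfolding u_def by (rule GL.feedback_cong) simp
      show "u t \<in> borel_measurable (output_sigma M y t)" for t
        unfolding u_def by (rule GL.measurable_feedback) (rule y_meas)
    qed
  qed
qed

end
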